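(* Let $B\in\mathcal{O}_{\mathfrak{b}}$ be a nontrivial simple $\mathfrak{b}$-module and let $W,W_1\in\mathcal{O}_{\mathfrak{W}}$ be nontrivial simple $\mathfrak{W}$-modules. Then: (1) $\mathrm{Ind}_{\mathfrak{b}}^{\mathfrak{W}}(B)$ is a simple module in $\mathcal{O}_{\mathfrak{W}}$. (2) $\mathrm{Soc}_{\mathfrak{b}}(W)$ is a simple $\mathfrak{b}$-module, and it is an essential $\mathfrak{b}$-submodule of $W$, i.e. it is the intersection of all nonzero $\mathfrak{b}$-submodules of $W$. (3) $W\cong \mathrm{Ind}_{\mathfrak{b}}^{\mathfrak{W}}\mathrm{Soc}_{\mathfrak{b}}(W)$ and $B=\mathrm{Soc}_{\mathfrak{b}}(\mathrm{Ind}_{\mathfrak{b}}^{\mathfrak{W}}B)$ (where $B$ is identified with $1\otimes B$). (4) $W\cong W_1$ as $\mathfrak{W}$-modules if and only if $\mathrm{Soc}_{\mathfrak{b}}(W)\cong \mathrm{Soc}_{\mathfrak{b}}(W_1)$ as $\mathfrak{b}$-modules. Consequently, $W$ is the induced module (from $\mathfrak{b}$ to $\mathfrak{W}$) of a simple $\mathfrak{a}_r$-module for some $r\in\mathbb{N}$.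
   Context: $\mathbb{N}$ is the set of positive integers. All Lie algebras and modules are over $\mathbb{C}$. $\mathfrak{W}=\mathrm{Der}(\mathbb{C}[t])$ has basis $\{d_i : i\ge -1\}$, $d_i=t^{i+1}\frac{d}{dt}$, with bracket $[d_n,d_m]=(m-n)d_{m+n}$; $\mathfrak{b}=\mathrm{span}\{d_i : i\ge 0\}$; for $r\in\mathbb{Z}_{\ge 0}$, $\mathfrak{V}^{(r)}=\mathrm{span}\{d_i : i\ge r\}$ and $\mathfrak{a}_r=\mathfrak{b}/\mathfrak{V}^{(r+1)}$ (an $\mathfrak{a}_r$-module is regarded as a $\mathfrak{b}$-module via the quotient map). $\mathcal{O}_{\mathfrak{W}}$ (resp. $\mathcal{O}_{\mathfrak{b}}$) is the category of all $\mathfrak{W}$-modules (resp. $\mathfrak{b}$-modules) $M$ such that for every $w\in M$ there is a nonnegative integer $n$ (depending on $w$) with $d_iw=0$ for all $i\ge n$. A module $V$ over a Lie algebra $L$ is trivial if $LV=0$, and nontrivial otherwise. $\mathrm{Soc}_{L}(V)$ is the sum of the minimal nonzero $L$-submodules of $V$. $\mathrm{Ind}_{\mathfrak{b}}^{\mathfrak{W}}(B)=U(\mathfrak{W})\otimes_{U(\mathfrak{b})}B$. *)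

theory Defs
  imports
    "HOL-Computational_Algebra.Polynomial"
    "HOL-Algebra.QuotRing"
    "HOL-Algebra.Module"
    "HOL-Algebra.Generated_Groups"
    "HOL-Algebra.Free_Abelian_Groups"
    Complex_Main
begin

section \<open>Lie algebras and their modules over the complex numbers\<close>

definition complex_ring :: "complex ring" where
  "complex_ring = \<lparr>carrier = UNIV, monoid.mult = (*), one = 1, ring.zero = 0, add = (+)\<rparr>"

text \<open>As usual for modules in \<^verbatim>\<open>HOL-Algebra\<close>, the fields \<^const>\<open>monoid.mult\<close> and
  \<^const>\<open>monoid.one\<close> inherited from the ring record carry no meaning in the two records below.\<close>

record 'l lie_alg = "(complex, 'l) module" +
  bracket :: "'l \<Rightarrow> 'l \<Rightarrow> 'l"

record ('l, 'v) lie_mod = "(complex, 'v) module" +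
  act :: "'l \<Rightarrow> 'v \<Rightarrow> 'v"  (infixr \<open>\<rhd>\<index>\<close> 75)

locale lie_algebra = Module.module complex_ring L for L :: "'l lie_alg" (structure) +
  assumes bracket_closed:
      "\<lbrakk>x \<in> carrier L; y \<in> carrier L\<rbrakk> \<Longrightarrow> bracket L x y \<in> carrier L"
    and bracket_add_left:
      "\<lbrakk>x \<in> carrier L; y \<in> carrier L; z \<in> carrier L\<rbrakk> \<Longrightarrow>
        bracket L (x \<oplus> y) z = bracket L x z \<oplus> bracket L y z"
    and bracket_add_right:
      "\<lbrakk>x \<in> carrier L; y \<in> carrier L; z \<in> carrier L\<rbrakk> \<Longrightarrow>
        bracket L x (y \<oplus> z) = bracket L x y \<oplus> bracket L x z"
    and bracket_smult_left:
      "\<lbrakk>x \<in> carrier L; y \<in> carrier L\<rbrakk> \<Longrightarrow> bracket L (c \<odot> x) y = c \<odot> bracket L x y"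
    and bracket_smult_right:
      "\<lbrakk>x \<in> carrier L; y \<in> carrier L\<rbrakk> \<Longrightarrow> bracket L x (c \<odot> y) = c \<odot> bracket L x y"
    and bracket_self: "x \<in> carrier L \<Longrightarrow> bracket L x x = \<zero>"
    and jacobi:
      "\<lbrakk>x \<in> carrier L; y \<in> carrier L; z \<in> carrier L\<rbrakk> \<Longrightarrow>
        bracket L x (bracket L y z) \<oplus> bracket L y (bracket L z x) \<oplus> bracket L z (bracket L x y) = \<zero>"

locale lie_module = lie_algebra L + V?: Module.module complex_ring V
  for L :: "'l lie_alg" (structure) and V :: "('l, 'v) lie_mod" (structure) +
  assumes act_closed: "\<lbrakk>x \<in> carrier L; v \<in> carrier V\<rbrakk> \<Longrightarrow> x \<rhd>\<^bsub>V\<^esub> v \<in> carrier V"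
    and act_add_left:
      "\<lbrakk>x \<in> carrier L; y \<in> carrier L; v \<in> carrier V\<rbrakk> \<Longrightarrow>
        (x \<oplus>\<^bsub>L\<^esub> y) \<rhd>\<^bsub>V\<^esub> v = x \<rhd>\<^bsub>V\<^esub> v \<oplus>\<^bsub>V\<^esub> y \<rhd>\<^bsub>V\<^esub> v"
    and act_add_right:
      "\<lbrakk>x \<in> carrier L; v \<in> carrier V; w \<in> carrier V\<rbrakk> \<Longrightarrow>
        x \<rhd>\<^bsub>V\<^esub> (v \<oplus>\<^bsub>V\<^esub> w) = x \<rhd>\<^bsub>V\<^esub> v \<oplus>\<^bsub>V\<^esub> x \<rhd>\<^bsub>V\<^esub> w"
    and act_smult_left:
      "\<lbrakk>x \<in> carrier L; v \<in> carrier V\<rbrakk> \<Longrightarrow> (c \<odot>\<^bsub>L\<^esub> x) \<rhd>\<^bsub>V\<^esub> v = c \<odot>\<^bsub>V\<^esub> (x \<rhd>\<^bsub>V\<^esub> v)"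
    and act_smult_right:
      "\<lbrakk>x \<in> carrier L; v \<in> carrier V\<rbrakk> \<Longrightarrow> x \<rhd>\<^bsub>V\<^esub> (c \<odot>\<^bsub>V\<^esub> v) = c \<odot>\<^bsub>V\<^esub> (x \<rhd>\<^bsub>V\<^esub> v)"
    and act_bracket:
      "\<lbrakk>x \<in> carrier L; y \<in> carrier L; v \<in> carrier V\<rbrakk> \<Longrightarrow>
        bracket L x y \<rhd>\<^bsub>V\<^esub> v = (x \<rhd>\<^bsub>V\<^esub> y \<rhd>\<^bsub>V\<^esub> v) \<ominus>\<^bsub>V\<^esub> (y \<rhd>\<^bsub>V\<^esub> x \<rhd>\<^bsub>V\<^esub> v)"

definition lie_submodule :: "'l lie_alg \<Rightarrow> 'v set \<Rightarrow> ('l, 'v) lie_mod \<Rightarrow> bool" where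
  "lie_submodule L N V \<longleftrightarrow>
     submodule N complex_ring V \<and> (\<forall>x\<in>carrier L. \<forall>v\<in>N. x \<rhd>\<^bsub>V\<^esub> v \<in> N)"

definition simple_lie_module :: "'l lie_alg \<Rightarrow> ('l, 'v) lie_mod \<Rightarrow> bool" where
  "simple_lie_module L V \<longleftrightarrow> lie_module L V \<and> carrier V \<noteq> {\<zero>\<^bsub>V\<^esub>} \<and>
     (\<forall>N. lie_submodule L N V \<longrightarrow> N = {\<zero>\<^bsub>V\<^esub>} \<or> N = carrier V)"

definition trivial_lie_module :: "'l lie_alg \<Rightarrow> ('l, 'v) lie_mod \<Rightarrow> bool" where
  "trivial_lie_module L V \<longleftrightarrow> (\<forall>x\<in>carrier L. \<forall>v\<in>carrier V. x \<rhd>\<^bsub>V\<^esub> v = \<zero>\<^bsub>V\<^esub>)"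

definition minimal_lie_submodule :: "'l lie_alg \<Rightarrow> 'v set \<Rightarrow> ('l, 'v) lie_mod \<Rightarrow> bool" where
  "minimal_lie_submodule L N V \<longleftrightarrow> lie_submodule L N V \<and> N \<noteq> {\<zero>\<^bsub>V\<^esub>} \<and>
     (\<forall>N'. lie_submodule L N' V \<and> N' \<subseteq> N \<longrightarrow> N' = {\<zero>\<^bsub>V\<^esub>} \<or> N' = N)"

definition lin_span :: "(complex, 'v, 'm) module_scheme \<Rightarrow> 'v set \<Rightarrow> 'v set" where
  "lin_span V S = (\<lambda>N. submodule N complex_ring V) hull S"

text \<open>The sum of a family of subspaces is the linear span of their union.\<close>

definition lie_socle :: "'l lie_alg \<Rightarrow> ('l, 'v) lie_mod \<Rightarrow> 'v set" where
  "lie_socle L V = lin_span V (\<Union>{N. minimal_lie_submodule L N V})"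

definition socle_module :: "'l lie_alg \<Rightarrow> ('l, 'v) lie_mod \<Rightarrow> ('l, 'v) lie_mod" where
  "socle_module L V = V\<lparr>carrier := lie_socle L V\<rparr>"

definition lie_mod_iso :: "'l lie_alg \<Rightarrow> ('l, 'v) lie_mod \<Rightarrow> ('l, 'w) lie_mod \<Rightarrow> ('v \<Rightarrow> 'w) set" where
  "lie_mod_iso L V W = {f. bij_betw f (carrier V) (carrier W) \<and>
     (\<forall>v\<in>carrier V. \<forall>w\<in>carrier V. f (v \<oplus>\<^bsub>V\<^esub> w) = f v \<oplus>\<^bsub>W\<^esub> f w) \<and>
     (\<forall>c. \<forall>v\<in>carrier V. f (c \<odot>\<^bsub>V\<^esub> v) = c \<odot>\<^bsub>W\<^esub> f v) \<and>
     (\<forall>x\<in>carrier L. \<forall>v\<in>carrier V. f (x \<rhd>\<^bsub>V\<^esub> v) = x \<rhd>\<^bsub>W\<^esub> f v)}"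

definition lie_mod_isomorphic :: "'l lie_alg \<Rightarrow> ('l, 'v) lie_mod \<Rightarrow> ('l, 'w) lie_mod \<Rightarrow> bool" where
  "lie_mod_isomorphic L V W \<longleftrightarrow> lie_mod_iso L V W \<noteq> {}"

definition quot_lie_alg :: "'l lie_alg \<Rightarrow> 'l set \<Rightarrow> 'l set lie_alg" where
  "quot_lie_alg L I = \<lparr>carrier = a_rcosets\<^bsub>L\<^esub> I, monoid.mult = undefined, one = undefined,
     ring.zero = I, add = set_add L,
     smult = (\<lambda>c X. \<Union>x\<in>X. I +>\<^bsub>L\<^esub> (c \<odot>\<^bsub>L\<^esub> x)),
     bracket = (\<lambda>X Y. \<Union>x\<in>X. \<Union>y\<in>Y. I +>\<^bsub>L\<^esub> bracket L x y)\<rparr>"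

definition pullback_lie_mod :: "('k \<Rightarrow> 'l) \<Rightarrow> ('l, 'v) lie_mod \<Rightarrow> ('k, 'v) lie_mod" where
  "pullback_lie_mod f A = \<lparr>carrier = carrier A, monoid.mult = monoid.mult A, one = one A,
     ring.zero = ring.zero A, add = add A, smult = smult A, act = (\<lambda>x. act A (f x))\<rparr>"

section \<open>The universal enveloping algebra\<close>

text \<open>\<^verbatim>\<open>U(L)\<close> is the quotient of the free associative unital algebra on the set \<^verbatim>\<open>L\<close> by the
  ideal generated by \<^verbatim>\<open>[x + y] - [x] - [y]\<close>, \<^verbatim>\<open>[cx] - c[x]\<close> (which yield the tensor algebra)
  and \<^verbatim>\<open>[x][y] - [y][x] - [[x,y]]\<close>. The free algebra consists of the finitely supported
  functions on words, with multiplication induced by concatenation.\<close>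

definition free_alg :: "'l lie_alg \<Rightarrow> ('l list \<Rightarrow> complex) ring" where
  "free_alg L = \<lparr>carrier = {a. finite {w. a w \<noteq> 0} \<and> {w. a w \<noteq> 0} \<subseteq> lists (carrier L)},
     monoid.mult = (\<lambda>a b w. \<Sum>k\<le>length w. a (take k w) * b (drop k w)),
     one = (\<lambda>w. if w = [] then 1 else 0),
     ring.zero = (\<lambda>w. 0),
     add = (\<lambda>a b w. a w + b w)\<rparr>"

definition free_const :: "complex \<Rightarrow> 'l list \<Rightarrow> complex" where
  "free_const c = (\<lambda>w. if w = [] then c else 0)"

definition free_gen :: "'l \<Rightarrow> 'l list \<Rightarrow> complex" where
  "free_gen x = (\<lambda>w. if w = [x] then 1 else 0)"

definition uea_ideal :: "'l lie_alg \<Rightarrow> ('l list \<Rightarrow> complex) set" where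
  "uea_ideal L = (let F = free_alg L in Idl\<^bsub>F\<^esub>
     ({free_gen (x \<oplus>\<^bsub>L\<^esub> y) \<ominus>\<^bsub>F\<^esub> (free_gen x \<oplus>\<^bsub>F\<^esub> free_gen y) | x y.
         x \<in> carrier L \<and> y \<in> carrier L} \<union>
      {free_gen (c \<odot>\<^bsub>L\<^esub> x) \<ominus>\<^bsub>F\<^esub> (free_const c \<otimes>\<^bsub>F\<^esub> free_gen x) | c x. x \<in> carrier L} \<union>
      {(free_gen x \<otimes>\<^bsub>F\<^esub> free_gen y \<ominus>\<^bsub>F\<^esub> free_gen y \<otimes>\<^bsub>F\<^esub> free_gen x) \<ominus>\<^bsub>F\<^esub> free_gen (bracket L x y)
        | x y. x \<in> carrier L \<and> y \<in> carrier L}))"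

definition uea :: "'l lie_alg \<Rightarrow> ('l list \<Rightarrow> complex) set ring" where
  "uea L = free_alg L Quot uea_ideal L"

definition uea_class :: "'l lie_alg \<Rightarrow> ('l list \<Rightarrow> complex) \<Rightarrow> ('l list \<Rightarrow> complex) set" where
  "uea_class L a = uea_ideal L +>\<^bsub>free_alg L\<^esub> a"

text \<open>The algebra map from \<^verbatim>\<open>U(K)\<close> to \<^verbatim>\<open>U(L)\<close> induced by the inclusion of a subalgebra \<^verbatim>\<open>K\<close>
  of \<^verbatim>\<open>L\<close>; all representatives of a coset in \<^verbatim>\<open>U(K)\<close> have the same class in \<^verbatim>\<open>U(L)\<close>.\<close>

definition uea_incl :: "'l lie_alg \<Rightarrow> ('l list \<Rightarrow> complex) set \<Rightarrow> ('l list \<Rightarrow> complex) set" where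
  "uea_incl L X = (\<Union>a\<in>X. uea_class L a)"

definition free_act :: "('l, 'v) lie_mod \<Rightarrow> ('l list \<Rightarrow> complex) \<Rightarrow> 'v \<Rightarrow> 'v" where
  "free_act V a v = (\<Oplus>\<^bsub>V\<^esub>w\<in>{w. a w \<noteq> 0}. a w \<odot>\<^bsub>V\<^esub> foldr (act V) w v)"

text \<open>The action of \<^verbatim>\<open>U(L)\<close> on an \<^verbatim>\<open>L\<close>-module; \<^const>\<open>free_act\<close> takes the same value at all
  representatives of a coset.\<close>

definition uea_act :: "('l, 'v) lie_mod \<Rightarrow> ('l list \<Rightarrow> complex) set \<Rightarrow> 'v \<Rightarrow> 'v" where
  "uea_act V X v = the_elem ((\<lambda>a. free_act V a v) ` X)"

section \<open>Tensor products and induced modules\<close>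

text \<open>The tensor product over a (noncommutative) ring \<^verbatim>\<open>R\<close> of a right module \<^verbatim>\<open>M\<close> and a left
  module \<^verbatim>\<open>N\<close> is the quotient of the free abelian group on pairs by the subgroup generated by
  the relators below.\<close>

definition tensor_relators ::
  "('r, 'a) ring_scheme \<Rightarrow> ('m, 'b) ring_scheme \<Rightarrow> ('m \<Rightarrow> 'r \<Rightarrow> 'm) \<Rightarrow>
   ('n, 'c) ring_scheme \<Rightarrow> ('r \<Rightarrow> 'n \<Rightarrow> 'n) \<Rightarrow> ('m \<times> 'n \<Rightarrow>\<^sub>0 int) set" where
  "tensor_relators R M rmul N lmul =
     {frag_of (m \<oplus>\<^bsub>M\<^esub> m', n) - frag_of (m, n) - frag_of (m', n) | m m' n.
        m \<in> carrier M \<and> m' \<in> carrier M \<and> n \<in> carrier N} \<union>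
     {frag_of (m, n \<oplus>\<^bsub>N\<^esub> n') - frag_of (m, n) - frag_of (m, n') | m n n'.
        m \<in> carrier M \<and> n \<in> carrier N \<and> n' \<in> carrier N} \<union>
     {frag_of (rmul m r, n) - frag_of (m, lmul r n) | m r n.
        m \<in> carrier M \<and> r \<in> carrier R \<and> n \<in> carrier N}"

definition ind_free ::
  "'l lie_alg \<Rightarrow> ('l, 'v) lie_mod \<Rightarrow> (('l list \<Rightarrow> complex) set \<times> 'v \<Rightarrow>\<^sub>0 int) monoid" where
  "ind_free L B = free_Abelian_group (carrier (uea L) \<times> carrier B)"

definition ind_rel ::
  "'l lie_alg \<Rightarrow> 'l lie_alg \<Rightarrow> ('l, 'v) lie_mod \<Rightarrow> (('l list \<Rightarrow> complex) set \<times> 'v \<Rightarrow>\<^sub>0 int) set" where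
  "ind_rel K L B = generate (ind_free L B)
     (tensor_relators (uea K) (uea L) (\<lambda>u k. u \<otimes>\<^bsub>uea L\<^esub> uea_incl L k) B (uea_act B))"

definition ind_tensor ::
  "'l lie_alg \<Rightarrow> 'l lie_alg \<Rightarrow> ('l, 'v) lie_mod \<Rightarrow> ('l list \<Rightarrow> complex) set \<Rightarrow> 'v \<Rightarrow>
   (('l list \<Rightarrow> complex) set \<times> 'v \<Rightarrow>\<^sub>0 int) set" where
  "ind_tensor K L B u v = ind_rel K L B #>\<^bsub>ind_free L B\<^esub> frag_of (u, v)"

text \<open>Left multiplication by \<^verbatim>\<open>u\<close> in \<^verbatim>\<open>U(L)\<close> on cosets, induced by sending a pair
  \<^verbatim>\<open>(u', v)\<close> to \<^verbatim>\<open>(u u', v)\<close>.\<close>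

definition ind_uea_act ::
  "'l lie_alg \<Rightarrow> 'l lie_alg \<Rightarrow> ('l, 'v) lie_mod \<Rightarrow> ('l list \<Rightarrow> complex) set \<Rightarrow>
   (('l list \<Rightarrow> complex) set \<times> 'v \<Rightarrow>\<^sub>0 int) set \<Rightarrow> (('l list \<Rightarrow> complex) set \<times> 'v \<Rightarrow>\<^sub>0 int) set" where
  "ind_uea_act K L B u X =
     (\<Union>f\<in>X. ind_rel K L B #>\<^bsub>ind_free L B\<^esub>
        frag_extend (\<lambda>(u', v). frag_of (u \<otimes>\<^bsub>uea L\<^esub> u', v)) f)"

definition ind ::
  "'l lie_alg \<Rightarrow> 'l lie_alg \<Rightarrow> ('l, 'v) lie_mod \<Rightarrow>
   ('l, (('l list \<Rightarrow> complex) set \<times> 'v \<Rightarrow>\<^sub>0 int) set) lie_mod" where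
  "ind K L B = \<lparr>carrier = carrier (ind_free L B Mod ind_rel K L B),
     monoid.mult = undefined, one = undefined,
     ring.zero = monoid.one (ind_free L B Mod ind_rel K L B),
     add = monoid.mult (ind_free L B Mod ind_rel K L B),
     smult = (\<lambda>c. ind_uea_act K L B (uea_class L (free_const c))),
     act = (\<lambda>x. ind_uea_act K L B (uea_class L (free_gen x)))\<rparr>"

definition ind_unit ::
  "'l lie_alg \<Rightarrow> 'l lie_alg \<Rightarrow> ('l, 'v) lie_mod \<Rightarrow> 'v \<Rightarrow>
   (('l list \<Rightarrow> complex) set \<times> 'v \<Rightarrow>\<^sub>0 int) set" where
  "ind_unit K L B v = ind_tensor K L B \<one>\<^bsub>uea L\<^esub> v"

section \<open>The Lie algebra of derivations of the polynomial ring\<close>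

type_synonym poly_op = "complex poly \<Rightarrow> complex poly"

definition poly_derivation :: "poly_op \<Rightarrow> bool" where
  "poly_derivation D \<longleftrightarrow> (\<forall>p q. D (p + q) = D p + D q) \<and>
     (\<forall>c p. D (Polynomial.smult c p) = Polynomial.smult c (D p)) \<and>
     (\<forall>p q. D (p * q) = D p * q + p * D q)"

definition witt :: "poly_op lie_alg" where
  "witt = \<lparr>carrier = {D. poly_derivation D}, monoid.mult = undefined, one = undefined,
     ring.zero = (\<lambda>p. 0), add = (\<lambda>D E p. D p + E p),
     smult = (\<lambda>c D p. Polynomial.smult c (D p)),
     bracket = (\<lambda>D E p. D (E p) - E (D p))\<rparr>"

text \<open>\<^verbatim>\<open>d i = t^(i+1) d/dt\<close>, meaningful only for \<^verbatim>\<open>i \<ge> -1\<close>.\<close>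

definition witt_d :: "int \<Rightarrow> poly_op" where
  "witt_d i = (\<lambda>p. Polynomial.monom 1 (nat (i + 1)) * pderiv p)"

definition witt_b :: "poly_op lie_alg" where
  "witt_b = witt\<lparr>carrier := lin_span witt {witt_d i | i. i \<ge> 0}\<rparr>"

definition witt_V :: "nat \<Rightarrow> poly_op set" where
  "witt_V r = lin_span witt {witt_d i | i. i \<ge> int r}"

definition witt_a :: "nat \<Rightarrow> poly_op set lie_alg" where
  "witt_a r = quot_lie_alg witt_b (witt_V (r + 1))"

definition inflate :: "nat \<Rightarrow> (poly_op set, 'v) lie_mod \<Rightarrow> (poly_op, 'v) lie_mod" where
  "inflate r = pullback_lie_mod (\<lambda>x. witt_V (r + 1) +>\<^bsub>witt_b\<^esub> x)"

text \<open>Used with \<^verbatim>\<open>L\<close> either \<^const>\<open>witt\<close> or \<^const>\<open>witt_b\<close>.\<close>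

definition in_cat_O :: "poly_op lie_alg \<Rightarrow> (poly_op, 'v) lie_mod \<Rightarrow> bool" where
  "in_cat_O L M \<longleftrightarrow> lie_module L M \<and>
     (\<forall>w\<in>carrier M. \<exists>n::nat. \<forall>i\<ge>int n. witt_d i \<rhd>\<^bsub>M\<^esub> w = \<zero>\<^bsub>M\<^esub>)"

abbreviation Ind_W :: "(poly_op, 'v) lie_mod \<Rightarrow>
    (poly_op, ((poly_op list \<Rightarrow> complex) set \<times> 'v \<Rightarrow>\<^sub>0 int) set) lie_mod" where
  "Ind_W B \<equiv> ind witt_b witt B"

section \<open>Basic facts about the derivation algebra and its subalgebras\<close>

lemma witt_d_bracket:
  assumes "n \<ge> -1" "m \<ge> -1" "n + m \<ge> -1"
  shows "bracket witt (witt_d n) (witt_d m) = of_int (m - n) \<odot>\<^bsub>witt\<^esub> witt_d (m + n)"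
proof
  fix p
  define k l where "k = nat (n + 1)" and "l = nat (m + 1)"
  have kl: "n = int k - 1" "m = int l - 1" "k + l \<ge> 1" using assms by (auto simp: k_def l_def)
  have e: "nat (m + n + 1) = k + l - 1" using kl by simp
  have "bracket witt (witt_d n) (witt_d m) p =
     (Polynomial.monom 1 k * pderiv (Polynomial.monom 1 l) - Polynomial.monom 1 l * pderiv (Polynomial.monom 1 k)) * pderiv p"
    by (simp add: witt_def witt_d_def pderiv_mult algebra_simps k_def l_def)
  also have "Polynomial.monom 1 k * pderiv (Polynomial.monom 1 l) - Polynomial.monom 1 l * pderiv (Polynomial.monom 1 k)
     = Polynomial.monom (of_int (m - n) :: complex) (k + l - 1)"
    using kl by (cases k; cases l) (auto simp: pderiv_monom mult_monom diff_monom minus_monom algebra_simps)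
  finally show "bracket witt (witt_d n) (witt_d m) p = (of_int (m - n) \<odot>\<^bsub>witt\<^esub> witt_d (m + n)) p"
    by (simp add: witt_def witt_d_def e smult_monom flip: mult_smult_left)
qed

lemma cring_complex: "cring complex_ring"
proof (rule cringI)
  show "abelian_group complex_ring"
  proof (rule abelian_groupI, goal_cases)
    case (6 x)
    then show ?case by (intro bexI[of _ "- x"]) (auto simp: complex_ring_def)
  qed (auto simp: complex_ring_def)
  show "Group.comm_monoid complex_ring"
    by (rule comm_monoidI) (auto simp: complex_ring_def)
qed (auto simp: complex_ring_def algebra_simps)

lemma poly_derivation_0 [simp]: "poly_derivation D \<Longrightarrow> D 0 = 0"
  unfolding poly_derivation_def by (metis add_cancel_right_left)

lemma poly_derivation_minus: "poly_derivation D \<Longrightarrow> D (p - q) = D p - D q"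
  unfolding poly_derivation_def by (metis add_diff_cancel_right' diff_add_cancel)

lemma abelian_group_witt: "abelian_group witt"
proof (rule abelian_groupI, goal_cases)
  case (6 x)
  then show ?case
    by (intro bexI[of _ "\<lambda>p. - x p"]) (auto simp: witt_def poly_derivation_def algebra_simps)
qed (auto simp: witt_def poly_derivation_def algebra_simps smult_add_right fun_eq_iff)

lemma module_witt: "Module.module complex_ring witt"
  by (rule Module.moduleI[OF cring_complex abelian_group_witt])
    (auto simp: witt_def complex_ring_def poly_derivation_def algebra_simps smult_add_right smult_add_left fun_eq_iff)

lemma lie_algebra_witt: "lie_algebra witt"
proof (intro lie_algebra.intro module_witt lie_algebra_axioms.intro, goal_cases)
  case (1 x y)
  then show ?case
    by (auto simp: witt_def poly_derivation_def algebra_simps smult_diff_right)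
qed (auto simp: witt_def poly_derivation_minus fun_eq_iff,
     auto simp: poly_derivation_def algebra_simps smult_diff_right)

lemma witt_carrier_iff: "D \<in> carrier witt \<longleftrightarrow> (\<exists>f. D = (\<lambda>p. f * pderiv p))"
proof
  assume "D \<in> carrier witt"
  then have d: "poly_derivation D" by (simp add: witt_def)
  then have m: "\<And>p q. D (p * q) = D p * q + p * D q" and a: "\<And>p q. D (p + q) = D p + D q"
    and s: "\<And>c p. D (Polynomial.smult c p) = Polynomial.smult c (D p)" by (auto simp: poly_derivation_def)
  have "D 1 = 0" using m[of 1 1] by simp
  then have c: "D [:c:] = 0" for c using s[of c 1] by simp
  have "D p = D [:0,1:] * pderiv p" for p
  proof (induction p)
    case 0 show ?case using d by simp
  next
    case (pCons b p)
    have "pCons b p = [:b:] + [:0,1:] * p" by simp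
    then have "D (pCons b p) = D [:0,1:] * p + [:0,1:] * D p" by (simp only: a m c) simp
    then show ?case using pCons by (simp add: pderiv_pCons algebra_simps)
  qed
  then show "\<exists>f. D = (\<lambda>p. f * pderiv p)" by blast
qed (auto simp: witt_def poly_derivation_def pderiv_add pderiv_smult pderiv_mult algebra_simps)


lemma witt_inv: "D \<in> carrier witt \<Longrightarrow> \<ominus>\<^bsub>witt\<^esub> D = (\<lambda>p. - D p)"
  by (rule abelian_group.minus_equality[OF abelian_group_witt])
    (auto simp: witt_def poly_derivation_def fun_eq_iff)

lemma submodule_witt_dvd:
  "submodule {(\<lambda>p. f * pderiv p) | f. Polynomial.monom 1 n dvd f} complex_ring witt" (is "submodule ?V _ _")
proof (rule Module.module.submoduleI[OF module_witt])
  show V: "?V \<subseteq> carrier witt" using witt_carrier_iff by blast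
  show "\<zero>\<^bsub>witt\<^esub> \<in> ?V" by (auto simp: witt_def intro!: exI[of _ 0])
  fix a b assume a: "a \<in> ?V"
  then obtain f where f: "a = (\<lambda>p. f * pderiv p)" "Polynomial.monom 1 n dvd f" by auto
  then have "\<ominus>\<^bsub>witt\<^esub> a = (\<lambda>p. (- f) * pderiv p)" using witt_inv[of a] V a by auto
  then show "\<ominus>\<^bsub>witt\<^esub> a \<in> ?V" using f by (auto intro!: exI[of _ "- f"])
  assume "b \<in> ?V"
  then obtain g where g: "b = (\<lambda>p. g * pderiv p)" "Polynomial.monom 1 n dvd g" by auto
  have "a \<oplus>\<^bsub>witt\<^esub> b = (\<lambda>p. (f + g) * pderiv p)" by (simp add: witt_def f g algebra_simps)
  then show "a \<oplus>\<^bsub>witt\<^esub> b \<in> ?V" using f g by (auto intro!: exI[of _ "f + g"] dvd_add)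
next
  fix c :: complex and a assume "a \<in> ?V"
  then obtain f where f: "a = (\<lambda>p. f * pderiv p)" "Polynomial.monom 1 n dvd f" by auto
  have "c \<odot>\<^bsub>witt\<^esub> a = (\<lambda>p. (Polynomial.smult c f) * pderiv p)" by (simp add: witt_def f)
  then show "c \<odot>\<^bsub>witt\<^esub> a \<in> ?V" using f by (auto intro!: exI[of _ "Polynomial.smult c f"] dvd_smult)
qed

lemma witt_V_eq: "witt_V r = {(\<lambda>p. f * pderiv p) | f. Polynomial.monom 1 (r+1) dvd f}" (is "_ = ?V")
  unfolding witt_V_def lin_span_def
proof (rule hull_unique)
  show "{witt_d i |i. int r \<le> i} \<subseteq> ?V"
  proof safe
    fix i assume "int r \<le> i"
    then have "r + 1 \<le> nat (i+1)" by simp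
    then have "Polynomial.monom 1 (r+1) dvd (Polynomial.monom 1 (nat (i+1)) :: complex poly)"
      by (metis le_imp_power_dvd monom_altdef smult_1_left)
    then show "\<exists>f. witt_d i = (\<lambda>p. f * pderiv p) \<and> Polynomial.monom 1 (r+1) dvd f"
      by (auto simp: witt_d_def)
  qed
  show "submodule ?V complex_ring witt" by (rule submodule_witt_dvd)
  fix S assume S: "{witt_d i |i. int r \<le> i} \<subseteq> S" "submodule S complex_ring witt"
  note E = Module.module.submoduleE[OF module_witt S(2)]
  have gen: "(\<lambda>p. Polynomial.monom 1 (r+1) * g * pderiv p) \<in> S" for g
  proof -
    have "(\<lambda>p. Polynomial.monom 1 k * g * pderiv p) \<in> S" if "k \<ge> r + 1" for k using that
    proof (induction g arbitrary: k)
      case 0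
      have "\<zero>\<^bsub>witt\<^esub> \<in> S" using S(2) by (simp add: submodule_def subgroup_def)
      then show ?case by (simp add: witt_def)
    next
      case (pCons c g)
      have "witt_d (int k - 1) \<in> S" using S(1) pCons.prems by force
      then have 1: "c \<odot>\<^bsub>witt\<^esub> witt_d (int k - 1) \<in> S" by (intro E(4)) (simp add: complex_ring_def)
      have 2: "(\<lambda>p. Polynomial.monom 1 (Suc k) * g * pderiv p) \<in> S" using pCons by simp
      have "pCons c g = [:c:] + [:0,1:] * g" by simp
      moreover have "Polynomial.monom 1 k * [:0,1::complex:] = Polynomial.monom 1 (Suc k)"
        by (simp add: monom_Suc)
      ultimately have "Polynomial.monom 1 k * pCons c g = Polynomial.smult c (Polynomial.monom 1 k) + Polynomial.monom 1 (Suc k) * g"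
        by (simp add: monom_Suc algebra_simps)
      then have "(\<lambda>p. Polynomial.monom 1 k * pCons c g * pderiv p) =
         c \<odot>\<^bsub>witt\<^esub> witt_d (int k - 1) \<oplus>\<^bsub>witt\<^esub> (\<lambda>p. Polynomial.monom 1 (Suc k) * g * pderiv p)"
        by (simp add: witt_def witt_d_def algebra_simps)
      then show ?case using E(5)[OF 1 2] by simp
    qed
    then show ?thesis by simp
  qed
  then show "?V \<subseteq> S" by (force elim!: dvdE)
qed

lemma witt_b_V: "carrier witt_b = witt_V 0" by (simp add: witt_b_def witt_V_def)

lemma witt_bracket_ops: "bracket witt (\<lambda>p. f * pderiv p) (\<lambda>p. g * pderiv p) = (\<lambda>p. (f * pderiv g - g * pderiv f) * pderiv p)"
  by (auto simp: witt_def pderiv_mult algebra_simps fun_eq_iff)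

lemma witt_b_ideal:
  assumes "x \<in> carrier witt_b" "y \<in> witt_V r"
  shows "bracket witt_b x y \<in> witt_V r"
proof -
  let ?m = "Polynomial.monom (1 :: complex) (r + 1)"
  obtain f g where x: "x = (\<lambda>p. ([:0,1:] * f) * pderiv p)" and y: "y = (\<lambda>p. (?m * g) * pderiv p)"
    using assms unfolding witt_b_V witt_V_eq by (auto simp: monom_Suc elim!: dvdE)
  have *: "[:0,1:] * pderiv ?m = of_nat (r + 1) * ?m"
    unfolding pderiv_monom by (simp add: of_nat_poly smult_monom flip: monom_Suc)
  have "([:0,1:] * f) * pderiv (?m * g) =
      ([:0,1:] * f) * (?m * pderiv g) + ([:0,1:] * pderiv ?m) * (f * g)"
    unfolding pderiv_mult by (simp only: distrib_left mult_ac)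
  also have "\<dots> = ?m * ([:0,1:] * f * pderiv g + of_nat (r + 1) * f * g)"
    unfolding * by (simp only: distrib_left mult_ac)
  finally have "([:0,1:] * f) * pderiv (?m * g) - (?m * g) * pderiv ([:0,1:] * f) =
      ?m * (([:0,1:] * f * pderiv g + of_nat (r + 1) * f * g) - g * pderiv ([:0,1:] * f))"
    by (simp only: right_diff_distrib mult.assoc)
  then have "?m dvd ([:0,1:] * f) * pderiv (?m * g) - (?m * g) * pderiv ([:0,1:] * f)"
    by (rule dvdI)
  moreover have "bracket witt_b x y = bracket witt x y" by (simp add: witt_b_def)
  ultimately show ?thesis
    unfolding witt_V_eq x y by (simp only: witt_bracket_ops) blast
qed

lemma lie_algebra_b: "lie_algebra witt_b"
proof -
  have m: "Module.module complex_ring witt_b"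
    using submodule.submodule_is_module[OF submodule_witt_dvd module_witt, of 1] witt_V_eq[of 0] witt_b_V
    by (simp add: witt_b_def)
  have s: "x \<in> carrier witt" if "x \<in> carrier witt_b" for x
    using that witt_carrier_iff unfolding witt_b_V witt_V_eq by blast
  interpret lie_algebra witt by (rule lie_algebra_witt)
  show ?thesis
    apply (intro lie_algebra.intro m lie_algebra_axioms.intro)
          apply (metis witt_b_ideal witt_b_V)
    using bracket_add_left bracket_add_right bracket_smult_left bracket_smult_right bracket_self jacobi s
         apply (simp_all add: witt_b_def)
    done
qed

end

theory Submission
  imports Defs
begin

text \<open>
  Since \<open>\<WW> = \<bb> \<oplus> \<complex> d\<^sub>-\<^sub>1\<close>, the \<open>\<WW>\<close>-submodule generated by a \<open>\<bb>\<close>-submodule \<open>N\<close> of a \<open>\<WW>\<close>-module is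
  spanned by the translates \<open>d\<^sub>-\<^sub>1\<^sup>n v\<close> with \<open>v \<in> N\<close>. The theorem rests on one calculation with
  these translates. Suppose that for some \<open>r\<close> all \<open>d\<^sub>i\<close> with \<open>i > r\<close> annihilate \<open>N\<close> and \<open>d\<^sub>r\<close> is
  injective on \<open>N\<close>, and consider \<open>d\<^sub>-\<^sub>1\<^sup>n v\<close> plus terms of lower degree, where \<open>v \<noteq> 0\<close> and \<open>n > 0\<close>.
  If \<open>r \<ge> 1\<close>, then \<open>d\<^sub>r\<^sub>+\<^sub>1\<close> turns it into an expression of degree \<open>n - 1\<close> with leading coefficient
  \<open>- n (r + 2) d\<^sub>r v \<noteq> 0\<close>. If \<open>r = 0\<close>, the coefficient of degree \<open>n - 1\<close> after applying \<open>d\<^sub>1\<close> is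
  \<open>n ((n - 1) v - 2 d\<^sub>0 v)\<close>; where it vanishes, \<open>n \<ge> 2\<close> as \<open>d\<^sub>0\<close> is injective, and \<open>d\<^sub>2\<close>
  produces an expression of degree \<open>n - 2\<close> whose leading coefficient is a positive multiple of \<open>v\<close>. By induction every \<open>\<bb>\<close>-submodule that
  contains such an expression contains a nonzero vector of \<open>N\<close> (lemma \<open>lowering\<close>). For the zero
  submodule this says that the translates of \<open>N\<close> are independent, so that the generated submodule
  is \<open>Ind N\<close> (lemma \<open>Ind_W_iso\<close>).

  In a nonzero module of \<open>\<O>\<^sub>\<bb>\<close> take the least \<open>n\<close> such that the \<open>d\<^sub>i\<close> with \<open>i \<ge> n\<close> have a common
  nonzero null vector. If \<open>n = r + 1\<close>, the space \<open>N\<close> of all these null vectors is a \<open>\<bb>\<close>-submodule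
  as above. For a nontrivial simple \<open>\<bb>\<close>-module \<open>B\<close> it is all of \<open>B\<close>; then every nonzero
  \<open>\<bb>\<close>-submodule of \<open>Ind B\<close> meets \<open>1 \<otimes> B\<close> and hence contains it, which makes \<open>Ind B\<close> simple with
  socle \<open>1 \<otimes> B\<close> (lemma \<open>induced_simple\<close>). For a nontrivial simple \<open>\<WW>\<close>-module \<open>W\<close> the case \<open>n = 0\<close>
  is impossible (lemma \<open>no_b_invariants\<close>), \<open>W\<close> is generated by \<open>N\<close> and therefore induced from it,
  and \<open>N\<close> is contained in every nonzero \<open>\<bb>\<close>-submodule, so it is the socle
  (lemma \<open>simple_structure\<close>). Thus \<open>W\<close> and its socle determine each other up to isomorphism, and
  as \<open>\<VV>\<^sup>(\<^sup>r\<^sup>+\<^sup>1\<^sup>)\<close> annihilates the socle, the socle is a module over \<open>\<aa>\<^sub>r\<close>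
  (and over \<open>\<aa>\<^sub>1\<close> if \<open>r = 0\<close>).

  Apart from generation by \<open>1 \<otimes> B\<close>, two facts about induced modules enter. One is the universal
  property, which needs the action of the enveloping algebra on a module and the construction of
  the tensor product (lemma \<open>Ind_universal\<close>). The other is that \<open>v \<mapsto> 1 \<otimes> v\<close> is injective (lemma \<open>ind_unit_inj\<close>).
  This is a part of the theorem of Poincare, Birkhoff and Witt, proved here for a subalgebra of
  codimension one by letting the Lie algebra act on the space \<open>\<complex>[d] \<otimes> B\<close> that the theorem
  predicts.
\<close>

section \<open>The complex numbers as a ring\<close>

lemma complex_ring_simps [simp]:
  "carrier complex_ring = UNIV" "x \<oplus>\<^bsub>complex_ring\<^esub> y = x + y" "x \<otimes>\<^bsub>complex_ring\<^esub> y = x * y"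
  "\<one>\<^bsub>complex_ring\<^esub> = 1" "\<zero>\<^bsub>complex_ring\<^esub> = 0"
  by (simp_all add: complex_ring_def)

lemma complex_ring_uminus [simp]: "\<ominus>\<^bsub>complex_ring\<^esub> x = - x"
proof -
  interpret cring complex_ring by (rule cring_complex)
  show ?thesis by (rule minus_equality) simp_all
qed

section \<open>The free associative algebra\<close>

lemma free_carrier_iff:
  "a \<in> carrier (free_alg L) \<longleftrightarrow> finite {w. a w \<noteq> 0} \<and> (\<forall>w. a w \<noteq> 0 \<longrightarrow> w \<in> lists (carrier L))"
  by (auto simp: free_alg_def)

lemma free_add [simp]: "a \<oplus>\<^bsub>free_alg L\<^esub> b = (\<lambda>w. a w + b w)"
  and free_zero [simp]: "\<zero>\<^bsub>free_alg L\<^esub> = (\<lambda>w. 0)"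
  and free_one: "\<one>\<^bsub>free_alg L\<^esub> = free_const 1"
  by (simp_all add: free_alg_def free_const_def)

lemma free_mult_Nil: "(a \<otimes>\<^bsub>free_alg L\<^esub> b) [] = a [] * b []"
  by (simp add: free_alg_def)

lemma free_mult_Cons:
  "(a \<otimes>\<^bsub>free_alg L\<^esub> b) (x # w) = a [] * b (x # w) + ((\<lambda>u. a (x # u)) \<otimes>\<^bsub>free_alg L\<^esub> b) w"
  by (simp add: free_alg_def sum.atMost_Suc_shift del: sum.atMost_Suc)

lemma free_mult_add_left:
  "(\<lambda>w. a w + b w) \<otimes>\<^bsub>free_alg L\<^esub> c = (\<lambda>w. (a \<otimes>\<^bsub>free_alg L\<^esub> c) w + (b \<otimes>\<^bsub>free_alg L\<^esub> c) w)"
  by (simp add: free_alg_def fun_eq_iff sum.distrib distrib_right)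

lemma free_mult_add_right:
  "c \<otimes>\<^bsub>free_alg L\<^esub> (\<lambda>w. a w + b w) = (\<lambda>w. (c \<otimes>\<^bsub>free_alg L\<^esub> a) w + (c \<otimes>\<^bsub>free_alg L\<^esub> b) w)"
  by (simp add: free_alg_def fun_eq_iff sum.distrib distrib_left)

lemma free_mult_scale_left:
  "(\<lambda>w. c * a w) \<otimes>\<^bsub>free_alg L\<^esub> b = (\<lambda>w. c * (a \<otimes>\<^bsub>free_alg L\<^esub> b) w)"
  by (simp add: free_alg_def fun_eq_iff sum_distrib_left mult.assoc)

text \<open>Splitting off the first letter of a word makes the product a recursion on words; associativity is
  then an induction that needs no manipulation of double sums.\<close>

lemma free_mult_assoc:
  "(a \<otimes>\<^bsub>free_alg L\<^esub> b) \<otimes>\<^bsub>free_alg L\<^esub> c = a \<otimes>\<^bsub>free_alg L\<^esub> (b \<otimes>\<^bsub>free_alg L\<^esub> c)"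
proof
  fix w show "((a \<otimes>\<^bsub>free_alg L\<^esub> b) \<otimes>\<^bsub>free_alg L\<^esub> c) w = (a \<otimes>\<^bsub>free_alg L\<^esub> (b \<otimes>\<^bsub>free_alg L\<^esub> c)) w"
  proof (induction w arbitrary: a b)
    case Nil show ?case by (simp add: free_mult_Nil)
  next
    case (Cons x w)
    have "((a \<otimes>\<^bsub>free_alg L\<^esub> b) \<otimes>\<^bsub>free_alg L\<^esub> c) (x # w) = a [] * b [] * c (x # w) +
        ((\<lambda>u. a [] * b (x # u) + ((\<lambda>u. a (x # u)) \<otimes>\<^bsub>free_alg L\<^esub> b) u) \<otimes>\<^bsub>free_alg L\<^esub> c) w"
      by (simp add: free_mult_Cons free_mult_Nil)
    also have "\<dots> = (a \<otimes>\<^bsub>free_alg L\<^esub> (b \<otimes>\<^bsub>free_alg L\<^esub> c)) (x # w)"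
      by (simp add: free_mult_add_left free_mult_scale_left Cons.IH free_mult_Cons
          algebra_simps)
    finally show ?case .
  qed
qed

lemma free_const_mult [simp]: "free_const c \<otimes>\<^bsub>free_alg L\<^esub> a = (\<lambda>w. c * a w)"
proof
  fix w show "(free_const c \<otimes>\<^bsub>free_alg L\<^esub> a) w = c * a w"
  proof (cases w)
    case (Cons x u)
    have "(\<lambda>u. free_const c (x # u)) \<otimes>\<^bsub>free_alg L\<^esub> a = (\<lambda>w. 0)"
      by (simp add: free_alg_def free_const_def)
    then show ?thesis by (simp add: Cons free_mult_Cons) (simp add: free_const_def)
  qed (simp add: free_mult_Nil free_const_def)
qed

lemma free_mult_const: "a \<otimes>\<^bsub>free_alg L\<^esub> free_const c = (\<lambda>w. a w * c)"
proof
  fix w show "(a \<otimes>\<^bsub>free_alg L\<^esub> free_const c) w = a w * c"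
    by (induction w arbitrary: a) (simp_all add: free_mult_Nil free_mult_Cons free_const_def)
qed

lemma free_gen_mult:
  "(free_gen x \<otimes>\<^bsub>free_alg L\<^esub> a) [] = 0"
  "(free_gen x \<otimes>\<^bsub>free_alg L\<^esub> a) (y # w) = (if y = x then a w else 0)"
proof -
  show "(free_gen x \<otimes>\<^bsub>free_alg L\<^esub> a) [] = 0" by (simp add: free_mult_Nil free_gen_def)
  have "(\<lambda>u. free_gen x (y # u)) = free_const (if y = x then 1 else 0)"
    by (auto simp: free_gen_def free_const_def fun_eq_iff)
  then show "(free_gen x \<otimes>\<^bsub>free_alg L\<^esub> a) (y # w) = (if y = x then a w else 0)"
    by (simp add: free_mult_Cons) (simp add: free_gen_def)
qed

lemma free_const_closed: "free_const c \<in> carrier (free_alg L)"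
  by (auto simp: free_carrier_iff free_const_def)

lemma free_gen_closed: "x \<in> carrier L \<Longrightarrow> free_gen x \<in> carrier (free_alg L)"
  by (auto simp: free_carrier_iff free_gen_def)

lemma free_add_closed:
  assumes "a \<in> carrier (free_alg L)" "b \<in> carrier (free_alg L)"
  shows "(\<lambda>w. a w + b w) \<in> carrier (free_alg L)"
proof -
  have "finite {w. a w + b w \<noteq> 0}"
    by (rule finite_subset[of _ "{w. a w \<noteq> 0} \<union> {w. b w \<noteq> 0}"])
      (use assms in \<open>auto simp: free_carrier_iff\<close>)
  moreover have "w \<in> lists (carrier L)" if "a w + b w \<noteq> 0" for w
    using that assms by (cases "a w = 0") (auto simp: free_carrier_iff)
  ultimately show ?thesis by (simp add: free_carrier_iff)
qed

lemma free_scale_closed: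
  assumes "a \<in> carrier (free_alg L)" shows "(\<lambda>w. c * a w) \<in> carrier (free_alg L)"
  using assms by (auto simp: free_carrier_iff elim: rev_finite_subset)

lemma free_mult_closed:
  assumes "a \<in> carrier (free_alg L)" "b \<in> carrier (free_alg L)"
  shows "a \<otimes>\<^bsub>free_alg L\<^esub> b \<in> carrier (free_alg L)"
proof -
  have *: "\<exists>u v. w = u @ v \<and> a u \<noteq> 0 \<and> b v \<noteq> 0" if "(a \<otimes>\<^bsub>free_alg L\<^esub> b) w \<noteq> 0" for w
  proof -
    from that have "(\<Sum>k\<le>length w. a (take k w) * b (drop k w)) \<noteq> 0" by (simp add: free_alg_def)
    then obtain k where "a (take k w) * b (drop k w) \<noteq> 0" by (meson sum.not_neutral_contains_not_neutral)
    then show ?thesis by (intro exI[of _ "take k w"] exI[of _ "drop k w"]) simp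
  qed
  have "{w. (a \<otimes>\<^bsub>free_alg L\<^esub> b) w \<noteq> 0} \<subseteq> (\<lambda>(u, v). u @ v) ` ({w. a w \<noteq> 0} \<times> {w. b w \<noteq> 0})"
    using * by fastforce
  then have "finite {w. (a \<otimes>\<^bsub>free_alg L\<^esub> b) w \<noteq> 0}"
    by (rule finite_subset) (use assms in \<open>auto simp: free_carrier_iff\<close>)
  moreover have "w \<in> lists (carrier L)" if "(a \<otimes>\<^bsub>free_alg L\<^esub> b) w \<noteq> 0" for w
    using *[OF that] assms by (fastforce simp: free_carrier_iff)
  ultimately show ?thesis by (simp add: free_carrier_iff)
qed

lemma ring_free_alg: "ring (free_alg L)"
proof (rule ringI)
  show "abelian_group (free_alg L)"
  proof (rule abelian_groupI, goal_cases)
    case (6 a)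
    then show ?case using free_scale_closed[of a L "-1"] by (intro bexI[of _ "\<lambda>w. - a w"]) simp_all
  qed (auto simp: free_add_closed algebra_simps, auto simp: free_carrier_iff)
  show "monoid (free_alg L)"
    by (rule monoidI) (simp_all add: free_mult_closed free_one free_const_closed free_mult_assoc free_mult_const)
qed (simp_all add: free_mult_add_left free_mult_add_right)

lemma free_minus:
  assumes "a \<in> carrier (free_alg L)" "b \<in> carrier (free_alg L)"
  shows "a \<ominus>\<^bsub>free_alg L\<^esub> b = (\<lambda>w. a w - b w)"
proof -
  interpret ring "free_alg L" by (rule ring_free_alg)
  have "\<ominus>\<^bsub>free_alg L\<^esub> b = (\<lambda>w. - b w)"
    by (rule minus_equality) (use assms free_scale_closed[of b L "-1"] in simp_all)
  then show ?thesis by (simp add: a_minus_def)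
qed

text \<open>The free algebra is spanned by the words, so a property of its elements can be checked on
  constants, under left multiplication by a generator, and under sums.\<close>

lemma free_alg_induct [consumes 1, case_names const gen add]:
  assumes "a \<in> carrier (free_alg L)"
    and "\<And>c. P (free_const c)"
    and "\<And>x a. x \<in> carrier L \<Longrightarrow> a \<in> carrier (free_alg L) \<Longrightarrow> P a \<Longrightarrow> P (free_gen x \<otimes>\<^bsub>free_alg L\<^esub> a)"
    and "\<And>a b. a \<in> carrier (free_alg L) \<Longrightarrow> b \<in> carrier (free_alg L) \<Longrightarrow> P a \<Longrightarrow> P b \<Longrightarrow> P (\<lambda>w. a w + b w)"
  shows "P a"
proof -
  define mono where "mono c w = (\<lambda>u. if u = w then c else (0::complex))" for c and w :: "'a list"
  have mono: "mono c w \<in> carrier (free_alg L) \<and> P (mono c w)" if "w \<in> lists (carrier L)" for c w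
    using that
  proof (induction w)
    case Nil
    then show ?case using assms(2)[of c] free_const_closed[of c L] by (simp add: mono_def free_const_def)
  next
    case (Cons x w)
    have "mono c (x # w) = free_gen x \<otimes>\<^bsub>free_alg L\<^esub> mono c w"
    proof
      fix u show "mono c (x # w) u = (free_gen x \<otimes>\<^bsub>free_alg L\<^esub> mono c w) u"
        by (cases u) (auto simp: free_gen_mult mono_def)
    qed
    then show ?case using Cons assms(3)[of x "mono c w"] by (simp add: free_mult_closed free_gen_closed)
  qed
  have "\<forall>a. a \<in> carrier (free_alg L) \<longrightarrow> {w. a w \<noteq> 0} \<subseteq> S \<longrightarrow> P a" if "finite S" for S using that
  proof (induction S)
    case empty
    show ?case
    proof (intro allI impI)
      fix a :: "'a list \<Rightarrow> complex" assume "{w. a w \<noteq> 0} \<subseteq> {}"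
      then have "a = free_const 0" by (auto simp: free_const_def fun_eq_iff)
      then show "P a" using assms(2) by simp
    qed
  next
    case (insert w S)
    show ?case
    proof (intro allI impI)
      fix a :: "'a list \<Rightarrow> complex" assume a: "a \<in> carrier (free_alg L)" "{w. a w \<noteq> 0} \<subseteq> insert w S"
      show "P a"
      proof (cases "a w = 0")
        case True then show ?thesis using insert.IH a by auto
      next
        case False
        then have w: "w \<in> lists (carrier L)" using a by (simp add: free_carrier_iff)
        define b where "b = (\<lambda>u. if u = w then 0 else a u)"
        have b: "b \<in> carrier (free_alg L)"
          using a(1) by (auto simp: free_carrier_iff b_def elim: rev_finite_subset)
        have "{u. b u \<noteq> 0} \<subseteq> S" using a(2) by (auto simp: b_def)
        then have "P b" using insert.IH b by blast
        then have "P (\<lambda>u. mono (a w) w u + b u)" using assms(4) mono[OF w] b by blast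
        moreover have "(\<lambda>u. mono (a w) w u + b u) = a" by (auto simp: mono_def b_def)
        ultimately show ?thesis by simp
      qed
    qed
  qed
  then show ?thesis using assms(1) by (auto simp: free_carrier_iff)
qed

section \<open>The action of the free algebra on a module\<close>

context lie_algebra begin

lemma smult_l_distr': "x \<in> carrier L \<Longrightarrow> (a + b) \<odot> x = a \<odot> x \<oplus> b \<odot> x"
  using smult_l_distr[of a b x] by simp

lemma smult_assoc1': "x \<in> carrier L \<Longrightarrow> (a * b) \<odot> x = a \<odot> (b \<odot> x)"
  using smult_assoc1[of a b x] by simp

lemma smult_zero [simp]: "x \<in> carrier L \<Longrightarrow> 0 \<odot> x = \<zero>"
  using smult_l_null[of x] by simp

lemma smult_one' [simp]: "x \<in> carrier L \<Longrightarrow> 1 \<odot> x = x"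
  using smult_one[of x] by simp

lemma smult_minus_one: "x \<in> carrier L \<Longrightarrow> (- 1) \<odot> x = \<ominus> x"
  using smult_l_minus[of 1 x] by simp

end

context lie_module begin

lemma smult_l_distrV: "v \<in> carrier V \<Longrightarrow> (a + b) \<odot>\<^bsub>V\<^esub> v = a \<odot>\<^bsub>V\<^esub> v \<oplus>\<^bsub>V\<^esub> b \<odot>\<^bsub>V\<^esub> v"
  using V.smult_l_distr[of a b v] by simp

lemma smult_assoc1V: "v \<in> carrier V \<Longrightarrow> (a * b) \<odot>\<^bsub>V\<^esub> v = a \<odot>\<^bsub>V\<^esub> (b \<odot>\<^bsub>V\<^esub> v)"
  using V.smult_assoc1[of a b v] by simp

lemma smult_closedV: "v \<in> carrier V \<Longrightarrow> a \<odot>\<^bsub>V\<^esub> v \<in> carrier V"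
  by simp

lemma smult_zeroV [simp]: "v \<in> carrier V \<Longrightarrow> 0 \<odot>\<^bsub>V\<^esub> v = \<zero>\<^bsub>V\<^esub>"
  using V.smult_l_null[of v] by simp

lemma smult_oneV [simp]: "v \<in> carrier V \<Longrightarrow> 1 \<odot>\<^bsub>V\<^esub> v = v"
  using V.smult_one[of v] by simp

lemma smult_minus_oneV: "v \<in> carrier V \<Longrightarrow> (- 1) \<odot>\<^bsub>V\<^esub> v = \<ominus>\<^bsub>V\<^esub> v"
  using V.smult_l_minus[of 1 v] by simp

lemma act_zero_right [simp]: "x \<in> carrier L \<Longrightarrow> x \<rhd>\<^bsub>V\<^esub> \<zero>\<^bsub>V\<^esub> = \<zero>\<^bsub>V\<^esub>"
  using act_smult_right[of x "\<zero>\<^bsub>V\<^esub>" 0] by (simp add: act_closed)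

lemma act_zero_left [simp]: "v \<in> carrier V \<Longrightarrow> \<zero>\<^bsub>L\<^esub> \<rhd>\<^bsub>V\<^esub> v = \<zero>\<^bsub>V\<^esub>"
  using act_smult_left[of "\<zero>\<^bsub>L\<^esub>" v 0] by (simp add: act_closed)

lemma foldr_act_closed: "w \<in> lists (carrier L) \<Longrightarrow> v \<in> carrier V \<Longrightarrow> foldr (act V) w v \<in> carrier V"
  by (induction w) (auto simp: act_closed)

lemma finsum_act:
  "finite S \<Longrightarrow> x \<in> carrier L \<Longrightarrow> g \<in> S \<rightarrow> carrier V \<Longrightarrow>
    x \<rhd>\<^bsub>V\<^esub> (\<Oplus>\<^bsub>V\<^esub>i\<in>S. g i) = (\<Oplus>\<^bsub>V\<^esub>i\<in>S. x \<rhd>\<^bsub>V\<^esub> g i)"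
proof (induction S rule: finite_induct)
  case (insert i S)
  then show ?case by (simp add: Pi_def act_add_right act_closed V.M.finsum_closed)
qed simp

text \<open>Sums over the support of an element are compared by extending them to a common finite set of words.\<close>

lemma free_act_superset:
  assumes "a \<in> carrier (free_alg L)" "v \<in> carrier V" "finite S" "S \<subseteq> lists (carrier L)" "{w. a w \<noteq> 0} \<subseteq> S"
  shows "free_act V a v = (\<Oplus>\<^bsub>V\<^esub>w\<in>S. a w \<odot>\<^bsub>V\<^esub> foldr (act V) w v)"
  unfolding free_act_def
  by (rule V.M.add.finprod_mono_neutral_cong_left)
    (use assms in \<open>auto simp: Pi_def foldr_act_closed subset_iff\<close>)

lemma free_act_closed:
  assumes "a \<in> carrier (free_alg L)" "v \<in> carrier V"
  shows "free_act V a v \<in> carrier V"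
  unfolding free_act_def using assms
  by (intro V.M.finsum_closed) (auto simp: free_carrier_iff foldr_act_closed intro!: smult_closedV)

lemma free_act_add:
  assumes "a \<in> carrier (free_alg L)" "b \<in> carrier (free_alg L)" "v \<in> carrier V"
  shows "free_act V (\<lambda>w. a w + b w) v = free_act V a v \<oplus>\<^bsub>V\<^esub> free_act V b v"
proof -
  let ?S = "{w. a w \<noteq> 0} \<union> {w. b w \<noteq> 0}"
  have S: "finite ?S" "?S \<subseteq> lists (carrier L)" using assms by (auto simp: free_carrier_iff)
  have c: "foldr (act V) w v \<in> carrier V" if "w \<in> ?S" for w
    using S that assms(3) by (auto intro!: foldr_act_closed)
  have "free_act V (\<lambda>w. a w + b w) v = (\<Oplus>\<^bsub>V\<^esub>w\<in>?S. (a w + b w) \<odot>\<^bsub>V\<^esub> foldr (act V) w v)"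
    using S assms by (intro free_act_superset) (auto simp: free_add_closed)
  also have "\<dots> = (\<Oplus>\<^bsub>V\<^esub>w\<in>?S. a w \<odot>\<^bsub>V\<^esub> foldr (act V) w v \<oplus>\<^bsub>V\<^esub> b w \<odot>\<^bsub>V\<^esub> foldr (act V) w v)"
    using c by (intro V.M.finsum_cong') (auto simp: smult_l_distrV)
  also have "\<dots> = (\<Oplus>\<^bsub>V\<^esub>w\<in>?S. a w \<odot>\<^bsub>V\<^esub> foldr (act V) w v) \<oplus>\<^bsub>V\<^esub> (\<Oplus>\<^bsub>V\<^esub>w\<in>?S. b w \<odot>\<^bsub>V\<^esub> foldr (act V) w v)"
    using c by (intro V.M.finsum_addf) auto
  also have "\<dots> = free_act V a v \<oplus>\<^bsub>V\<^esub> free_act V b v"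
    using S assms by (subst (1 2) free_act_superset[where S = ?S]) auto
  finally show ?thesis .
qed

lemma free_act_const [simp]: "v \<in> carrier V \<Longrightarrow> free_act V (free_const c) v = c \<odot>\<^bsub>V\<^esub> v"
  by (subst free_act_superset[where S = "{[]}"])
    (use free_const_closed[of c L] in \<open>auto simp: free_const_def\<close>)

lemma free_act_gen_mult:
  assumes "a \<in> carrier (free_alg L)" "x \<in> carrier L" "v \<in> carrier V"
  shows "free_act V (free_gen x \<otimes>\<^bsub>free_alg L\<^esub> a) v = x \<rhd>\<^bsub>V\<^esub> free_act V a v"
proof -
  let ?S = "{w. a w \<noteq> 0}" and ?b = "free_gen x \<otimes>\<^bsub>free_alg L\<^esub> a"
  have S: "finite ?S" "?S \<subseteq> lists (carrier L)" using assms by (auto simp: free_carrier_iff)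
  have c: "foldr (act V) w v \<in> carrier V" if "w \<in> ?S" for w
    using S that assms(3) by (auto intro!: foldr_act_closed)
  have sub: "{w. ?b w \<noteq> 0} \<subseteq> (#) x ` ?S"
  proof
    fix w assume "w \<in> {w. ?b w \<noteq> 0}"
    then show "w \<in> (#) x ` ?S" by (cases w) (auto simp: free_gen_mult split: if_splits)
  qed
  have "free_act V ?b v = (\<Oplus>\<^bsub>V\<^esub>w\<in>(#) x ` ?S. ?b w \<odot>\<^bsub>V\<^esub> foldr (act V) w v)"
    by (intro free_act_superset) (use S sub assms in \<open>auto 4 3 simp: free_mult_closed free_gen_closed subset_iff\<close>)
  also have "\<dots> = (\<Oplus>\<^bsub>V\<^esub>w\<in>?S. ?b (x # w) \<odot>\<^bsub>V\<^esub> foldr (act V) (x # w) v)"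
    by (intro V.M.add.finprod_reindex) (use c assms in \<open>auto simp: Pi_def act_closed inj_on_def\<close>)
  also have "\<dots> = (\<Oplus>\<^bsub>V\<^esub>w\<in>?S. x \<rhd>\<^bsub>V\<^esub> (a w \<odot>\<^bsub>V\<^esub> foldr (act V) w v))"
    by (intro V.M.finsum_cong') (use c assms in \<open>auto simp: act_closed act_smult_right free_gen_mult\<close>)
  also have "\<dots> = x \<rhd>\<^bsub>V\<^esub> free_act V a v"
    unfolding free_act_def using c S assms by (subst finsum_act) auto
  finally show ?thesis .
qed

lemma free_act_gen [simp]:
  assumes "x \<in> carrier L" "v \<in> carrier V" shows "free_act V (free_gen x) v = x \<rhd>\<^bsub>V\<^esub> v"
  using free_act_gen_mult[of "free_const 1" x v] assms free_const_closed[of 1 L]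
  by (simp add: free_mult_const)

lemma free_act_zero [simp]: "free_act V (\<lambda>w. 0) v = \<zero>\<^bsub>V\<^esub>"
  by (simp add: free_act_def)

lemma free_act_scale:
  assumes "a \<in> carrier (free_alg L)" "v \<in> carrier V"
  shows "free_act V (\<lambda>w. c * a w) v = c \<odot>\<^bsub>V\<^esub> free_act V a v"
proof -
  let ?S = "{w. a w \<noteq> 0}"
  have S: "finite ?S" "?S \<subseteq> lists (carrier L)" using assms by (auto simp: free_carrier_iff)
  have f: "foldr (act V) w v \<in> carrier V" if "w \<in> ?S" for w
    using S that assms(2) by (auto intro!: foldr_act_closed)
  have "free_act V (\<lambda>w. c * a w) v = (\<Oplus>\<^bsub>V\<^esub>w\<in>?S. (c * a w) \<odot>\<^bsub>V\<^esub> foldr (act V) w v)"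
    by (intro free_act_superset) (use S assms in \<open>auto simp: free_scale_closed\<close>)
  also have "\<dots> = (\<Oplus>\<^bsub>V\<^esub>w\<in>?S. c \<odot>\<^bsub>V\<^esub> (a w \<odot>\<^bsub>V\<^esub> foldr (act V) w v))"
    by (intro V.M.finsum_cong') (use f in \<open>auto simp: smult_assoc1V\<close>)
  also have "\<dots> = c \<odot>\<^bsub>V\<^esub> free_act V a v"
    unfolding free_act_def using f S by (subst V.finsum_smult_ldistr) auto
  finally show ?thesis .
qed

lemma free_act_minus:
  assumes "a \<in> carrier (free_alg L)" "b \<in> carrier (free_alg L)" "v \<in> carrier V"
  shows "free_act V (\<lambda>w. a w - b w) v = free_act V a v \<ominus>\<^bsub>V\<^esub> free_act V b v"
  using free_act_add[OF assms(1) free_scale_closed[OF assms(2), of "-1"] assms(3)]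
    free_act_scale[OF assms(2,3), of "-1"] assms
  by (simp add: free_act_closed smult_minus_oneV V.M.minus_eq)

lemma free_act_mult:
  assumes "a \<in> carrier (free_alg L)" "b \<in> carrier (free_alg L)" "v \<in> carrier V"
  shows "free_act V (a \<otimes>\<^bsub>free_alg L\<^esub> b) v = free_act V a (free_act V b v)"
  using assms(1)
proof (induction a rule: free_alg_induct)
  case (const c)
  show ?case using assms by (simp add: free_act_scale free_act_closed)
next
  case (gen x a)
  then show ?case using assms(2,3)
    by (simp add: free_mult_assoc free_act_gen_mult free_mult_closed free_act_closed)
next
  case (add a a')
  then show ?case using assms(2,3)
    by (simp add: free_mult_add_left free_act_add free_mult_closed free_act_closed)
qed

lemma free_act_add_right:
  assumes "a \<in> carrier (free_alg L)" "v \<in> carrier V" "v' \<in> carrier V"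
  shows "free_act V a (v \<oplus>\<^bsub>V\<^esub> v') = free_act V a v \<oplus>\<^bsub>V\<^esub> free_act V a v'"
  using assms(1)
proof (induction a rule: free_alg_induct)
  case (const c)
  show ?case using assms V.smult_r_distr[of c v v'] by simp
next
  case (gen x a)
  then show ?case using assms(2,3)
    by (simp add: free_act_gen_mult free_act_closed act_add_right)
next
  case (add a a')
  then show ?case using assms(2,3)
    by (simp add: free_act_add free_act_closed V.M.a_ac)
qed

end

text \<open>By induction over the free algebra. The source may be a module over a subalgebra, as Frobenius
  reciprocity requires.\<close>

lemma free_act_hom:
  assumes "lie_module K B" "lie_module L V" "carrier K \<subseteq> carrier L"
    and f: "\<And>v. v \<in> carrier B \<Longrightarrow> f v \<in> carrier V"
      "\<And>v w. v \<in> carrier B \<Longrightarrow> w \<in> carrier B \<Longrightarrow> f (v \<oplus>\<^bsub>B\<^esub> w) = f v \<oplus>\<^bsub>V\<^esub> f w"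
      "\<And>c v. v \<in> carrier B \<Longrightarrow> f (c \<odot>\<^bsub>B\<^esub> v) = c \<odot>\<^bsub>V\<^esub> f v"
      "\<And>x v. x \<in> carrier K \<Longrightarrow> v \<in> carrier B \<Longrightarrow> f (x \<rhd>\<^bsub>B\<^esub> v) = x \<rhd>\<^bsub>V\<^esub> f v"
    and a: "a \<in> carrier (free_alg K)" and v: "v \<in> carrier B"
  shows "f (free_act B a v) = free_act V a (f v)"
proof -
  interpret B: lie_module K B by fact
  interpret V: lie_module L V by fact
  have sub: "a \<in> carrier (free_alg L)" if "a \<in> carrier (free_alg K)" for a
    using that assms(3) by (auto simp: free_carrier_iff)
  have mult: "a \<otimes>\<^bsub>free_alg K\<^esub> b = a \<otimes>\<^bsub>free_alg L\<^esub> b" for a b by (simp add: free_alg_def)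
  show ?thesis using a
  proof (induction a rule: free_alg_induct)
    case (const c)
    then show ?case using f v by simp
  next
    case (gen x a)
    then show ?case using f v assms(3) B.free_act_gen_mult[of a x v] V.free_act_gen_mult[of a x "f v"]
      by (simp add: mult sub subset_iff B.free_act_closed)
  next
    case (add a b)
    then show ?case using f v by (simp add: B.free_act_add V.free_act_add sub B.free_act_closed)
  qed
qed

section \<open>The universal enveloping algebra\<close>

text \<open>The generators of \<open>uea_ideal\<close>, with the operations of the free algebra evaluated pointwise.\<close>

definition uea_relators :: "'l lie_alg \<Rightarrow> ('l list \<Rightarrow> complex) set" where
  "uea_relators L =
     {(\<lambda>w. free_gen (x \<oplus>\<^bsub>L\<^esub> y) w - (free_gen x w + free_gen y w)) | x y. x \<in> carrier L \<and> y \<in> carrier L} \<union>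
     {(\<lambda>w. free_gen (c \<odot>\<^bsub>L\<^esub> x) w - c * free_gen x w) | c x. x \<in> carrier L} \<union>
     {(\<lambda>w. (free_gen x \<otimes>\<^bsub>free_alg L\<^esub> free_gen y) w - (free_gen y \<otimes>\<^bsub>free_alg L\<^esub> free_gen x) w
        - free_gen (bracket L x y) w) | x y. x \<in> carrier L \<and> y \<in> carrier L}"

context lie_algebra begin

sublocale F: ring "free_alg L" by (rule ring_free_alg)

lemma free_minus_closed:
  "a \<in> carrier (free_alg L) \<Longrightarrow> b \<in> carrier (free_alg L) \<Longrightarrow> (\<lambda>w. a w - b w) \<in> carrier (free_alg L)"
  using free_add_closed[OF _ free_scale_closed[of b L "-1"], of a] by simp

lemma uea_ideal_eq: "uea_ideal L = Idl\<^bsub>free_alg L\<^esub> (uea_relators L)"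
  unfolding uea_ideal_def Let_def uea_relators_def
  by (intro arg_cong[where f = "genideal (free_alg L)"] arg_cong2[where f = "(\<union>)"] Collect_cong ex_cong1
      rev_conj_cong refl)
    (auto simp: free_minus free_gen_closed free_add_closed free_scale_closed free_mult_closed
      free_minus_closed bracket_closed)

lemma uea_relators_subset: "uea_relators L \<subseteq> carrier (free_alg L)"
  by (auto simp: uea_relators_def intro!: free_minus_closed free_gen_closed free_add_closed free_scale_closed
      free_mult_closed bracket_closed)

lemma uea_ideal_is_ideal: "ideal (uea_ideal L) (free_alg L)"
  unfolding uea_ideal_eq by (rule F.genideal_ideal[OF uea_relators_subset])

lemma uea_relators_in_ideal: "uea_relators L \<subseteq> uea_ideal L"
  unfolding uea_ideal_eq by (rule F.genideal_self[OF uea_relators_subset])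

lemma uea_ideal_minimal: "ideal I (free_alg L) \<Longrightarrow> uea_relators L \<subseteq> I \<Longrightarrow> uea_ideal L \<subseteq> I"
  unfolding uea_ideal_eq by (rule F.genideal_minimal)

sublocale UI: ideal "uea_ideal L" "free_alg L" by (rule uea_ideal_is_ideal)

sublocale U: ring "uea L" unfolding uea_def by (rule UI.quotient_is_ring)

lemma uea_carrier: "carrier (uea L) = uea_class L ` carrier (free_alg L)"
  by (auto simp: uea_def FactRing_def A_RCOSETS_def' uea_class_def)

lemma uea_class_eqI:
  assumes "a \<in> carrier (free_alg L)" "b \<in> carrier (free_alg L)" "(\<lambda>w. a w - b w) \<in> uea_ideal L"
  shows "uea_class L a = uea_class L b"
proof -
  have "a \<in> uea_class L b"
    using assms(3) by (auto simp: uea_class_def a_r_coset_def' intro!: bexI[of _ "\<lambda>w. a w - b w"])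
  then show ?thesis
    unfolding uea_class_def using F.a_repr_independence[OF _ assms(2) UI.a_subgroup] by simp
qed

lemma uea_class_self: "a \<in> carrier (free_alg L) \<Longrightarrow> a \<in> uea_class L a"
  unfolding uea_class_def by (rule UI.a_rcos_self)

lemma uea_class_mem:
  assumes "a \<in> carrier (free_alg L)" "b \<in> uea_class L a"
  shows "b \<in> carrier (free_alg L)" "(\<lambda>w. b w - a w) \<in> uea_ideal L" "uea_class L b = uea_class L a"
proof -
  show b: "b \<in> carrier (free_alg L)"
    using assms F.a_r_coset_subset_G[OF UI.a_subset] by (auto simp: uea_class_def)
  obtain h where h: "h \<in> uea_ideal L" "b = (\<lambda>w. h w + a w)"
    using assms(2) by (auto simp: uea_class_def a_r_coset_def')
  then show "(\<lambda>w. b w - a w) \<in> uea_ideal L" by simp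
  then show "uea_class L b = uea_class L a" using assms(1) b by (intro uea_class_eqI)
qed

lemma uea_class_mult:
  "a \<in> carrier (free_alg L) \<Longrightarrow> b \<in> carrier (free_alg L) \<Longrightarrow>
    uea_class L a \<otimes>\<^bsub>uea L\<^esub> uea_class L b = uea_class L (a \<otimes>\<^bsub>free_alg L\<^esub> b)"
  unfolding uea_class_def uea_def by (simp add: FactRing_def UI.rcoset_mult_add)

lemma uea_class_add:
  "a \<in> carrier (free_alg L) \<Longrightarrow> b \<in> carrier (free_alg L) \<Longrightarrow>
    uea_class L a \<oplus>\<^bsub>uea L\<^esub> uea_class L b = uea_class L (\<lambda>w. a w + b w)"
  unfolding uea_class_def uea_def by (simp add: FactRing_def UI.a_rcos_sum)

lemma uea_one: "\<one>\<^bsub>uea L\<^esub> = uea_class L (free_const 1)"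
  unfolding uea_class_def uea_def by (simp add: FactRing_def free_one)

lemma uea_class_closed: "a \<in> carrier (free_alg L) \<Longrightarrow> uea_class L a \<in> carrier (uea L)"
  by (simp add: uea_carrier)

end

context lie_module begin

lemma free_act_zero_right [simp]:
  assumes "a \<in> carrier (free_alg L)" shows "free_act V a \<zero>\<^bsub>V\<^esub> = \<zero>\<^bsub>V\<^esub>"
  using assms by (induction a rule: free_alg_induct) (simp_all add: free_act_gen_mult free_act_add)

text \<open>The elements of the free algebra that annihilate the module form a two-sided ideal, and the
  axioms of a module say that this ideal contains the relators. Hence the action factors through
  the enveloping algebra.\<close>

lemma uea_ideal_annihilates:
  assumes "a \<in> uea_ideal L" "v \<in> carrier V" shows "free_act V a v = \<zero>\<^bsub>V\<^esub>"
proof -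
  define I where "I = {a \<in> carrier (free_alg L). \<forall>v\<in>carrier V. free_act V a v = \<zero>\<^bsub>V\<^esub>}"
  have "ideal I (free_alg L)"
  proof (rule idealI[OF ring_free_alg])
    show "subgroup I (add_monoid (free_alg L))"
    proof (rule group.subgroupI)
      show "group (add_monoid (free_alg L))" by (rule F.add.is_group)
      show "I \<noteq> {}" using F.zero_closed by (auto simp: I_def)
      fix a assume a: "a \<in> I"
      then have "\<ominus>\<^bsub>free_alg L\<^esub> a = (\<lambda>w. - 1 * a w)"
        using free_scale_closed[of a L "-1"] by (intro F.minus_equality) (auto simp: I_def)
      moreover have "(\<lambda>w. - 1 * a w) \<in> I"
        using a free_scale_closed[of a L "-1"] free_act_scale[of a _ "-1"] unfolding I_def by simp
      ultimately show "inv\<^bsub>add_monoid (free_alg L)\<^esub> a \<in> I" by (simp add: a_inv_def)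
    qed (auto simp: I_def free_add_closed free_act_add)
  qed (simp_all add: I_def free_mult_closed free_act_mult free_act_closed)
  moreover have "uea_relators L \<subseteq> I"
  proof -
    note closed = free_gen_closed free_add_closed free_scale_closed free_mult_closed bracket_closed
      free_minus_closed free_act_closed act_closed
    have "free_act V r v = \<zero>\<^bsub>V\<^esub>" if "r \<in> uea_relators L" and v: "v \<in> carrier V" for r v
      using that(1) unfolding uea_relators_def
    proof (elim UnE CollectE exE conjE)
      fix x y assume r: "r = (\<lambda>w. free_gen (x \<oplus> y) w - (free_gen x w + free_gen y w))"
        and xy: "x \<in> carrier L" "y \<in> carrier L"
      have "free_act V r v = (x \<oplus> y) \<rhd>\<^bsub>V\<^esub> v \<ominus>\<^bsub>V\<^esub> (x \<rhd>\<^bsub>V\<^esub> v \<oplus>\<^bsub>V\<^esub> y \<rhd>\<^bsub>V\<^esub> v)"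
        unfolding r using xy v by (simp add: free_act_minus free_act_add closed)
      then show ?thesis using xy v by (simp add: act_add_left V.M.minus_eq V.M.r_neg act_closed)
    next
      fix c x assume r: "r = (\<lambda>w. free_gen (c \<odot> x) w - c * free_gen x w)" and x: "x \<in> carrier L"
      have "free_act V r v = (c \<odot> x) \<rhd>\<^bsub>V\<^esub> v \<ominus>\<^bsub>V\<^esub> (c \<odot>\<^bsub>V\<^esub> (x \<rhd>\<^bsub>V\<^esub> v))"
        unfolding r using x v by (simp add: free_act_minus free_act_scale closed)
      then show ?thesis using x v by (simp add: act_smult_left V.M.minus_eq V.M.r_neg act_closed)
    next
      fix x y assume r: "r = (\<lambda>w. (free_gen x \<otimes>\<^bsub>free_alg L\<^esub> free_gen y) w -
          (free_gen y \<otimes>\<^bsub>free_alg L\<^esub> free_gen x) w - free_gen (bracket L x y) w)"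
        and xy: "x \<in> carrier L" "y \<in> carrier L"
      have "free_act V r v = (x \<rhd>\<^bsub>V\<^esub> y \<rhd>\<^bsub>V\<^esub> v \<ominus>\<^bsub>V\<^esub> y \<rhd>\<^bsub>V\<^esub> x \<rhd>\<^bsub>V\<^esub> v) \<ominus>\<^bsub>V\<^esub> bracket L x y \<rhd>\<^bsub>V\<^esub> v"
        unfolding r using xy v by (simp add: free_act_minus free_act_mult closed)
      then show ?thesis using xy v by (simp add: act_bracket V.M.minus_eq V.M.r_neg act_closed)
    qed
    then show ?thesis using uea_relators_subset by (auto simp: I_def)
  qed
  ultimately have "uea_ideal L \<subseteq> I" by (rule uea_ideal_minimal)
  then show ?thesis using assms by (auto simp: I_def)
qed

lemma uea_act_class:
  assumes "a \<in> carrier (free_alg L)" "v \<in> carrier V"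
  shows "uea_act V (uea_class L a) v = free_act V a v"
proof -
  have "free_act V b v = free_act V a v" if "b \<in> uea_class L a" for b
  proof -
    note b = uea_class_mem[OF assms(1) that]
    have "free_act V b v = free_act V (\<lambda>w. (b w - a w) + a w) v" by simp
    also have "\<dots> = free_act V (\<lambda>w. b w - a w) v \<oplus>\<^bsub>V\<^esub> free_act V a v"
      using assms b by (intro free_act_add) (auto simp: free_minus_closed)
    also have "\<dots> = free_act V a v"
      using uea_ideal_annihilates[OF b(2) assms(2)] assms by (simp add: free_act_closed)
    finally show ?thesis .
  qed
  then have "(\<lambda>a. free_act V a v) ` uea_class L a = {free_act V a v}"
    using uea_class_self[OF assms(1)] by blast
  then show ?thesis by (simp add: uea_act_def)
qed

lemma uea_act_closed:
  "u \<in> carrier (uea L) \<Longrightarrow> v \<in> carrier V \<Longrightarrow> uea_act V u v \<in> carrier V"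
  by (auto simp: uea_carrier uea_act_class free_act_closed)

lemma uea_act_add_left:
  "u \<in> carrier (uea L) \<Longrightarrow> u' \<in> carrier (uea L) \<Longrightarrow> v \<in> carrier V \<Longrightarrow>
    uea_act V (u \<oplus>\<^bsub>uea L\<^esub> u') v = uea_act V u v \<oplus>\<^bsub>V\<^esub> uea_act V u' v"
  by (auto simp: uea_carrier uea_act_class uea_class_add free_add_closed free_act_add)

lemma uea_act_add_right:
  "u \<in> carrier (uea L) \<Longrightarrow> v \<in> carrier V \<Longrightarrow> v' \<in> carrier V \<Longrightarrow>
    uea_act V u (v \<oplus>\<^bsub>V\<^esub> v') = uea_act V u v \<oplus>\<^bsub>V\<^esub> uea_act V u v'"
  by (auto simp: uea_carrier uea_act_class free_act_add_right)

lemma uea_act_mult: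
  "u \<in> carrier (uea L) \<Longrightarrow> u' \<in> carrier (uea L) \<Longrightarrow> v \<in> carrier V \<Longrightarrow>
    uea_act V (u \<otimes>\<^bsub>uea L\<^esub> u') v = uea_act V u (uea_act V u' v)"
  by (auto simp: uea_carrier uea_act_class uea_class_mult free_mult_closed free_act_mult free_act_closed)

end

context lie_algebra begin

lemma uea_class_relator:
  assumes "a \<in> carrier (free_alg L)" "b \<in> carrier (free_alg L)" "(\<lambda>w. a w - b w) \<in> uea_relators L"
  shows "uea_class L a = uea_class L b"
  using assms uea_relators_in_ideal by (intro uea_class_eqI) auto

lemma uea_gen_add:
  assumes "x \<in> carrier L" "y \<in> carrier L"
  shows "uea_class L (free_gen (x \<oplus> y)) = uea_class L (free_gen x) \<oplus>\<^bsub>uea L\<^esub> uea_class L (free_gen y)"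
proof -
  have "uea_class L (free_gen (x \<oplus> y)) = uea_class L (\<lambda>w. free_gen x w + free_gen y w)"
    using assms by (intro uea_class_relator free_gen_closed free_add_closed) (auto simp: uea_relators_def)
  then show ?thesis using assms by (simp add: uea_class_add free_gen_closed)
qed

lemma uea_gen_smult:
  assumes "x \<in> carrier L"
  shows "uea_class L (free_gen (c \<odot> x)) = uea_class L (free_const c) \<otimes>\<^bsub>uea L\<^esub> uea_class L (free_gen x)"
proof -
  have "uea_class L (free_gen (c \<odot> x)) = uea_class L (\<lambda>w. c * free_gen x w)"
    using assms by (intro uea_class_relator free_gen_closed free_scale_closed) (auto simp: uea_relators_def)
  then show ?thesis using assms by (simp add: uea_class_mult free_gen_closed free_const_closed)
qed

lemma uea_const_central:
  assumes "u \<in> carrier (uea L)"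
  shows "uea_class L (free_const c) \<otimes>\<^bsub>uea L\<^esub> u = u \<otimes>\<^bsub>uea L\<^esub> uea_class L (free_const c)"
  using assms by (auto simp: uea_carrier uea_class_mult free_const_closed free_mult_const mult.commute)

lemma uea_const_add:
  "uea_class L (free_const (c + d)) = uea_class L (free_const c) \<oplus>\<^bsub>uea L\<^esub> uea_class L (free_const d)"
proof -
  have eq: "free_const (c + d) = (\<lambda>w. free_const c w + free_const d w)" by (auto simp: free_const_def)
  show ?thesis by (subst eq) (simp add: uea_class_add free_const_closed)
qed

lemma uea_const_mult:
  "uea_class L (free_const (c * d)) = uea_class L (free_const c) \<otimes>\<^bsub>uea L\<^esub> uea_class L (free_const d)"
proof -
  have eq: "free_const (c * d) = (\<lambda>w. c * free_const d w)" by (auto simp: free_const_def)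
  show ?thesis by (subst eq) (simp add: uea_class_mult free_const_closed)
qed

lemma uea_gen_commutator:
  assumes "x \<in> carrier L" "y \<in> carrier L"
  shows "uea_class L (free_gen x) \<otimes>\<^bsub>uea L\<^esub> uea_class L (free_gen y) =
    uea_class L (free_gen (bracket L x y)) \<oplus>\<^bsub>uea L\<^esub>
    uea_class L (free_gen y) \<otimes>\<^bsub>uea L\<^esub> uea_class L (free_gen x)"
proof -
  let ?xy = "free_gen x \<otimes>\<^bsub>free_alg L\<^esub> free_gen y" and ?yx = "free_gen y \<otimes>\<^bsub>free_alg L\<^esub> free_gen x"
  have eq: "(\<lambda>w. ?xy w - (free_gen (bracket L x y) w + ?yx w)) = (\<lambda>w. ?xy w - ?yx w - free_gen (bracket L x y) w)"
    by (simp add: fun_eq_iff)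
  have "uea_class L ?xy = uea_class L (\<lambda>w. free_gen (bracket L x y) w + ?yx w)"
  proof (rule uea_class_relator)
    show "(\<lambda>w. ?xy w - (free_gen (bracket L x y) w + ?yx w)) \<in> uea_relators L"
      unfolding eq uea_relators_def using assms by blast
  qed (use assms in \<open>simp_all add: free_mult_closed free_gen_closed free_add_closed bracket_closed\<close>)
  then show ?thesis
    using assms by (simp add: uea_class_mult uea_class_add free_mult_closed free_gen_closed bracket_closed)
qed

end

context lie_module begin

lemma uea_act_const: "v \<in> carrier V \<Longrightarrow> uea_act V (uea_class L (free_const c)) v = c \<odot>\<^bsub>V\<^esub> v"
  by (simp add: uea_act_class free_const_closed)

lemma uea_act_gen: "x \<in> carrier L \<Longrightarrow> v \<in> carrier V \<Longrightarrow> uea_act V (uea_class L (free_gen x)) v = x \<rhd>\<^bsub>V\<^esub> v"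
  by (simp add: uea_act_class free_gen_closed)

end

section \<open>Induced modules\<close>

locale lie_subalgebra = lie_algebra L + K: lie_algebra K
  for K :: "'l lie_alg" and L :: "'l lie_alg" (structure) +
  assumes subalgebra_eq: "K = L\<lparr>carrier := carrier K\<rparr>"
    and subalgebra_subset: "carrier K \<subseteq> carrier L"
begin

lemma subalgebra_ops:
  "x \<oplus>\<^bsub>K\<^esub> y = x \<oplus> y" "c \<odot>\<^bsub>K\<^esub> x = c \<odot> x" "bracket K x y = bracket L x y" "\<zero>\<^bsub>K\<^esub> = \<zero>"
  by (subst subalgebra_eq, simp)+

lemma subalgebra_mem: "x \<in> carrier K \<Longrightarrow> x \<in> carrier L"
  using subalgebra_subset by blast

lemma free_subalgebra: "a \<in> carrier (free_alg K) \<Longrightarrow> a \<in> carrier (free_alg L)"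
  using subalgebra_subset by (auto simp: free_carrier_iff)

lemma free_subalgebra_mult: "a \<otimes>\<^bsub>free_alg K\<^esub> b = a \<otimes>\<^bsub>free_alg L\<^esub> b"
  by (simp add: free_alg_def)

text \<open>The ideal of the large free algebra cuts out an ideal of the small one that contains the relators
  of the subalgebra.\<close>

lemma uea_ideal_subalgebra: "uea_ideal K \<subseteq> uea_ideal L"
proof -
  define I where "I = uea_ideal L \<inter> carrier (free_alg K)"
  have "ideal I (free_alg K)"
  proof (rule idealI[OF ring_free_alg])
    show "subgroup I (add_monoid (free_alg K))"
    proof (rule group.subgroupI)
      show "group (add_monoid (free_alg K))" by (rule K.F.add.is_group)
      show "I \<subseteq> carrier (add_monoid (free_alg K))" by (auto simp: I_def)
      show "I \<noteq> {}" using UI.zero_closed K.F.zero_closed by (auto simp: I_def)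
      fix a assume a: "a \<in> I"
      have inv: "\<ominus>\<^bsub>free_alg M\<^esub> a = (\<lambda>w. - 1 * a w)" if "a \<in> carrier (free_alg M)" for M :: "'l lie_alg"
        using free_scale_closed[of a M "-1"] that
        by (intro abelian_group.minus_equality ring.is_abelian_group ring_free_alg) simp_all
      have aK: "a \<in> carrier (free_alg K)" and aI: "a \<in> uea_ideal L" using a by (auto simp: I_def)
      have "(\<lambda>w. - 1 * a w) \<in> uea_ideal L"
        using UI.a_inv_closed[OF aI] inv[OF free_subalgebra[OF aK]] by simp
      then have "(\<lambda>w. - 1 * a w) \<in> I" using free_scale_closed[OF aK, of "-1"] by (simp add: I_def)
      then show "inv\<^bsub>add_monoid (free_alg K)\<^esub> a \<in> I"
        using inv[OF aK] by (simp add: a_inv_def)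
      fix b assume "b \<in> I"
      then show "a \<otimes>\<^bsub>add_monoid (free_alg K)\<^esub> b \<in> I"
        using a UI.a_closed[of a b] by (auto simp: I_def free_add_closed)
    qed
  next
    fix a x assume "a \<in> I" "x \<in> carrier (free_alg K)"
    then show "x \<otimes>\<^bsub>free_alg K\<^esub> a \<in> I" "a \<otimes>\<^bsub>free_alg K\<^esub> x \<in> I"
      using UI.I_l_closed[of a x] UI.I_r_closed[of a x] free_subalgebra[of x]
      by (auto simp: I_def free_mult_closed) (simp_all add: free_subalgebra_mult)
  qed
  moreover have "uea_relators K \<subseteq> I"
  proof -
    have "uea_relators K \<subseteq> uea_relators L"
      unfolding uea_relators_def subalgebra_ops free_subalgebra_mult
      by (intro Un_mono Collect_mono ex_mono impI) (use subalgebra_mem in blast)+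
    then show ?thesis using K.uea_relators_subset uea_relators_in_ideal by (auto simp: I_def)
  qed
  ultimately have "uea_ideal K \<subseteq> I" by (rule K.uea_ideal_minimal)
  then show ?thesis by (auto simp: I_def)
qed

lemma uea_incl_class:
  assumes "a \<in> carrier (free_alg K)" shows "uea_incl L (uea_class K a) = uea_class L a"
proof -
  have "uea_class L b = uea_class L a" if "b \<in> uea_class K a" for b
    using K.uea_class_mem[OF assms that] uea_ideal_subalgebra assms
    by (intro uea_class_eqI) (auto intro: free_subalgebra)
  moreover have "a \<in> uea_class K a" by (rule K.uea_class_self[OF assms])
  ultimately show ?thesis unfolding uea_incl_def by blast
qed

end

text \<open>The tensor product is a quotient of a free abelian group, which sits inside the additive group of
  all finitely supported integer combinations. Its cosets are translates of the subgroup \<open>rel\<close> in that larger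
  group, so calculations with cosets become calculations with \<open>+\<close> and \<open>-\<close> of the type.\<close>

locale induced_module = lie_subalgebra K L + B: lie_module K B
  for K :: "'l lie_alg" and L :: "'l lie_alg" (structure) and B :: "('l, 'v) lie_mod"
begin

definition pairs where "pairs = carrier (uea L) \<times> carrier B"
definition rel where "rel = ind_rel K L B"
definition relators where
  "relators = tensor_relators (uea K) (uea L) (\<lambda>u k. u \<otimes>\<^bsub>uea L\<^esub> uea_incl L k) B (uea_act B)"
definition cls where "cls f = (\<lambda>h. h + f) ` rel"
definition tensor where "tensor u v = ind_tensor K L B u v"
definition Ind where "Ind = ind K L B"
definition mult_on_left where
  "mult_on_left u = frag_extend (\<lambda>(u', v). frag_of (u \<otimes>\<^bsub>uea L\<^esub> u', v :: 'v))"

lemma uea_incl_closed: "k \<in> carrier (uea K) \<Longrightarrow> uea_incl L k \<in> carrier (uea L)"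
  by (auto simp: K.uea_carrier uea_incl_class free_subalgebra uea_class_closed)

lemma ind_free_simps:
  "f \<in> carrier (ind_free L B) \<longleftrightarrow> Poly_Mapping.keys f \<subseteq> pairs"
  "f \<otimes>\<^bsub>ind_free L B\<^esub> g = f + g" "\<one>\<^bsub>ind_free L B\<^esub> = 0"
  by (simp_all add: ind_free_def pairs_def)

lemma group_ind_free: "group (ind_free L B)" by (simp add: ind_free_def)

lemma keys_minus_subset: "Poly_Mapping.keys f \<subseteq> S \<Longrightarrow> Poly_Mapping.keys g \<subseteq> S \<Longrightarrow> Poly_Mapping.keys (f - g) \<subseteq> S"
  by (rule order_trans[OF keys_diff]) simp

lemma relators_keys: "f \<in> relators \<Longrightarrow> Poly_Mapping.keys f \<subseteq> pairs"
  unfolding relators_def tensor_relators_def pairs_def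
proof (elim UnE CollectE exE conjE, goal_cases)
  case (1 m m' n)
  then show ?case by (simp only: 1) (intro keys_minus_subset; simp add: 1)
next
  case (2 m n n')
  then show ?case by (simp only: 2) (intro keys_minus_subset; simp add: 2)
next
  case (3 m r n)
  then show ?case
    by (simp only: 3) (intro keys_minus_subset; simp add: 3 uea_incl_closed B.uea_act_closed)
qed

lemma relators_carrier: "relators \<subseteq> carrier (ind_free L B)"
  using relators_keys by (auto simp: ind_free_simps)

lemma rel_eq: "rel = generate (ind_free L B) relators"
  by (simp add: rel_def ind_rel_def relators_def)

lemma rel_subgroup: "subgroup rel (ind_free L B)"
  unfolding rel_eq by (rule group.generate_is_subgroup[OF group_ind_free relators_carrier])

lemma rel_keys: "f \<in> rel \<Longrightarrow> Poly_Mapping.keys f \<subseteq> pairs"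
  using subgroup.mem_carrier[OF rel_subgroup] by (simp add: ind_free_simps)

lemma rel_zero: "0 \<in> rel"
  using subgroup.one_closed[OF rel_subgroup] by (simp add: ind_free_simps)

lemma rel_add: "f \<in> rel \<Longrightarrow> g \<in> rel \<Longrightarrow> f + g \<in> rel"
  using subgroup.m_closed[OF rel_subgroup, of f g] by (simp add: ind_free_simps)

lemma inv_ind_free: "Poly_Mapping.keys f \<subseteq> pairs \<Longrightarrow> inv\<^bsub>ind_free L B\<^esub> f = - f"
  by (simp add: ind_free_def pairs_def)

lemma rel_uminus: "f \<in> rel \<Longrightarrow> - f \<in> rel"
  using subgroup.m_inv_closed[OF rel_subgroup, of f] rel_keys[of f] by (simp add: inv_ind_free)

lemma rel_diff: "f \<in> rel \<Longrightarrow> g \<in> rel \<Longrightarrow> f - g \<in> rel"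
  using rel_add[of f "-g"] rel_uminus[of g] by simp

lemma relators_rel: "f \<in> relators \<Longrightarrow> f \<in> rel"
  unfolding rel_eq by (rule generate.incl)

text \<open>Used to see that additive maps vanish on \<open>rel\<close>, or preserve it, once they do so on the relators.\<close>

lemma rel_induct [consumes 1, case_names relator zero add uminus]:
  assumes "f \<in> rel" and "\<And>f. f \<in> relators \<Longrightarrow> P f" and "P 0"
    and "\<And>f g. f \<in> rel \<Longrightarrow> g \<in> rel \<Longrightarrow> P f \<Longrightarrow> P g \<Longrightarrow> P (f + g)"
    and "\<And>f. f \<in> rel \<Longrightarrow> P f \<Longrightarrow> P (- f)"
  shows "P f"
  using assms(1) unfolding rel_eq
proof (induction f rule: generate.induct)
  case one then show ?case using assms(3) by (simp add: ind_free_simps)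
next
  case (incl h) then show ?case using assms(2) by simp
next
  case (inv h) then show ?case using assms(2,5) relators_rel relators_keys by (simp add: inv_ind_free)
next
  case (eng f g) then show ?case using assms(4) by (simp add: ind_free_simps rel_eq)
qed

lemma r_coset_eq: "rel #>\<^bsub>ind_free L B\<^esub> f = cls f"
  by (auto simp: r_coset_def ind_free_simps cls_def)

lemma cls_eq_iff: "cls f = cls g \<longleftrightarrow> f - g \<in> rel"
proof
  assume "cls f = cls g"
  moreover have "f \<in> cls f" unfolding cls_def using rel_zero by force
  ultimately show "f - g \<in> rel" by (auto simp: cls_def)
next
  assume r: "f - g \<in> rel"
  have "h + f \<in> cls g" if "h \<in> rel" for h
    unfolding cls_def by (rule image_eqI[of _ _ "h + (f - g)"]) (simp_all add: rel_add r that)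
  moreover have "h + g \<in> cls f" if "h \<in> rel" for h
    unfolding cls_def by (rule image_eqI[of _ _ "h - (f - g)"]) (simp_all add: rel_diff r that)
  ultimately show "cls f = cls g" by (force simp: cls_def)
qed

lemma cls_self: "f \<in> cls f" unfolding cls_def using rel_zero by force

lemma tensor_eq: "tensor u v = cls (frag_of (u, v))"
  by (simp add: tensor_def ind_tensor_def r_coset_eq flip: rel_def)

lemma Ind_carrier: "carrier Ind = cls ` {f. Poly_Mapping.keys f \<subseteq> pairs}"
  by (auto simp: Ind_def ind_def carrier_FactGroup r_coset_eq ind_free_simps simp flip: rel_def)

lemma Ind_zero: "\<zero>\<^bsub>Ind\<^esub> = cls 0"
  by (simp add: Ind_def ind_def cls_def flip: rel_def)

lemma Ind_add: "cls f \<oplus>\<^bsub>Ind\<^esub> cls g = cls (f + g)"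
proof -
  have "cls f \<oplus>\<^bsub>Ind\<^esub> cls g = (\<Union>h\<in>rel. \<Union>k\<in>rel. {(h + f) + (k + g)})"
    by (simp add: Ind_def ind_def set_mult_def ind_free_simps cls_def)
  also have "\<dots> = cls (f + g)"
  proof (intro equalityI subsetI)
    fix x assume "x \<in> (\<Union>h\<in>rel. \<Union>k\<in>rel. {(h + f) + (k + g)})"
    then obtain h k where hk: "h \<in> rel" "k \<in> rel" "x = (h + f) + (k + g)" by blast
    then have "x = (h + k) + (f + g)" by (simp add: algebra_simps)
    then show "x \<in> cls (f + g)" unfolding cls_def using rel_add hk by blast
  next
    fix x assume "x \<in> cls (f + g)"
    then obtain h where "h \<in> rel" "x = (h + f) + (0 + g)" by (auto simp: cls_def algebra_simps)
    then show "x \<in> (\<Union>h\<in>rel. \<Union>k\<in>rel. {(h + f) + (k + g)})" using rel_zero by blast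
  qed
  finally show ?thesis .
qed

lemma mult_on_left_simps:
  "mult_on_left u (frag_of (u', v)) = frag_of (u \<otimes>\<^bsub>uea L\<^esub> u', v)" "mult_on_left u 0 = 0"
  "mult_on_left u (f + g) = mult_on_left u f + mult_on_left u g"
  "mult_on_left u (f - g) = mult_on_left u f - mult_on_left u g"
  "mult_on_left u (- f) = - mult_on_left u f"
  by (simp_all add: mult_on_left_def frag_extend_add frag_extend_diff frag_extend_minus)

lemma mult_on_left_keys:
  assumes "Poly_Mapping.keys f \<subseteq> pairs" "u \<in> carrier (uea L)"
  shows "Poly_Mapping.keys (mult_on_left u f) \<subseteq> pairs"
  using assms(1)
proof (induction f rule: free_Abelian_group_induct[consumes 1, case_names zero diff of])
  case (diff f g) then show ?case by (simp add: mult_on_left_simps keys_minus_subset)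
next
  case (of a) then show ?case using assms(2) by (cases a) (auto simp: mult_on_left_simps pairs_def)
qed (simp add: mult_on_left_simps)

text \<open>Left multiplication by an element of the enveloping algebra takes each of the three kinds of
  relators to itself. Hence it acts on the tensor product.\<close>

lemma mult_on_left_relators:
  assumes "u \<in> carrier (uea L)" "f \<in> relators" shows "mult_on_left u f \<in> relators"
proof -
  have "\<exists>m m' n. mult_on_left u f = frag_of (m \<oplus>\<^bsub>uea L\<^esub> m', n) - frag_of (m, n) - frag_of (m', n) \<and>
      m \<in> carrier (uea L) \<and> m' \<in> carrier (uea L) \<and> n \<in> carrier B"
    if "f = frag_of (m \<oplus>\<^bsub>uea L\<^esub> m', n) - frag_of (m, n) - frag_of (m', n)"
      "m \<in> carrier (uea L)" "m' \<in> carrier (uea L)" "n \<in> carrier B" for m m' n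
    using that assms(1)
    by (intro exI[of _ "u \<otimes>\<^bsub>uea L\<^esub> m"] exI[of _ "u \<otimes>\<^bsub>uea L\<^esub> m'"] exI[of _ n])
      (simp add: mult_on_left_simps U.r_distr)
  moreover have "\<exists>m n n'. mult_on_left u f = frag_of (m, n \<oplus>\<^bsub>B\<^esub> n') - frag_of (m, n) - frag_of (m, n') \<and>
      m \<in> carrier (uea L) \<and> n \<in> carrier B \<and> n' \<in> carrier B"
    if "f = frag_of (m, n \<oplus>\<^bsub>B\<^esub> n') - frag_of (m, n) - frag_of (m, n')"
      "m \<in> carrier (uea L)" "n \<in> carrier B" "n' \<in> carrier B" for m n n'
    using that assms(1)
    by (intro exI[of _ "u \<otimes>\<^bsub>uea L\<^esub> m"] exI[of _ n] exI[of _ n']) (simp add: mult_on_left_simps)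
  moreover have "\<exists>m r n. mult_on_left u f = frag_of (m \<otimes>\<^bsub>uea L\<^esub> uea_incl L r, n) - frag_of (m, uea_act B r n) \<and>
      m \<in> carrier (uea L) \<and> r \<in> carrier (uea K) \<and> n \<in> carrier B"
    if "f = frag_of (m \<otimes>\<^bsub>uea L\<^esub> uea_incl L r, n) - frag_of (m, uea_act B r n)"
      "m \<in> carrier (uea L)" "r \<in> carrier (uea K)" "n \<in> carrier B" for m r n
    using that assms(1)
    by (intro exI[of _ "u \<otimes>\<^bsub>uea L\<^esub> m"] exI[of _ r] exI[of _ n])
      (simp add: mult_on_left_simps U.m_assoc uea_incl_closed)
  ultimately show ?thesis
    using assms(2) unfolding relators_def tensor_relators_def
    by (elim UnE CollectE exE conjE) (simp_all only: Un_iff mem_Collect_eq, blast+)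
qed

lemma mult_on_left_rel:
  assumes "u \<in> carrier (uea L)" "f \<in> rel" shows "mult_on_left u f \<in> rel"
  using assms(2)
  by (induction f rule: rel_induct)
    (simp_all add: mult_on_left_simps rel_zero rel_add rel_uminus relators_rel mult_on_left_relators assms(1))

lemma ind_uea_act_cls:
  assumes "u \<in> carrier (uea L)"
  shows "ind_uea_act K L B u (cls f) = cls (mult_on_left u f)"
proof -
  have "cls (mult_on_left u g) = cls (mult_on_left u f)" if "g \<in> cls f" for g
  proof -
    have "g - f \<in> rel" using that by (auto simp: cls_def)
    then show ?thesis using mult_on_left_rel[OF assms, of "g - f"] by (simp add: cls_eq_iff mult_on_left_simps)
  qed
  moreover have "ind_uea_act K L B u (cls f) = (\<Union>g\<in>cls f. cls (mult_on_left u g))"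
    by (simp add: ind_uea_act_def r_coset_eq mult_on_left_def flip: rel_def)
  ultimately show ?thesis using cls_self[of f] by blast
qed

end

context induced_module begin

definition uact where "uact = ind_uea_act K L B"

lemma tensor_add_left:
  assumes "u \<in> carrier (uea L)" "u' \<in> carrier (uea L)" "v \<in> carrier B"
  shows "tensor (u \<oplus>\<^bsub>uea L\<^esub> u') v = tensor u v \<oplus>\<^bsub>Ind\<^esub> tensor u' v"
proof -
  have "frag_of (u \<oplus>\<^bsub>uea L\<^esub> u', v) - frag_of (u, v) - frag_of (u', v) \<in> relators"
    unfolding relators_def tensor_relators_def using assms by blast
  then show ?thesis by (simp add: tensor_eq Ind_add cls_eq_iff diff_diff_add relators_rel)
qed

lemma tensor_add_right:
  assumes "u \<in> carrier (uea L)" "v \<in> carrier B" "v' \<in> carrier B"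
  shows "tensor u (v \<oplus>\<^bsub>B\<^esub> v') = tensor u v \<oplus>\<^bsub>Ind\<^esub> tensor u v'"
proof -
  have "frag_of (u, v \<oplus>\<^bsub>B\<^esub> v') - frag_of (u, v) - frag_of (u, v') \<in> relators"
    unfolding relators_def tensor_relators_def using assms by blast
  then show ?thesis by (simp add: tensor_eq Ind_add cls_eq_iff diff_diff_add relators_rel)
qed

lemma tensor_balanced:
  assumes "u \<in> carrier (uea L)" "k \<in> carrier (uea K)" "v \<in> carrier B"
  shows "tensor (u \<otimes>\<^bsub>uea L\<^esub> uea_incl L k) v = tensor u (uea_act B k v)"
proof -
  have "frag_of (u \<otimes>\<^bsub>uea L\<^esub> uea_incl L k, v) - frag_of (u, uea_act B k v) \<in> relators"
    unfolding relators_def tensor_relators_def using assms by blast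
  then show ?thesis by (simp add: tensor_eq cls_eq_iff relators_rel)
qed

lemma tensor_closed: "u \<in> carrier (uea L) \<Longrightarrow> v \<in> carrier B \<Longrightarrow> tensor u v \<in> carrier Ind"
  by (auto simp: tensor_eq Ind_carrier pairs_def)

lemma Ind_cases:
  assumes "X \<in> carrier Ind" obtains f where "X = cls f" "Poly_Mapping.keys f \<subseteq> pairs"
  using assms by (auto simp: Ind_carrier)

lemma keys_plus_subset: "Poly_Mapping.keys f \<subseteq> S \<Longrightarrow> Poly_Mapping.keys g \<subseteq> S \<Longrightarrow> Poly_Mapping.keys (f + g) \<subseteq> S"
  by (rule order_trans[OF keys_add]) simp

lemma abelian_group_Ind: "abelian_group Ind"
proof (rule abelian_groupI)
  fix X Y Z assume "X \<in> carrier Ind" "Y \<in> carrier Ind" "Z \<in> carrier Ind"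
  then show "X \<oplus>\<^bsub>Ind\<^esub> Y \<oplus>\<^bsub>Ind\<^esub> Z = X \<oplus>\<^bsub>Ind\<^esub> (Y \<oplus>\<^bsub>Ind\<^esub> Z)"
    by (elim Ind_cases) (simp add: Ind_add add.assoc)
next
  fix X Y assume "X \<in> carrier Ind" "Y \<in> carrier Ind"
  then show "X \<oplus>\<^bsub>Ind\<^esub> Y = Y \<oplus>\<^bsub>Ind\<^esub> X"
    by (elim Ind_cases) (simp add: Ind_add add.commute)
next
  fix X Y assume "X \<in> carrier Ind" "Y \<in> carrier Ind"
  then show "X \<oplus>\<^bsub>Ind\<^esub> Y \<in> carrier Ind"
    by (elim Ind_cases) (simp add: Ind_add, simp add: Ind_carrier keys_plus_subset)
next
  fix X assume "X \<in> carrier Ind"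
  then show "\<zero>\<^bsub>Ind\<^esub> \<oplus>\<^bsub>Ind\<^esub> X = X" by (elim Ind_cases) (simp add: Ind_add Ind_zero)
next
  fix X assume "X \<in> carrier Ind"
  then obtain f where f: "X = cls f" "Poly_Mapping.keys f \<subseteq> pairs" by (rule Ind_cases)
  then show "\<exists>Y\<in>carrier Ind. Y \<oplus>\<^bsub>Ind\<^esub> X = \<zero>\<^bsub>Ind\<^esub>"
    by (intro bexI[of _ "cls (- f)"]) (simp_all add: Ind_add Ind_zero Ind_carrier)
qed (simp add: Ind_zero Ind_carrier)

sublocale I: abelian_group Ind by (rule abelian_group_Ind)

lemma tensor_zero_right:
  assumes "u \<in> carrier (uea L)" shows "tensor u \<zero>\<^bsub>B\<^esub> = \<zero>\<^bsub>Ind\<^esub>"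
  using tensor_add_right[OF assms, of "\<zero>\<^bsub>B\<^esub>" "\<zero>\<^bsub>B\<^esub>"] tensor_closed[OF assms, of "\<zero>\<^bsub>B\<^esub>"]
  by (simp add: I.add.l_cancel_one')

lemma tensor_minus_right:
  assumes "u \<in> carrier (uea L)" "v \<in> carrier B" shows "tensor u (\<ominus>\<^bsub>B\<^esub> v) = cls (- frag_of (u, v))"
proof -
  have "cls (frag_of (u, v)) \<oplus>\<^bsub>Ind\<^esub> tensor u (\<ominus>\<^bsub>B\<^esub> v) = \<zero>\<^bsub>Ind\<^esub>"
    using tensor_add_right[OF assms, of "\<ominus>\<^bsub>B\<^esub> v"] assms
    by (simp add: B.V.M.r_neg tensor_zero_right flip: tensor_eq)
  then show ?thesis by (simp add: tensor_eq Ind_add Ind_zero cls_eq_iff add.commute)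
qed

text \<open>Elements of the induced module are finite sums of elementary tensors; signs are absorbed by
  the right factor.\<close>

lemma Ind_induct [consumes 1, case_names tensor add]:
  assumes "X \<in> carrier Ind"
    and tens: "\<And>u v. u \<in> carrier (uea L) \<Longrightarrow> v \<in> carrier B \<Longrightarrow> P (tensor u v)"
    and add: "\<And>X Y. X \<in> carrier Ind \<Longrightarrow> Y \<in> carrier Ind \<Longrightarrow> P X \<Longrightarrow> P Y \<Longrightarrow> P (X \<oplus>\<^bsub>Ind\<^esub> Y)"
  shows "P X"
proof -
  have "P (cls f) \<and> P (cls (- f))" if "Poly_Mapping.keys f \<subseteq> pairs" for f
    using that
  proof (induction f rule: free_Abelian_group_induct[consumes 1, case_names zero diff of])
    case zero
    have "P \<zero>\<^bsub>Ind\<^esub>" using tens[of "\<one>\<^bsub>uea L\<^esub>" "\<zero>\<^bsub>B\<^esub>"] by (simp add: tensor_zero_right)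
    then show ?case by (simp add: Ind_zero)
  next
    case (diff f g)
    have "cls f \<in> carrier Ind" "cls g \<in> carrier Ind" "cls (- f) \<in> carrier Ind" "cls (- g) \<in> carrier Ind"
      using diff by (auto simp: Ind_carrier)
    then have "P (cls f \<oplus>\<^bsub>Ind\<^esub> cls (- g))" "P (cls g \<oplus>\<^bsub>Ind\<^esub> cls (- f))" using diff add by blast+
    then show ?case by (simp add: Ind_add)
  next
    case (of a)
    then obtain u v where a: "a = (u, v)" "u \<in> carrier (uea L)" "v \<in> carrier B" by (auto simp: pairs_def)
    then show ?case using tens[of u v] tens[of u "\<ominus>\<^bsub>B\<^esub> v"] tensor_minus_right[of u v]
      by (simp add: tensor_eq[of u v])
  qed
  then show ?thesis using assms(1) by (elim Ind_cases) blast
qed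

lemma uact_closed: "u \<in> carrier (uea L) \<Longrightarrow> X \<in> carrier Ind \<Longrightarrow> uact u X \<in> carrier Ind"
  by (auto simp: uact_def Ind_carrier ind_uea_act_cls mult_on_left_keys)

lemma uact_tensor: "u \<in> carrier (uea L) \<Longrightarrow> uact u (tensor u' v) = tensor (u \<otimes>\<^bsub>uea L\<^esub> u') v"
  by (simp add: uact_def tensor_eq ind_uea_act_cls mult_on_left_simps)

lemma uact_add_right:
  "u \<in> carrier (uea L) \<Longrightarrow> X \<in> carrier Ind \<Longrightarrow> Y \<in> carrier Ind \<Longrightarrow>
    uact u (X \<oplus>\<^bsub>Ind\<^esub> Y) = uact u X \<oplus>\<^bsub>Ind\<^esub> uact u Y"
  by (elim Ind_cases) (simp add: uact_def Ind_add ind_uea_act_cls mult_on_left_simps)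

lemma uact_add_left:
  assumes "u \<in> carrier (uea L)" "u' \<in> carrier (uea L)" "X \<in> carrier Ind"
  shows "uact (u \<oplus>\<^bsub>uea L\<^esub> u') X = uact u X \<oplus>\<^bsub>Ind\<^esub> uact u' X"
  using assms(3)
proof (induction X rule: Ind_induct)
  case (tensor w v)
  then show ?case using assms(1,2) by (simp add: uact_tensor tensor_add_left U.l_distr)
next
  case (add X Y)
  then show ?case using assms(1,2) by (simp add: uact_add_right uact_closed I.a_ac)
qed

lemma uact_mult:
  assumes "u \<in> carrier (uea L)" "u' \<in> carrier (uea L)" "X \<in> carrier Ind"
  shows "uact (u \<otimes>\<^bsub>uea L\<^esub> u') X = uact u (uact u' X)"
  using assms(3)
proof (induction X rule: Ind_induct)
  case (tensor w v)
  then show ?case using assms(1,2) by (simp add: uact_tensor U.m_assoc)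
next
  case (add X Y)
  then show ?case using assms(1,2) by (simp add: uact_add_right uact_closed)
qed

lemma uact_one:
  assumes "X \<in> carrier Ind" shows "uact \<one>\<^bsub>uea L\<^esub> X = X"
  using assms by (induction X rule: Ind_induct) (simp_all add: uact_tensor uact_add_right)

lemma Ind_ops:
  "c \<odot>\<^bsub>Ind\<^esub> X = uact (uea_class L (free_const c)) X"
  "x \<rhd>\<^bsub>Ind\<^esub> X = uact (uea_class L (free_gen x)) X"
  by (simp_all add: Ind_def ind_def uact_def)

lemma lie_module_Ind: "lie_module L Ind"
proof (intro lie_module.intro lie_algebra_axioms lie_module_axioms.intro)
  note [simp] = Ind_ops uea_class_closed free_const_closed free_gen_closed uact_closed bracket_closed
  show "Module.module complex_ring Ind"
    by (rule Module.moduleI[OF cring_complex abelian_group_Ind])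
      (simp_all add: uea_const_add uea_const_mult uact_add_left uact_add_right uact_mult
        uact_one flip: uea_one)
  fix x y X Y c assume X: "X \<in> carrier Ind" and x: "x \<in> carrier L"
  show "x \<rhd>\<^bsub>Ind\<^esub> X \<in> carrier Ind" using x X by simp
  show "(c \<odot> x) \<rhd>\<^bsub>Ind\<^esub> X = c \<odot>\<^bsub>Ind\<^esub> x \<rhd>\<^bsub>Ind\<^esub> X"
    using x X by (simp add: uea_gen_smult uact_mult)
  show "x \<rhd>\<^bsub>Ind\<^esub> (c \<odot>\<^bsub>Ind\<^esub> X) = c \<odot>\<^bsub>Ind\<^esub> x \<rhd>\<^bsub>Ind\<^esub> X"
    using x X by (simp add: uea_const_central flip: uact_mult)
  show "x \<rhd>\<^bsub>Ind\<^esub> (X \<oplus>\<^bsub>Ind\<^esub> Y) = x \<rhd>\<^bsub>Ind\<^esub> X \<oplus>\<^bsub>Ind\<^esub> x \<rhd>\<^bsub>Ind\<^esub> Y" if "Y \<in> carrier Ind"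
    using x X that by (simp add: uact_add_right)
  assume y: "y \<in> carrier L"
  show "(x \<oplus> y) \<rhd>\<^bsub>Ind\<^esub> X = x \<rhd>\<^bsub>Ind\<^esub> X \<oplus>\<^bsub>Ind\<^esub> y \<rhd>\<^bsub>Ind\<^esub> X"
    using x y X by (simp add: uea_gen_add uact_add_left)
  have "x \<rhd>\<^bsub>Ind\<^esub> y \<rhd>\<^bsub>Ind\<^esub> X = bracket L x y \<rhd>\<^bsub>Ind\<^esub> X \<oplus>\<^bsub>Ind\<^esub> y \<rhd>\<^bsub>Ind\<^esub> x \<rhd>\<^bsub>Ind\<^esub> X"
    using x y X uact_add_left[of "uea_class L (free_gen (bracket L x y))"
        "uea_class L (free_gen y) \<otimes>\<^bsub>uea L\<^esub> uea_class L (free_gen x)" X]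
    by (simp add: uea_gen_commutator[OF x y, symmetric] uact_mult)
  then show "bracket L x y \<rhd>\<^bsub>Ind\<^esub> X = (x \<rhd>\<^bsub>Ind\<^esub> y \<rhd>\<^bsub>Ind\<^esub> X) \<ominus>\<^bsub>Ind\<^esub> (y \<rhd>\<^bsub>Ind\<^esub> x \<rhd>\<^bsub>Ind\<^esub> X)"
    using x y X unfolding I.minus_eq by (simp add: I.a_assoc I.r_neg)
qed

sublocale IM: lie_module L Ind by (rule lie_module_Ind)

lemma ind_unit_eq: "ind_unit K L B v = tensor \<one>\<^bsub>uea L\<^esub> v"
  by (simp add: ind_unit_def tensor_def)

lemma tensor_eq_uact:
  assumes "u \<in> carrier (uea L)" shows "tensor u v = uact u (ind_unit K L B v)"
  using assms by (simp add: ind_unit_eq uact_tensor)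

lemma ind_unit_closed: "v \<in> carrier B \<Longrightarrow> ind_unit K L B v \<in> carrier Ind"
  by (simp add: ind_unit_eq tensor_closed)

lemma ind_unit_add:
  "v \<in> carrier B \<Longrightarrow> v' \<in> carrier B \<Longrightarrow>
    ind_unit K L B (v \<oplus>\<^bsub>B\<^esub> v') = ind_unit K L B v \<oplus>\<^bsub>Ind\<^esub> ind_unit K L B v'"
  by (simp add: ind_unit_eq tensor_add_right)

lemma ind_unit_uact:
  assumes "a \<in> carrier (free_alg K)" "v \<in> carrier B"
  shows "ind_unit K L B (free_act B a v) = uact (uea_class L a) (ind_unit K L B v)"
  using tensor_balanced[of "\<one>\<^bsub>uea L\<^esub>" "uea_class K a" v] assms
  by (simp add: ind_unit_eq uea_incl_class uact_tensor B.uea_act_class K.uea_class_closed uea_class_closed free_subalgebra)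

lemma ind_unit_smult: "v \<in> carrier B \<Longrightarrow> ind_unit K L B (c \<odot>\<^bsub>B\<^esub> v) = c \<odot>\<^bsub>Ind\<^esub> ind_unit K L B v"
  using ind_unit_uact[of "free_const c" v] by (simp add: free_const_closed Ind_ops)

lemma ind_unit_act:
  "x \<in> carrier K \<Longrightarrow> v \<in> carrier B \<Longrightarrow> ind_unit K L B (x \<rhd>\<^bsub>B\<^esub> v) = x \<rhd>\<^bsub>Ind\<^esub> ind_unit K L B v"
  using ind_unit_uact[of "free_gen x" v] by (simp add: free_gen_closed Ind_ops)

lemma uact_eq_free_act:
  assumes "a \<in> carrier (free_alg L)" "X \<in> carrier Ind"
  shows "uact (uea_class L a) X = free_act Ind a X"
  using assms(1)
proof (induction a rule: free_alg_induct)
  case (const c) then show ?case using assms(2) by (simp add: Ind_ops)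
next
  case (gen x a)
  then show ?case using assms(2)
    by (simp add: IM.free_act_gen_mult uact_mult free_gen_closed uea_class_closed Ind_ops flip: uea_class_mult)
next
  case (add a b)
  then show ?case using assms(2)
    by (simp add: IM.free_act_add uact_add_left uea_class_closed flip: uea_class_add)
qed

text \<open>The enveloping algebra is spanned by words, and a word times \<open>1 \<otimes> v\<close> is reached from \<open>1 \<otimes> v\<close> by
  acting with the letters of the word.\<close>

lemma Ind_generated:
  assumes N: "lie_submodule L N Ind" and unit: "\<And>v. v \<in> carrier B \<Longrightarrow> ind_unit K L B v \<in> N"
  shows "N = carrier Ind"
proof
  have sub: "submodule N complex_ring Ind" using N by (simp add: lie_submodule_def)
  note E = Module.module.submoduleE[OF IM.V.module_axioms sub]
  show "N \<subseteq> carrier Ind" by (rule E(1))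
  have act: "free_act Ind a X \<in> N" if "a \<in> carrier (free_alg L)" "X \<in> N" for a X
    using that(1)
  proof (induction a rule: free_alg_induct)
    case (const c) then show ?case using that E(1) E(4)[of c X] by (auto simp del: Ind_ops)
  next
    case (gen x a)
    then show ?case using N that E(1) by (auto simp: IM.free_act_gen_mult lie_submodule_def)
  next
    case (add a b)
    then show ?case using that E(1,5) by (auto simp: IM.free_act_add)
  qed
  show "carrier Ind \<subseteq> N"
  proof
    fix X assume "X \<in> carrier Ind"
    then show "X \<in> N"
    proof (induction X rule: Ind_induct)
      case (tensor u v)
      then obtain a where "a \<in> carrier (free_alg L)" "u = uea_class L a" by (auto simp: uea_carrier)
      then show ?case using act[of a "ind_unit K L B v"] unit[OF tensor(2)] tensor
        by (simp add: tensor_eq_uact uact_eq_free_act ind_unit_closed)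
    qed (use E(5) in blast)
  qed
qed

end

text \<open>Frobenius reciprocity. The rule \<open>u \<otimes> v \<mapsto> u f(v)\<close> respects the relators; for the third kind this is
  because \<open>f\<close> intertwines the actions of the free algebra on the subalgebra.\<close>

lemma (in induced_module) Ind_universal:
  assumes V: "lie_module L V"
    and f: "\<And>v. v \<in> carrier B \<Longrightarrow> f v \<in> carrier V"
      "\<And>v w. v \<in> carrier B \<Longrightarrow> w \<in> carrier B \<Longrightarrow> f (v \<oplus>\<^bsub>B\<^esub> w) = f v \<oplus>\<^bsub>V\<^esub> f w"
      "\<And>c v. v \<in> carrier B \<Longrightarrow> f (c \<odot>\<^bsub>B\<^esub> v) = c \<odot>\<^bsub>V\<^esub> f v"
      "\<And>x v. x \<in> carrier K \<Longrightarrow> v \<in> carrier B \<Longrightarrow> f (x \<rhd>\<^bsub>B\<^esub> v) = x \<rhd>\<^bsub>V\<^esub> f v"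
  obtains F where "\<And>X. X \<in> carrier Ind \<Longrightarrow> F X \<in> carrier V"
      "\<And>X Y. X \<in> carrier Ind \<Longrightarrow> Y \<in> carrier Ind \<Longrightarrow> F (X \<oplus>\<^bsub>Ind\<^esub> Y) = F X \<oplus>\<^bsub>V\<^esub> F Y"
      "\<And>c X. X \<in> carrier Ind \<Longrightarrow> F (c \<odot>\<^bsub>Ind\<^esub> X) = c \<odot>\<^bsub>V\<^esub> F X"
      "\<And>x X. x \<in> carrier L \<Longrightarrow> X \<in> carrier Ind \<Longrightarrow> F (x \<rhd>\<^bsub>Ind\<^esub> X) = x \<rhd>\<^bsub>V\<^esub> F X"
      "\<And>v. v \<in> carrier B \<Longrightarrow> F (ind_unit K L B v) = f v"
proof -
  interpret V: lie_module L V by (rule V)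
  have "(\<lambda>(u, v). uea_act V u (f v)) ` pairs \<subseteq> carrier (add_monoid V)"
    using f(1) by (auto simp: pairs_def V.uea_act_closed)
  then obtain h where h: "h \<in> hom (free_Abelian_group pairs) (add_monoid V)"
    and h_of: "\<And>p. p \<in> pairs \<Longrightarrow> h (frag_of p) = (\<lambda>(u, v). uea_act V u (f v)) p"
    using comm_group.free_Abelian_group_universal[OF V.V.M.a_comm_group] by blast
  have h_closed: "h p \<in> carrier V" if "Poly_Mapping.keys p \<subseteq> pairs" for p
    using hom_in_carrier[OF h, of p] that by simp
  have h_add: "h (p + q) = h p \<oplus>\<^bsub>V\<^esub> h q" if "Poly_Mapping.keys p \<subseteq> pairs" "Poly_Mapping.keys q \<subseteq> pairs" for p q
    using hom_mult[OF h, of p q] that by simp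
  have h_0: "h 0 = \<zero>\<^bsub>V\<^esub>" using h_add[of 0 0] h_closed[of 0] by (simp add: V.V.M.add.l_cancel_one')
  have h_kill: "h r = \<zero>\<^bsub>V\<^esub>" if "h p = h q" "r = p - q" "Poly_Mapping.keys p \<subseteq> pairs" "Poly_Mapping.keys q \<subseteq> pairs" for r p q
  proof -
    have r: "Poly_Mapping.keys r \<subseteq> pairs" using that keys_minus_subset by simp
    have "h q = h r \<oplus>\<^bsub>V\<^esub> h q" using h_add[OF r that(4)] that by simp
    then show ?thesis using h_closed[OF r] h_closed[OF that(4)] by (simp add: V.V.M.add.r_cancel_one')
  qed
  have h_relator: "h r = \<zero>\<^bsub>V\<^esub>" if "r \<in> relators" for r
    using that unfolding relators_def tensor_relators_def
  proof (elim UnE CollectE exE conjE, goal_cases)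
    case (1 m m' n)
    have k: "Poly_Mapping.keys (frag_of (m, n) + frag_of (m', n)) \<subseteq> pairs"
      using 1 by (intro keys_plus_subset) (simp_all add: pairs_def)
    show ?case
      by (rule h_kill[where p = "frag_of (m \<oplus>\<^bsub>uea L\<^esub> m', n)" and q = "frag_of (m, n) + frag_of (m', n)"])
        (use 1 f(1) k in \<open>simp_all add: h_add h_of pairs_def V.uea_act_add_left\<close>)
  next
    case (2 m n n')
    have k: "Poly_Mapping.keys (frag_of (m, n) + frag_of (m, n')) \<subseteq> pairs"
      using 2 by (intro keys_plus_subset) (simp_all add: pairs_def)
    show ?case
      by (rule h_kill[where p = "frag_of (m, n \<oplus>\<^bsub>B\<^esub> n')" and q = "frag_of (m, n) + frag_of (m, n')"])
        (use 2 f(1,2) k in \<open>simp_all add: h_add h_of pairs_def V.uea_act_add_right\<close>)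
  next
    case (3 m r' n)
    obtain a where a: "a \<in> carrier (free_alg K)" "r' = uea_class K a" using 3 by (auto simp: K.uea_carrier)
    have "f (free_act B a n) = free_act V a (f n)"
      using B.lie_module_axioms V subalgebra_subset f a(1) 3(4) by (rule free_act_hom)
    then have "uea_act V (uea_incl L r') (f n) = f (uea_act B r' n)"
      using a 3 f(1) by (simp add: uea_incl_class B.uea_act_class V.uea_act_class free_subalgebra)
    then have "uea_act V (m \<otimes>\<^bsub>uea L\<^esub> uea_incl L r') (f n) = uea_act V m (f (uea_act B r' n))"
      using 3 f(1) by (simp add: V.uea_act_mult uea_incl_closed)
    then show ?case
      by (intro h_kill[where p = "frag_of (m \<otimes>\<^bsub>uea L\<^esub> uea_incl L r', n)" and q = "frag_of (m, uea_act B r' n)"])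
        (use 3 in \<open>simp_all add: h_of pairs_def uea_incl_closed B.uea_act_closed\<close>)
  qed
  have h_rel: "h r = \<zero>\<^bsub>V\<^esub>" if "r \<in> rel" for r
    using that
  proof (induction r rule: rel_induct)
    case (uminus r)
    then show ?case using h_add[of r "- r"] rel_keys[of r] h_closed[of "- r"] h_0 by simp
  qed (simp_all add: h_relator h_0 h_add rel_keys)
  define F where "F X = the_elem (h ` X)" for X
  have F_cls: "F (cls p) = h p" if "Poly_Mapping.keys p \<subseteq> pairs" for p
  proof -
    have "h q = h p" if "q \<in> cls p" for q
      using that \<open>Poly_Mapping.keys p \<subseteq> pairs\<close> by (auto simp: cls_def h_add rel_keys h_rel h_closed)
    then have "h ` cls p = {h p}" using cls_self[of p] by blast
    then show ?thesis by (simp add: F_def)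
  qed
  have F_closed: "F X \<in> carrier V" if "X \<in> carrier Ind" for X
    using that by (elim Ind_cases) (simp add: F_cls h_closed)
  have F_add: "F (X \<oplus>\<^bsub>Ind\<^esub> Y) = F X \<oplus>\<^bsub>V\<^esub> F Y" if "X \<in> carrier Ind" "Y \<in> carrier Ind" for X Y
    using that by (elim Ind_cases) (simp add: F_cls h_add Ind_add keys_plus_subset)
  have F_tensor: "F (tensor u v) = uea_act V u (f v)" if "u \<in> carrier (uea L)" "v \<in> carrier B" for u v
    using that by (simp add: tensor_eq F_cls h_of pairs_def)
  have F_uact: "F (uact u X) = uea_act V u (F X)" if u: "u \<in> carrier (uea L)" and "X \<in> carrier Ind" for u X
    using that(2)
  proof (induction X rule: Ind_induct)
    case (tensor w v)
    then show ?case using u f(1) by (simp add: uact_tensor F_tensor V.uea_act_mult)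
  next
    case (add X Y)
    then show ?case using u by (simp add: uact_add_right F_add uact_closed V.uea_act_add_right F_closed)
  qed
  show thesis
  proof (rule that[of F])
    show "F (c \<odot>\<^bsub>Ind\<^esub> X) = c \<odot>\<^bsub>V\<^esub> F X" if "X \<in> carrier Ind" for c X
      using that by (simp add: Ind_ops F_uact uea_class_closed free_const_closed V.uea_act_const F_closed)
    show "F (x \<rhd>\<^bsub>Ind\<^esub> X) = x \<rhd>\<^bsub>V\<^esub> F X" if "x \<in> carrier L" "X \<in> carrier Ind" for x X
      using that by (simp add: Ind_ops F_uact uea_class_closed free_gen_closed V.uea_act_gen F_closed)
    show "F (ind_unit K L B v) = f v" if "v \<in> carrier B" for v
      using that f(1)[OF that] F_tensor[OF U.one_closed that] V.uea_act_const[of "f v" 1]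
      by (simp add: ind_unit_eq uea_one)
  qed (use F_closed F_add in auto)
qed

section \<open>Inducing from a subalgebra of codimension one\<close>

lemma (in abelian_group) eq_minusI:
  "b \<in> carrier G \<Longrightarrow> c \<in> carrier G \<Longrightarrow> a = b \<oplus> c \<Longrightarrow> b = a \<ominus> c"
  by (simp add: minus_eq a_assoc r_neg)

lemma (in abelian_group) eq_of_minus_eq_zero:
  assumes "x \<in> carrier G" "y \<in> carrier G" "x \<ominus> y = \<zero>" shows "x = y"
proof -
  have "x = (x \<ominus> y) \<oplus> y" using assms(1,2) by (simp add: minus_eq a_assoc l_neg)
  then show ?thesis using assms by simp
qed

context lie_algebra begin

lemma bracket_swap:
  assumes "x \<in> carrier L" "y \<in> carrier L" shows "bracket L x y \<oplus> bracket L y x = \<zero>"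
proof -
  have "\<zero> = bracket L (x \<oplus> y) (x \<oplus> y)" using assms by (simp add: bracket_self)
  also have "\<dots> = bracket L x y \<oplus> bracket L y x"
    using assms bracket_self[OF assms(1)] bracket_self[OF assms(2)]
    by (simp add: bracket_add_left bracket_add_right bracket_closed M.a_comm)
  finally show ?thesis by simp
qed

lemma bracket_antisym:
  assumes "x \<in> carrier L" "y \<in> carrier L" shows "bracket L y x = \<ominus> bracket L x y"
  using bracket_swap[OF assms(2,1)] assms by (intro M.minus_equality[symmetric]) (simp_all add: bracket_closed)

text \<open>The map \<open>x \<mapsto> [x, d]\<close> is a derivation; this is the form in which the Jacobi identity is used.\<close>

lemma bracket_derivation:
  assumes "x \<in> carrier L" "y \<in> carrier L" "d \<in> carrier L"
  shows "bracket L (bracket L x y) d = bracket L (bracket L x d) y \<oplus> bracket L x (bracket L y d)"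
proof -
  let ?a = "bracket L x (bracket L y d)" and ?b = "bracket L y (bracket L d x)" and ?c = "bracket L d (bracket L x y)"
  have cl: "?a \<in> carrier L" "?b \<in> carrier L" "?c \<in> carrier L" using assms by (simp_all add: bracket_closed)
  have "bracket L (bracket L x y) d = \<ominus> ?c"
    using assms bracket_antisym[of d "bracket L x y"] by (simp add: bracket_closed)
  also have "\<ominus> ?c = ?a \<oplus> ?b"
    using jacobi[OF assms] cl by (intro M.minus_equality) simp_all
  also have "?b = bracket L (bracket L x d) y"
    using assms bracket_smult_right[of y "bracket L x d" "-1"] bracket_antisym[of x d]
      bracket_antisym[of y "bracket L x d"]
    by (simp add: bracket_closed smult_minus_one)
  finally show ?thesis using cl assms by (simp add: M.a_comm bracket_closed)
qed

end

text \<open>The functions \<open>k\<close> and \<open>c\<close> are the coordinates of the decomposition \<open>L = K \<oplus> \<complex> d\<close>. The goal is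
  a module over \<open>L\<close> that contains a copy of \<open>B\<close>: a sequence \<open>u\<close> stands for the formal sum of the
  \<open>d\<^sup>n u\<^sub>n\<close>, and \<open>shift\<close> is left multiplication by \<open>d\<close>.\<close>

locale codim_one_induced = induced_module K L B
  for K :: "'l lie_alg" and L :: "'l lie_alg" (structure) and B :: "('l, 'v) lie_mod" +
  fixes d :: 'l and c :: "'l \<Rightarrow> complex" and k :: "'l \<Rightarrow> 'l"
  assumes d_closed: "d \<in> carrier L"
    and k_closed: "x \<in> carrier L \<Longrightarrow> k x \<in> carrier K"
    and decomp: "x \<in> carrier L \<Longrightarrow> x = k x \<oplus> c x \<odot> d"
    and c_add: "x \<in> carrier L \<Longrightarrow> y \<in> carrier L \<Longrightarrow> c (x \<oplus> y) = c x + c y"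
    and c_smult: "x \<in> carrier L \<Longrightarrow> c (a \<odot> x) = a * c x"
    and c_sub: "x \<in> carrier K \<Longrightarrow> c x = 0"
begin

lemma k_closed': "x \<in> carrier L \<Longrightarrow> k x \<in> carrier L" using k_closed subalgebra_mem by blast

lemma k_unique:
  assumes "x \<in> carrier L" "y \<in> carrier K" "x = y \<oplus> c x \<odot> d" shows "k x = y"
proof -
  have "k x \<oplus> c x \<odot> d = y \<oplus> c x \<odot> d" using decomp[OF assms(1)] assms(3) by metis
  then show ?thesis using assms(1,2) d_closed k_closed' subalgebra_mem by simp
qed

lemma k_sub: "x \<in> carrier K \<Longrightarrow> k x = x"
  by (rule k_unique) (simp_all add: c_sub subalgebra_mem d_closed)

lemma k_add:
  assumes "x \<in> carrier L" "y \<in> carrier L" shows "k (x \<oplus> y) = k x \<oplus> k y"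
proof (rule k_unique)
  show "k x \<oplus> k y \<in> carrier K"
    using K.M.a_closed[OF k_closed[OF assms(1)] k_closed[OF assms(2)]] by (simp add: subalgebra_ops)
  have "x \<oplus> y = (k x \<oplus> c x \<odot> d) \<oplus> (k y \<oplus> c y \<odot> d)"
    using decomp[OF assms(1)] decomp[OF assms(2)] by simp
  also have "\<dots> = k x \<oplus> k y \<oplus> c (x \<oplus> y) \<odot> d"
    using assms d_closed k_closed' by (simp add: c_add smult_l_distr' M.a_ac)
  finally show "x \<oplus> y = k x \<oplus> k y \<oplus> c (x \<oplus> y) \<odot> d" .
qed (use assms in simp)

lemma k_smult:
  assumes "x \<in> carrier L" shows "k (a \<odot> x) = a \<odot> k x"
proof (rule k_unique)
  show "a \<odot> k x \<in> carrier K" using K.smult_closed[of a "k x"] k_closed[OF assms] by (simp add: subalgebra_ops)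
  have "a \<odot> x = a \<odot> (k x \<oplus> c x \<odot> d)" using decomp[OF assms] by simp
  also have "\<dots> = a \<odot> k x \<oplus> c (a \<odot> x) \<odot> d"
    using assms d_closed k_closed'[OF assms] smult_r_distr[of a "k x" "c x \<odot> d"]
    by (simp add: c_smult smult_assoc1')
  finally show "a \<odot> x = a \<odot> k x \<oplus> c (a \<odot> x) \<odot> d" .
qed (use assms in simp)

text \<open>Comparing coordinates on both sides gives the two identities for \<open>c\<close> and \<open>k\<close> below.\<close>

lemma bracket_decomp:
  assumes x: "x \<in> carrier L" and y: "y \<in> carrier L"
  shows "bracket L x y \<oplus> c x \<odot> bracket L y d = bracket L (k x) (k y) \<oplus> c y \<odot> bracket L x d"
proof -
  note cl = k_closed'[OF x] k_closed'[OF y] d_closed x y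
  have xd: "bracket L z d = bracket L (k z) d" if z: "z \<in> carrier L" for z
  proof -
    have "bracket L z d = bracket L (k z \<oplus> c z \<odot> d) d" using decomp[OF z] by simp
    then show ?thesis using k_closed'[OF z] d_closed
      by (simp add: bracket_add_left bracket_smult_left bracket_self bracket_closed)
  qed
  have "bracket L x y = bracket L (k x \<oplus> c x \<odot> d) (k y \<oplus> c y \<odot> d)"
    using decomp[OF x] decomp[OF y] by simp
  also have "\<dots> = bracket L (k x) (k y) \<oplus> c y \<odot> bracket L (k x) d \<oplus> c x \<odot> bracket L d (k y)"
    using cl by (simp add: bracket_add_left bracket_add_right bracket_smult_left bracket_smult_right
        bracket_self bracket_closed M.a_ac)
  finally have "bracket L x y \<oplus> c x \<odot> bracket L y d =
      bracket L (k x) (k y) \<oplus> c y \<odot> bracket L (k x) d \<oplus> c x \<odot> (bracket L d (k y) \<oplus> bracket L (k y) d)"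
    using cl smult_r_distr[of "c x" "bracket L d (k y)" "bracket L (k y) d"]
    by (simp add: xd[OF y] bracket_closed M.a_assoc)
  then show ?thesis using cl by (simp add: bracket_swap xd[OF x] bracket_closed)
qed

lemma c_bracket:
  assumes "x \<in> carrier L" "y \<in> carrier L"
  shows "c (bracket L x y) + c x * c (bracket L y d) = c y * c (bracket L x d)"
  using arg_cong[OF bracket_decomp[OF assms], of c] assms d_closed k_closed' k_closed
    c_sub[of "bracket L (k x) (k y)"] K.bracket_closed[of "k x" "k y"]
  by (simp add: c_add c_smult bracket_closed subalgebra_ops)

lemma k_bracket:
  assumes "x \<in> carrier L" "y \<in> carrier L"
  shows "k (bracket L x y) \<oplus> c x \<odot> k (bracket L y d) = bracket L (k x) (k y) \<oplus> c y \<odot> k (bracket L x d)"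
  using arg_cong[OF bracket_decomp[OF assms], of k] assms d_closed k_closed' k_closed
    k_sub[of "bracket L (k x) (k y)"] K.bracket_closed[of "k x" "k y"]
  by (simp add: k_add k_smult bracket_closed subalgebra_ops)

definition vanishes_from :: "nat \<Rightarrow> (nat \<Rightarrow> 'v) \<Rightarrow> bool" where
  "vanishes_from n u \<longleftrightarrow> (\<forall>m\<ge>n. u m = \<zero>\<^bsub>B\<^esub>)"

definition seq_carrier :: "(nat \<Rightarrow> 'v) set" where
  "seq_carrier = {u. (\<forall>n. u n \<in> carrier B) \<and> (\<exists>n. vanishes_from n u)}"

definition seq_add :: "(nat \<Rightarrow> 'v) \<Rightarrow> (nat \<Rightarrow> 'v) \<Rightarrow> nat \<Rightarrow> 'v" (infixl "\<boxplus>" 65) where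
  "u \<boxplus> w = (\<lambda>n. u n \<oplus>\<^bsub>B\<^esub> w n)"

definition seq_smult :: "complex \<Rightarrow> (nat \<Rightarrow> 'v) \<Rightarrow> nat \<Rightarrow> 'v" where
  "seq_smult a u = (\<lambda>n. a \<odot>\<^bsub>B\<^esub> u n)"

definition const_seq :: "'v \<Rightarrow> nat \<Rightarrow> 'v" where
  "const_seq v = (\<lambda>n. if n = 0 then v else \<zero>\<^bsub>B\<^esub>)"

definition shift :: "(nat \<Rightarrow> 'v) \<Rightarrow> nat \<Rightarrow> 'v" where
  "shift u = (\<lambda>n. case n of 0 \<Rightarrow> \<zero>\<^bsub>B\<^esub> | Suc m \<Rightarrow> u m)"

definition tail :: "(nat \<Rightarrow> 'v) \<Rightarrow> nat \<Rightarrow> 'v" where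
  "tail u = (\<lambda>n. u (Suc n))"

text \<open>The action is forced by \<open>x \<cdot> v = k(x) v + c(x) d v\<close> for \<open>v\<close> in \<open>B\<close> and
  \<open>x \<cdot> d u = d (x \<cdot> u) + [x, d] \<cdot> u\<close>. As \<open>u = u\<^sub>0 + d (tail u)\<close>, this is a recursion, which ends after
  \<open>n\<close> steps on a sequence that vanishes from \<open>n\<close> on.\<close>

primrec seq_act_bounded :: "nat \<Rightarrow> 'l \<Rightarrow> (nat \<Rightarrow> 'v) \<Rightarrow> nat \<Rightarrow> 'v" where
  "seq_act_bounded 0 x u = (\<lambda>_. \<zero>\<^bsub>B\<^esub>)"
| "seq_act_bounded (Suc n) x u =
    const_seq (k x \<rhd>\<^bsub>B\<^esub> u 0) \<boxplus> shift (const_seq (c x \<odot>\<^bsub>B\<^esub> u 0)) \<boxplus>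
    shift (seq_act_bounded n x (tail u)) \<boxplus> seq_act_bounded n (bracket L x d) (tail u)"

definition seq_act :: "'l \<Rightarrow> (nat \<Rightarrow> 'v) \<Rightarrow> nat \<Rightarrow> 'v" where
  "seq_act x u = seq_act_bounded (LEAST n. vanishes_from n u) x u"

definition Seq :: "('l, nat \<Rightarrow> 'v) lie_mod" where
  "Seq = \<lparr>carrier = seq_carrier, monoid.mult = undefined, one = undefined,
     ring.zero = (\<lambda>_. \<zero>\<^bsub>B\<^esub>), add = (\<boxplus>), smult = seq_smult, act = seq_act\<rparr>"

lemma Seq_simps [simp]:
  "carrier Seq = seq_carrier" "u \<oplus>\<^bsub>Seq\<^esub> w = u \<boxplus> w" "\<zero>\<^bsub>Seq\<^esub> = (\<lambda>_. \<zero>\<^bsub>B\<^esub>)"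
  "a \<odot>\<^bsub>Seq\<^esub> u = seq_smult a u" "x \<rhd>\<^bsub>Seq\<^esub> u = seq_act x u"
  by (simp_all add: Seq_def)

lemma seq_closed: "u \<in> seq_carrier \<Longrightarrow> u n \<in> carrier B"
  by (simp add: seq_carrier_def)

lemma vanishes_mono: "vanishes_from n u \<Longrightarrow> n \<le> m \<Longrightarrow> vanishes_from m u"
  by (auto simp: vanishes_from_def)

lemma seq_add_closed:
  assumes "u \<in> seq_carrier" "w \<in> seq_carrier" shows "u \<boxplus> w \<in> seq_carrier"
proof -
  obtain m n where "vanishes_from m u" "vanishes_from n w" using assms by (auto simp: seq_carrier_def)
  then have "vanishes_from (max m n) (u \<boxplus> w)" by (simp add: vanishes_from_def seq_add_def)
  then show ?thesis using assms by (auto simp: seq_carrier_def seq_add_def)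
qed

lemma seq_smult_closed: "u \<in> seq_carrier \<Longrightarrow> seq_smult a u \<in> seq_carrier"
proof -
  assume u: "u \<in> seq_carrier"
  then obtain n where "vanishes_from n u" by (auto simp: seq_carrier_def)
  then have "vanishes_from n (seq_smult a u)" by (simp add: vanishes_from_def seq_smult_def)
  then show ?thesis using u by (auto simp: seq_carrier_def seq_smult_def)
qed

lemma seq_zero_closed: "(\<lambda>_. \<zero>\<^bsub>B\<^esub>) \<in> seq_carrier"
  by (simp add: seq_carrier_def vanishes_from_def)

lemma const_seq_closed: "v \<in> carrier B \<Longrightarrow> const_seq v \<in> seq_carrier"
  by (auto simp: seq_carrier_def vanishes_from_def const_seq_def intro!: exI[of _ 1])

lemma shift_vanishes: "vanishes_from n u \<Longrightarrow> vanishes_from (Suc n) (shift u)"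
  by (auto simp: vanishes_from_def shift_def split: nat.split)

lemma shift_closed: "u \<in> seq_carrier \<Longrightarrow> shift u \<in> seq_carrier"
  using shift_vanishes by (fastforce simp: seq_carrier_def shift_def split: nat.split)

lemma tail_vanishes: "vanishes_from (Suc n) u \<Longrightarrow> vanishes_from n (tail u)"
  by (simp add: vanishes_from_def tail_def)

lemma tail_closed: "u \<in> seq_carrier \<Longrightarrow> tail u \<in> seq_carrier"
  using tail_vanishes vanishes_mono[OF _ le_SucI] by (fastforce simp: seq_carrier_def tail_def)

lemma module_Seq: "Module.module complex_ring Seq"
proof (rule Module.moduleI[OF cring_complex])
  show "abelian_group Seq"
  proof (rule abelian_groupI, goal_cases)
    case (6 u)
    then show ?case using seq_smult_closed[of u "-1"]
      by (intro bexI[of _ "seq_smult (- 1) u"])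
        (simp_all add: fun_eq_iff seq_add_def seq_smult_def seq_closed B.smult_minus_oneV B.V.M.l_neg)
  qed (simp_all add: seq_add_closed seq_zero_closed, simp_all add: fun_eq_iff seq_add_def seq_closed B.V.M.a_ac)
qed (simp_all add: seq_smult_closed, simp_all add: fun_eq_iff seq_add_def seq_smult_def seq_closed
    B.smult_l_distrV B.smult_assoc1V B.V.smult_r_distr)

interpretation S: Module.module complex_ring Seq by (rule module_Seq)

lemmas seq_ac = S.M.a_ac[simplified]

lemma const_seq_add: "const_seq (v \<oplus>\<^bsub>B\<^esub> w) = const_seq v \<boxplus> const_seq w"
  by (simp add: fun_eq_iff const_seq_def seq_add_def)

lemma const_seq_smult: "const_seq (a \<odot>\<^bsub>B\<^esub> v) = seq_smult a (const_seq v)"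
  by (simp add: fun_eq_iff const_seq_def seq_smult_def)

lemma shift_add: "shift (u \<boxplus> w) = shift u \<boxplus> shift w"
  by (simp add: fun_eq_iff shift_def seq_add_def split: nat.split)

lemma shift_smult: "shift (seq_smult a u) = seq_smult a (shift u)"
  by (simp add: fun_eq_iff shift_def seq_smult_def split: nat.split)

lemma shift_zero: "shift (\<lambda>_. \<zero>\<^bsub>B\<^esub>) = (\<lambda>_. \<zero>\<^bsub>B\<^esub>)"
  by (simp add: fun_eq_iff shift_def split: nat.split)

lemma const_seq_zero: "const_seq \<zero>\<^bsub>B\<^esub> = (\<lambda>_. \<zero>\<^bsub>B\<^esub>)"
  by (simp add: fun_eq_iff const_seq_def)

lemma tail_add: "tail (u \<boxplus> w) = (tail u) \<boxplus> (tail w)"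
  by (simp add: fun_eq_iff seq_add_def tail_def)

lemma tail_smult: "tail (seq_smult a u) = seq_smult a (tail u)"
  by (simp add: fun_eq_iff seq_smult_def tail_def)

lemma tail_shift: "tail (shift u) = u" by (simp add: fun_eq_iff shift_def tail_def)

lemma seq_smult_add:
  "u \<in> seq_carrier \<Longrightarrow> w \<in> seq_carrier \<Longrightarrow> seq_smult a (u \<boxplus> w) = seq_smult a u \<boxplus> seq_smult a w"
  using S.smult_r_distr[of a u w] by simp

lemmas seq_cl = seq_add_closed seq_smult_closed const_seq_closed shift_closed tail_closed seq_closed
  seq_zero_closed bracket_closed d_closed k_closed B.act_closed B.smult_closedV

lemma seq_act_bounded_closed:
  "x \<in> carrier L \<Longrightarrow> u \<in> seq_carrier \<Longrightarrow> seq_act_bounded n x u \<in> seq_carrier"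
  by (induction n arbitrary: x u) (simp_all add: seq_cl)

lemma seq_act_bounded_add_right:
  "x \<in> carrier L \<Longrightarrow> u \<in> seq_carrier \<Longrightarrow> w \<in> seq_carrier \<Longrightarrow>
    seq_act_bounded n x (u \<boxplus> w) = seq_act_bounded n x u \<boxplus> seq_act_bounded n x w"
proof (induction n arbitrary: x u w)
  case 0
  then show ?case by (simp add: seq_add_def)
next
  case (Suc n)
  have "(u \<boxplus> w) 0 = u 0 \<oplus>\<^bsub>B\<^esub> w 0" by (simp add: seq_add_def)
  then show ?case using Suc
    by (simp add: tail_add seq_cl seq_act_bounded_closed B.act_add_right B.V.smult_r_distr
        const_seq_add shift_add seq_ac)
qed

lemma seq_act_bounded_smult_right:
  "x \<in> carrier L \<Longrightarrow> u \<in> seq_carrier \<Longrightarrow>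
    seq_act_bounded n x (seq_smult a u) = seq_smult a (seq_act_bounded n x u)"
proof (induction n arbitrary: x u)
  case 0
  then show ?case by (simp add: seq_smult_def)
next
  case (Suc n)
  have "seq_smult a u 0 = a \<odot>\<^bsub>B\<^esub> u 0" by (simp add: seq_smult_def)
  moreover have "c x \<odot>\<^bsub>B\<^esub> (a \<odot>\<^bsub>B\<^esub> u 0) = a \<odot>\<^bsub>B\<^esub> (c x \<odot>\<^bsub>B\<^esub> u 0)"
    using Suc.prems by (simp add: seq_closed mult.commute flip: B.smult_assoc1V)
  ultimately show ?case using Suc
    by (simp add: tail_smult seq_cl seq_act_bounded_closed B.act_smult_right
        const_seq_smult shift_smult seq_smult_add)
qed

lemma seq_act_bounded_add_left:
  "x \<in> carrier L \<Longrightarrow> y \<in> carrier L \<Longrightarrow> u \<in> seq_carrier \<Longrightarrow>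
    seq_act_bounded n (x \<oplus> y) u = seq_act_bounded n x u \<boxplus> seq_act_bounded n y u"
proof (induction n arbitrary: x y u)
  case 0
  then show ?case by (simp add: seq_add_def)
next
  case (Suc n)
  have "(k x \<oplus> k y) \<rhd>\<^bsub>B\<^esub> u 0 = k x \<rhd>\<^bsub>B\<^esub> u 0 \<oplus>\<^bsub>B\<^esub> k y \<rhd>\<^bsub>B\<^esub> u 0"
    using Suc.prems B.act_add_left[of "k x" "k y" "u 0"] by (simp add: seq_cl subalgebra_ops)
  then show ?case using Suc
    by (simp add: seq_cl seq_act_bounded_closed k_add c_add B.smult_l_distrV bracket_add_left
        const_seq_add shift_add seq_ac)
qed

lemma seq_act_bounded_smult_left:
  "x \<in> carrier L \<Longrightarrow> u \<in> seq_carrier \<Longrightarrow>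
    seq_act_bounded n (a \<odot> x) u = seq_smult a (seq_act_bounded n x u)"
proof (induction n arbitrary: x u)
  case 0
  then show ?case by (simp add: seq_smult_def)
next
  case (Suc n)
  have "(a \<odot> k x) \<rhd>\<^bsub>B\<^esub> u 0 = a \<odot>\<^bsub>B\<^esub> (k x \<rhd>\<^bsub>B\<^esub> u 0)"
    using Suc.prems B.act_smult_left[of "k x" "u 0" a] by (simp add: seq_cl subalgebra_ops)
  then show ?case using Suc
    by (simp add: seq_cl seq_act_bounded_closed k_smult c_smult B.smult_assoc1V bracket_smult_left
        const_seq_smult shift_smult seq_smult_add)
qed

text \<open>Beyond the support the recursion adds nothing, so any bound on the support gives the same action.\<close>

lemma seq_act_bounded_vanishing:
  "x \<in> carrier L \<Longrightarrow> u \<in> seq_carrier \<Longrightarrow> vanishes_from n u \<Longrightarrow>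
    seq_act_bounded (Suc n) x u = seq_act_bounded n x u"
proof (induction n arbitrary: x u)
  case 0
  then show ?case
    by (simp add: vanishes_from_def k_closed const_seq_zero shift_zero) (simp add: seq_add_def)
next
  case (Suc n)
  then have "seq_act_bounded (Suc n) x (tail u) = seq_act_bounded n x (tail u)"
    "seq_act_bounded (Suc n) (bracket L x d) (tail u) = seq_act_bounded n (bracket L x d) (tail u)"
    by (auto intro!: Suc.IH simp: seq_cl tail_vanishes simp del: seq_act_bounded.simps)
  then show ?case by (simp only: seq_act_bounded.simps)
qed

lemma seq_act_eq:
  assumes "x \<in> carrier L" "u \<in> seq_carrier" "vanishes_from n u"
  shows "seq_act x u = seq_act_bounded n x u"
proof -
  let ?l = "LEAST n. vanishes_from n u"
  have l: "vanishes_from ?l u" "?l \<le> n" using assms(3) by (auto intro: LeastI Least_le)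
  have "seq_act_bounded m x u = seq_act_bounded ?l x u" if "m \<ge> ?l" for m
    using that
  proof (induction m rule: dec_induct)
    case (step m)
    then show ?case using seq_act_bounded_vanishing[OF assms(1,2) vanishes_mono[OF l(1)], of m] by simp
  qed simp
  from this[OF l(2)] show ?thesis by (simp add: seq_act_def)
qed

lemma seq_bound2:
  assumes "u \<in> seq_carrier" "w \<in> seq_carrier"
  obtains n where "vanishes_from n u" "vanishes_from n w" "vanishes_from n (u \<boxplus> w)"
proof -
  obtain m n where "vanishes_from m u" "vanishes_from n w" using assms by (auto simp: seq_carrier_def)
  then have "vanishes_from (max m n) u" "vanishes_from (max m n) w" by (auto intro: vanishes_mono)
  then show thesis by (intro that[of "max m n"]) (auto simp: vanishes_from_def seq_add_def)
qed

lemma seq_bound: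
  assumes "u \<in> seq_carrier" obtains n where "vanishes_from n u" "vanishes_from n (seq_smult a u)"
  using assms by (auto simp: seq_carrier_def vanishes_from_def seq_smult_def)

lemma seq_act_closed: "x \<in> carrier L \<Longrightarrow> u \<in> seq_carrier \<Longrightarrow> seq_act x u \<in> seq_carrier"
  by (simp add: seq_act_def seq_act_bounded_closed)

lemma seq_act_add_left:
  "x \<in> carrier L \<Longrightarrow> y \<in> carrier L \<Longrightarrow> u \<in> seq_carrier \<Longrightarrow> seq_act (x \<oplus> y) u = seq_act x u \<boxplus> seq_act y u"
  by (simp add: seq_act_def seq_act_bounded_add_left)

lemma seq_act_smult_left:
  "x \<in> carrier L \<Longrightarrow> u \<in> seq_carrier \<Longrightarrow> seq_act (a \<odot> x) u = seq_smult a (seq_act x u)"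
  by (simp add: seq_act_def seq_act_bounded_smult_left)

lemma seq_act_add_right:
  assumes "x \<in> carrier L" "u \<in> seq_carrier" "w \<in> seq_carrier"
  shows "seq_act x (u \<boxplus> w) = seq_act x u \<boxplus> seq_act x w"
proof -
  obtain n where "vanishes_from n u" "vanishes_from n w" "vanishes_from n (u \<boxplus> w)"
    using seq_bound2[OF assms(2,3)] .
  then show ?thesis using assms
    by (simp add: seq_act_eq[where n = n] seq_add_closed seq_act_bounded_add_right)
qed

lemma seq_act_smult_right:
  assumes "x \<in> carrier L" "u \<in> seq_carrier"
  shows "seq_act x (seq_smult a u) = seq_smult a (seq_act x u)"
proof -
  obtain n where "vanishes_from n u" "vanishes_from n (seq_smult a u)" using seq_bound[OF assms(2)] .
  then show ?thesis using assms
    by (simp add: seq_act_eq[where n = n] seq_smult_closed seq_act_bounded_smult_right)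
qed

lemma seq_add_zero: "u \<in> seq_carrier \<Longrightarrow> u \<boxplus> (\<lambda>_. \<zero>\<^bsub>B\<^esub>) = u" "u \<in> seq_carrier \<Longrightarrow> (\<lambda>_. \<zero>\<^bsub>B\<^esub>) \<boxplus> u = u"
  using S.M.r_zero[of u] S.M.l_zero[of u] by simp_all

lemma seq_act_const:
  assumes "x \<in> carrier L" "v \<in> carrier B"
  shows "seq_act x (const_seq v) = const_seq (k x \<rhd>\<^bsub>B\<^esub> v) \<boxplus> shift (const_seq (c x \<odot>\<^bsub>B\<^esub> v))"
proof -
  have "vanishes_from (Suc 0) (const_seq v)" by (simp add: vanishes_from_def const_seq_def)
  then have "seq_act x (const_seq v) = seq_act_bounded (Suc 0) x (const_seq v)"
    using assms by (intro seq_act_eq) (simp_all add: seq_cl)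
  moreover have "const_seq v 0 = v" by (simp add: const_seq_def)
  ultimately show ?thesis using assms by (simp add: shift_zero seq_add_zero seq_cl)
qed

lemma seq_act_shift:
  assumes "x \<in> carrier L" "u \<in> seq_carrier"
  shows "seq_act x (shift u) = shift (seq_act x u) \<boxplus> seq_act (bracket L x d) u"
proof -
  obtain n where n: "vanishes_from n u" using assms by (auto simp: seq_carrier_def)
  have "seq_act x (shift u) = seq_act_bounded (Suc n) x (shift u)"
    using assms shift_vanishes[OF n] by (intro seq_act_eq) (simp_all add: seq_cl)
  moreover have "shift u 0 = \<zero>\<^bsub>B\<^esub>" by (simp add: shift_def)
  ultimately show ?thesis using assms n
    by (simp add: tail_shift const_seq_zero shift_zero k_closed seq_add_zero seq_cl
        seq_act_bounded_closed seq_act_eq[where n = n])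
qed

lemma seq_induct [consumes 1, case_names const shift add]:
  assumes "u \<in> seq_carrier"
    and const: "\<And>v. v \<in> carrier B \<Longrightarrow> P (const_seq v)"
    and shift: "\<And>u. u \<in> seq_carrier \<Longrightarrow> P u \<Longrightarrow> P (shift u)"
    and add: "\<And>u w. u \<in> seq_carrier \<Longrightarrow> w \<in> seq_carrier \<Longrightarrow> P u \<Longrightarrow> P w \<Longrightarrow> P (u \<boxplus> w)"
  shows "P u"
proof -
  obtain n where "vanishes_from n u" using assms(1) by (auto simp: seq_carrier_def)
  then show ?thesis using assms(1)
  proof (induction n arbitrary: u)
    case 0
    then have "u = const_seq \<zero>\<^bsub>B\<^esub>" by (auto simp: vanishes_from_def const_seq_def fun_eq_iff)
    then show ?case using const by simp
  next
    case (Suc n)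
    have "u = const_seq (u 0) \<boxplus> shift (tail u)"
      using Suc.prems by (auto simp: fun_eq_iff const_seq_def shift_def seq_add_def tail_def seq_closed split: nat.split)
    moreover have "P (const_seq (u 0) \<boxplus> shift (tail u))"
      using Suc.prems Suc.IH[of "tail u"]
      by (intro add const shift) (simp_all add: seq_cl tail_vanishes)
    ultimately show ?case by simp
  qed
qed

text \<open>For constants the identity combines the axiom for the module \<open>B\<close> with the coordinates of \<open>[x, y]\<close>.
  The derivation property of \<open>x \<mapsto> [x, d]\<close> carries it from \<open>u\<close> to \<open>d u\<close>.\<close>

lemma seq_act_bracket:
  assumes "u \<in> seq_carrier" "x \<in> carrier L" "y \<in> carrier L"
  shows "seq_act x (seq_act y u) = seq_act (bracket L x y) u \<boxplus> seq_act y (seq_act x u)"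
  using assms
proof (induction u arbitrary: x y rule: seq_induct)
  case (const v)
  note cl = seq_cl seq_act_closed
  have expand: "seq_act x (seq_act y (const_seq v)) =
      const_seq (k x \<rhd>\<^bsub>B\<^esub> k y \<rhd>\<^bsub>B\<^esub> v \<oplus>\<^bsub>B\<^esub> (c y \<odot>\<^bsub>L\<^esub> k (bracket L x d)) \<rhd>\<^bsub>B\<^esub> v) \<boxplus>
      (shift (const_seq (c x \<odot>\<^bsub>B\<^esub> (k y \<rhd>\<^bsub>B\<^esub> v))) \<boxplus> shift (const_seq (c y \<odot>\<^bsub>B\<^esub> (k x \<rhd>\<^bsub>B\<^esub> v)))) \<boxplus>
      shift (const_seq ((c y * c (bracket L x d)) \<odot>\<^bsub>B\<^esub> v)) \<boxplus>
      shift (shift (const_seq ((c x * c y) \<odot>\<^bsub>B\<^esub> v)))"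
    if xy: "x \<in> carrier L" "y \<in> carrier L" for x y
    using xy const B.act_smult_left[of "k (bracket L x d)" v "c y"]
    by (simp add: seq_act_const seq_act_add_right seq_act_shift cl B.act_smult_right shift_add
        const_seq_add subalgebra_ops seq_ac mult.commute flip: B.smult_assoc1V)
  have K: "k x \<rhd>\<^bsub>B\<^esub> k y \<rhd>\<^bsub>B\<^esub> v \<oplus>\<^bsub>B\<^esub> (c y \<odot>\<^bsub>L\<^esub> k (bracket L x d)) \<rhd>\<^bsub>B\<^esub> v =
      k (bracket L x y) \<rhd>\<^bsub>B\<^esub> v \<oplus>\<^bsub>B\<^esub> (k y \<rhd>\<^bsub>B\<^esub> k x \<rhd>\<^bsub>B\<^esub> v \<oplus>\<^bsub>B\<^esub> (c x \<odot>\<^bsub>L\<^esub> k (bracket L y d)) \<rhd>\<^bsub>B\<^esub> v)"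
  proof -
    have ck: "a \<odot>\<^bsub>L\<^esub> k z \<in> carrier K" if "z \<in> carrier L" for a z
      using K.smult_closed[of a "k z"] k_closed[OF that] by (simp add: subalgebra_ops)
    have bK: "bracket L (k x) (k y) \<in> carrier K"
      using K.bracket_closed[of "k x" "k y"] const k_closed by (simp add: subalgebra_ops)
    have "k x \<rhd>\<^bsub>B\<^esub> k y \<rhd>\<^bsub>B\<^esub> v = bracket L (k x) (k y) \<rhd>\<^bsub>B\<^esub> v \<oplus>\<^bsub>B\<^esub> k y \<rhd>\<^bsub>B\<^esub> k x \<rhd>\<^bsub>B\<^esub> v"
      using B.act_bracket[of "k x" "k y" v] const
      by (simp add: subalgebra_ops cl B.V.M.minus_eq B.V.M.a_assoc B.V.M.l_neg)
    moreover have "bracket L (k x) (k y) \<rhd>\<^bsub>B\<^esub> v \<oplus>\<^bsub>B\<^esub> (c y \<odot>\<^bsub>L\<^esub> k (bracket L x d)) \<rhd>\<^bsub>B\<^esub> v =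
        k (bracket L x y) \<rhd>\<^bsub>B\<^esub> v \<oplus>\<^bsub>B\<^esub> (c x \<odot>\<^bsub>L\<^esub> k (bracket L y d)) \<rhd>\<^bsub>B\<^esub> v"
      using arg_cong[OF k_bracket[OF const(2,3)], of "\<lambda>z. z \<rhd>\<^bsub>B\<^esub> v"] const
        B.act_add_left[of "k (bracket L x y)" "c x \<odot>\<^bsub>L\<^esub> k (bracket L y d)" v]
        B.act_add_left[of "bracket L (k x) (k y)" "c y \<odot>\<^bsub>L\<^esub> k (bracket L x d)" v]
      by (simp add: subalgebra_ops cl ck bK)
    ultimately show ?thesis using const
      by (simp add: cl ck bK B.V.M.a_ac)
  qed
  have C: "(c y * c (bracket L x d)) \<odot>\<^bsub>B\<^esub> v = c (bracket L x y) \<odot>\<^bsub>B\<^esub> v \<oplus>\<^bsub>B\<^esub> (c x * c (bracket L y d)) \<odot>\<^bsub>B\<^esub> v"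
    unfolding c_bracket[OF const(2,3), symmetric] by (rule B.smult_l_distrV[OF const(1)])
  have ck: "a \<odot>\<^bsub>L\<^esub> k z \<in> carrier K" if "z \<in> carrier L" for a z
    using K.smult_closed[of a "k z"] k_closed[OF that] by (simp add: subalgebra_ops)
  have xy: "bracket L x y \<in> carrier L" using const by (simp add: bracket_closed)
  have ac: "(p \<boxplus> q) \<boxplus> (s \<boxplus> s') \<boxplus> (e \<boxplus> f) \<boxplus> t = (p \<boxplus> e) \<boxplus> (q \<boxplus> (s' \<boxplus> s) \<boxplus> f \<boxplus> t)"
    if "p \<in> seq_carrier" "q \<in> seq_carrier" "s \<in> seq_carrier" "s' \<in> seq_carrier" "e \<in> seq_carrier"
      "f \<in> seq_carrier" "t \<in> seq_carrier" for p q s s' e f t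
    using that by (simp add: seq_ac seq_add_closed)
  have "seq_act x (seq_act y (const_seq v)) =
      (const_seq (k (bracket L x y) \<rhd>\<^bsub>B\<^esub> v) \<boxplus>
       const_seq (k y \<rhd>\<^bsub>B\<^esub> k x \<rhd>\<^bsub>B\<^esub> v \<oplus>\<^bsub>B\<^esub> (c x \<odot>\<^bsub>L\<^esub> k (bracket L y d)) \<rhd>\<^bsub>B\<^esub> v)) \<boxplus>
      (shift (const_seq (c x \<odot>\<^bsub>B\<^esub> (k y \<rhd>\<^bsub>B\<^esub> v))) \<boxplus> shift (const_seq (c y \<odot>\<^bsub>B\<^esub> (k x \<rhd>\<^bsub>B\<^esub> v)))) \<boxplus>
      (shift (const_seq (c (bracket L x y) \<odot>\<^bsub>B\<^esub> v)) \<boxplus>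
       shift (const_seq ((c x * c (bracket L y d)) \<odot>\<^bsub>B\<^esub> v))) \<boxplus>
      shift (shift (const_seq ((c x * c y) \<odot>\<^bsub>B\<^esub> v)))"
    by (simp only: expand[OF const(2,3)] K C const_seq_add shift_add)
  also have "\<dots> = seq_act (bracket L x y) (const_seq v) \<boxplus> seq_act y (seq_act x (const_seq v))"
    unfolding expand[OF const(3,2)] seq_act_const[OF xy const(1)] mult.commute[of "c y" "c x"]
    by (rule ac) (use const xy in \<open>simp_all add: cl ck\<close>)
  finally show ?case .
next
  case (shift u)
  note cl = seq_cl seq_act_closed
  have b: "seq_act (bracket L (bracket L x y) d) u =
      seq_act (bracket L (bracket L x d) y) u \<boxplus> seq_act (bracket L x (bracket L y d)) u"
    unfolding bracket_derivation[OF shift.prems d_closed]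
    by (rule seq_act_add_left) (use shift(1,3,4) in \<open>simp_all add: cl\<close>)
  have 1: "seq_act x (seq_act y u) = seq_act (bracket L x y) u \<boxplus> seq_act y (seq_act x u)"
    by (rule shift.IH[OF shift.prems])
  have 2: "seq_act (bracket L x d) (seq_act y u) =
      seq_act (bracket L (bracket L x d) y) u \<boxplus> seq_act y (seq_act (bracket L x d) u)"
    by (rule shift.IH) (simp_all add: cl shift.prems)
  have 3: "seq_act x (seq_act (bracket L y d) u) =
      seq_act (bracket L x (bracket L y d)) u \<boxplus> seq_act (bracket L y d) (seq_act x u)"
    by (rule shift.IH) (simp_all add: cl shift.prems)
  have "seq_act x (seq_act y (shift u)) =
      shift (seq_act x (seq_act y u)) \<boxplus> seq_act (bracket L x d) (seq_act y u) \<boxplus> seq_act x (seq_act (bracket L y d) u)"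
    using shift(1,3,4) by (simp add: seq_act_shift seq_act_add_right cl)
  also have "\<dots> = (shift (seq_act (bracket L x y) u) \<boxplus> seq_act (bracket L (bracket L x y) d) u) \<boxplus>
      (shift (seq_act y (seq_act x u)) \<boxplus> seq_act (bracket L y d) (seq_act x u) \<boxplus> seq_act y (seq_act (bracket L x d) u))"
    unfolding 1 2 3 b using shift(1,3,4) by (simp add: shift_add cl seq_ac)
  also have "\<dots> = seq_act (bracket L x y) (shift u) \<boxplus> seq_act y (seq_act x (shift u))"
    using shift(1,3,4) by (simp add: seq_act_shift seq_act_add_right cl)
  finally show ?case .
next
  case (add u w)
  have "seq_act x (seq_act y (u \<boxplus> w)) = seq_act x (seq_act y u) \<boxplus> seq_act x (seq_act y w)"
    using add(1,2,5,6) by (simp add: seq_act_add_right seq_act_closed)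
  also have "\<dots> = seq_act (bracket L x y) (u \<boxplus> w) \<boxplus> seq_act y (seq_act x (u \<boxplus> w))"
    unfolding add(3)[OF add(5,6)] add(4)[OF add(5,6)]
    using add(1,2,5,6) by (simp add: seq_act_add_right seq_act_closed bracket_closed seq_cl seq_ac)
  finally show ?case .
qed

lemma lie_module_Seq: "lie_module L Seq"
proof (intro lie_module.intro lie_algebra_axioms module_Seq lie_module_axioms.intro, goal_cases)
  case (6 x y u)
  then have "seq_act x (seq_act y u) = seq_act (bracket L x y) u \<oplus>\<^bsub>Seq\<^esub> seq_act y (seq_act x u)"
    using seq_act_bracket[of u x y] by simp
  then show ?case
    using 6 S.M.eq_minusI[of "seq_act (bracket L x y) u" "seq_act y (seq_act x u)"]
    by (simp add: seq_act_closed bracket_closed del: Seq_simps(2))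
qed (simp_all add: seq_act_closed seq_act_add_left seq_act_add_right seq_act_smult_left seq_act_smult_right)

text \<open>The inclusion of \<open>B\<close> into the module of sequences extends to the induced module, and the extension
  recovers \<open>v\<close> from \<open>1 \<otimes> v\<close>.\<close>

lemma ind_unit_inj: "inj_on (ind_unit K L B) (carrier B)"
proof -
  have hom: "const_seq (x \<rhd>\<^bsub>B\<^esub> v) = x \<rhd>\<^bsub>Seq\<^esub> const_seq v" if "x \<in> carrier K" "v \<in> carrier B" for x v
    using that by (simp add: seq_act_const subalgebra_mem k_sub c_sub const_seq_zero shift_zero
        seq_add_zero seq_cl)
  obtain F where F: "\<And>v. v \<in> carrier B \<Longrightarrow> F (ind_unit K L B v) = const_seq v"
  proof (rule Ind_universal[OF lie_module_Seq, of const_seq])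
    fix x v assume "x \<in> carrier K" "v \<in> carrier B"
    then show "const_seq (x \<rhd>\<^bsub>B\<^esub> v) = x \<rhd>\<^bsub>Seq\<^esub> const_seq v" by (rule hom)
  next
    fix F assume "\<And>v. v \<in> carrier B \<Longrightarrow> F (ind_unit K L B v) = const_seq v"
    then show thesis by (rule that)
  qed (simp_all add: const_seq_closed const_seq_add const_seq_smult)
  show ?thesis
  proof (rule inj_onI)
    fix v w assume vw: "v \<in> carrier B" "w \<in> carrier B" "ind_unit K L B v = ind_unit K L B w"
    then have "const_seq v = const_seq w" using F by metis
    from fun_cong[OF this, of 0] show "v = w" by (simp add: const_seq_def)
  qed
qed

end

section \<open>The derivation algebra and its subalgebra\<close>

lemma witt_d_closed [simp]: "witt_d i \<in> carrier witt"
  unfolding witt_carrier_iff witt_d_def by blast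

lemma witt_d_V: "i \<ge> int n \<Longrightarrow> witt_d i \<in> witt_V n"
  unfolding witt_V_def lin_span_def by (rule hull_inc) blast

lemma witt_d_b [simp]: "i \<ge> 0 \<Longrightarrow> witt_d i \<in> carrier witt_b"
  unfolding witt_b_V by (rule witt_d_V) simp

lemma witt_b_eq: "witt_b = witt\<lparr>carrier := carrier witt_b\<rparr>"
  by (simp add: witt_b_def)

lemma witt_V_subset: "witt_V n \<subseteq> carrier witt"
  unfolding witt_V_eq using witt_carrier_iff by blast

lemma witt_V_antimono:
  assumes "m \<le> n" shows "witt_V n \<subseteq> witt_V m"
proof -
  have "Polynomial.monom 1 (m + 1) dvd (Polynomial.monom 1 (n + 1) :: complex poly)"
    using assms by (metis add_le_mono1 le_imp_power_dvd monom_altdef smult_1_left)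
  then show ?thesis unfolding witt_V_eq by (blast intro: dvd_trans)
qed

lemma witt_V_b: "witt_V n \<subseteq> carrier witt_b"
  unfolding witt_b_V by (rule witt_V_antimono) simp

lemma submodule_witt_V: "submodule (witt_V n) complex_ring witt"
  unfolding witt_V_eq by (rule submodule_witt_dvd)

lemma lie_subalgebra_witt: "lie_subalgebra witt_b witt"
proof (intro lie_subalgebra.intro lie_subalgebra_axioms.intro lie_algebra_witt lie_algebra_b witt_b_eq)
  show "carrier witt_b \<subseteq> carrier witt" unfolding witt_b_V by (rule witt_V_subset)
qed

lemmas witt_b_mem = lie_subalgebra.subalgebra_mem[OF lie_subalgebra_witt]

text \<open>For \<open>x = f d/dt\<close> the polynomial \<open>f\<close> is \<open>x(t)\<close>, so this is \<open>f(0)\<close>, the coefficient of \<open>d\<^sub>-\<^sub>1\<close> in \<open>x\<close>.\<close>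

definition witt_const :: "poly_op \<Rightarrow> complex" where
  "witt_const x = Polynomial.coeff (x [:0, 1:]) 0"

definition witt_proj :: "poly_op \<Rightarrow> poly_op" where
  "witt_proj x = (\<lambda>p. x p - Polynomial.smult (witt_const x) (pderiv p))"

lemma witt_const_op: "witt_const (\<lambda>p. f * pderiv p) = Polynomial.coeff f 0"
  by (simp add: witt_const_def pderiv_pCons)

lemma witt_d_minus: "witt_d (- 1) = pderiv"
  by (simp add: witt_d_def fun_eq_iff)

lemma witt_b_iff: "x \<in> carrier witt_b \<longleftrightarrow> x \<in> carrier witt \<and> witt_const x = 0"
proof -
  have "Polynomial.monom 1 1 dvd f \<longleftrightarrow> Polynomial.coeff f 0 = 0" for f :: "complex poly"
  proof -
    have "Polynomial.monom 1 1 = [:- 0, 1 :: complex:]" by (simp add: monom_Suc)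
    then show ?thesis by (simp only: poly_eq_0_iff_dvd[symmetric]) (simp add: poly_0_coeff_0)
  qed
  note d = this
  show ?thesis
    unfolding witt_b_V witt_V_eq witt_carrier_iff
    by (auto simp: d[simplified] witt_const_op)
qed

lemma witt_decomp:
  assumes "x \<in> carrier witt"
  shows "witt_proj x \<in> carrier witt_b" "x = witt_proj x \<oplus>\<^bsub>witt\<^esub> witt_const x \<odot>\<^bsub>witt\<^esub> witt_d (- 1)"
proof -
  obtain f where f: "x = (\<lambda>p. f * pderiv p)" using assms witt_carrier_iff by blast
  have "witt_proj x = (\<lambda>p. (f - [:Polynomial.coeff f 0:]) * pderiv p)"
    unfolding witt_proj_def f witt_const_op by (simp add: algebra_simps)
  moreover have "\<dots> \<in> carrier witt_b"
    unfolding witt_b_iff witt_const_op witt_carrier_iff by auto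
  ultimately show "witt_proj x \<in> carrier witt_b" by simp
  show "x = witt_proj x \<oplus>\<^bsub>witt\<^esub> witt_const x \<odot>\<^bsub>witt\<^esub> witt_d (- 1)"
    by (simp add: witt_d_minus witt_proj_def witt_def)
qed

lemma codim_one_witt: "lie_module witt_b B \<Longrightarrow> codim_one_induced witt_b witt B (witt_d (- 1)) witt_const witt_proj"
  by (intro codim_one_induced.intro induced_module.intro codim_one_induced_axioms.intro lie_subalgebra_witt)
    (use witt_decomp witt_b_iff in \<open>auto simp: witt_const_def\<close>, simp_all add: witt_def)

lemma (in lie_subalgebra) lie_module_restrict: "lie_module L V \<Longrightarrow> lie_module K V"
proof -
  assume "lie_module L V"
  then interpret V: lie_module L V .
  show ?thesis
    by (intro lie_module.intro K.lie_algebra_axioms V.V.module_axioms lie_module_axioms.intro)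
      (simp_all add: subalgebra_ops subalgebra_mem V.act_closed V.act_add_left V.act_add_right
        V.act_smult_left V.act_smult_right V.act_bracket)
qed

section \<open>Submodules of a module\<close>

lemma (in lie_module) lie_submoduleI:
  assumes "N \<subseteq> carrier V" "\<zero>\<^bsub>V\<^esub> \<in> N" "\<And>v w. v \<in> N \<Longrightarrow> w \<in> N \<Longrightarrow> v \<oplus>\<^bsub>V\<^esub> w \<in> N"
    "\<And>a v. v \<in> N \<Longrightarrow> a \<odot>\<^bsub>V\<^esub> v \<in> N" "\<And>x v. x \<in> carrier L \<Longrightarrow> v \<in> N \<Longrightarrow> x \<rhd>\<^bsub>V\<^esub> v \<in> N"
  shows "lie_submodule L N V"
  unfolding lie_submodule_def
proof (intro conjI ballI V.submoduleI)
  fix v assume "v \<in> N"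
  then show "\<ominus>\<^bsub>V\<^esub> v \<in> N" using assms(1) assms(4)[of v "-1"] smult_minus_oneV[of v] by auto
qed (use assms in auto)

lemma (in lie_module) lie_submoduleD:
  assumes "lie_submodule L N V"
  shows "N \<subseteq> carrier V" "\<zero>\<^bsub>V\<^esub> \<in> N" "\<And>v w. v \<in> N \<Longrightarrow> w \<in> N \<Longrightarrow> v \<oplus>\<^bsub>V\<^esub> w \<in> N"
    "\<And>a v. v \<in> N \<Longrightarrow> a \<odot>\<^bsub>V\<^esub> v \<in> N" "\<And>v. v \<in> N \<Longrightarrow> \<ominus>\<^bsub>V\<^esub> v \<in> N"
    "\<And>x v. x \<in> carrier L \<Longrightarrow> v \<in> N \<Longrightarrow> x \<rhd>\<^bsub>V\<^esub> v \<in> N"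
proof -
  have s: "submodule N complex_ring V" using assms by (simp add: lie_submodule_def)
  note E = V.submoduleE[OF s]
  show "N \<subseteq> carrier V" "\<And>v w. v \<in> N \<Longrightarrow> w \<in> N \<Longrightarrow> v \<oplus>\<^bsub>V\<^esub> w \<in> N" "\<And>v. v \<in> N \<Longrightarrow> \<ominus>\<^bsub>V\<^esub> v \<in> N"
    "\<And>a v. v \<in> N \<Longrightarrow> a \<odot>\<^bsub>V\<^esub> v \<in> N" using E by auto
  show "\<zero>\<^bsub>V\<^esub> \<in> N" using s by (simp add: submodule_def subgroup_def)
  show "\<And>x v. x \<in> carrier L \<Longrightarrow> v \<in> N \<Longrightarrow> x \<rhd>\<^bsub>V\<^esub> v \<in> N" using assms by (simp add: lie_submodule_def)
qed

section \<open>Lowering the degree\<close>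

text \<open>The set \<open>fil n\<close> consists of the sums of terms \<open>d\<^sub>-\<^sub>1\<^sup>j v\<close> with \<open>j < n\<close> and \<open>v \<in> N\<close>; the recursion is
  Horner's scheme.\<close>

locale witt_submodule = lie_module witt V for V :: "(poly_op, 'v) lie_mod" (structure) +
  fixes N :: "'v set"
  assumes N_sub: "lie_submodule witt_b N V"
begin

sublocale b: lie_module witt_b V by (rule lie_subalgebra.lie_module_restrict[OF lie_subalgebra_witt lie_module_axioms])

lemmas N_mem = b.lie_submoduleD[OF N_sub]

abbreviation D :: "'v \<Rightarrow> 'v" where "D v \<equiv> witt_d (- 1) \<rhd> v"
abbreviation e :: "nat \<Rightarrow> 'v \<Rightarrow> 'v" where "e i v \<equiv> witt_d (int i) \<rhd> v"

primrec fil :: "nat \<Rightarrow> 'v set" where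
  "fil 0 = {\<zero>}"
| "fil (Suc n) = {v \<oplus> D u | v u. v \<in> N \<and> u \<in> fil n}"

primrec dpow :: "nat \<Rightarrow> 'v \<Rightarrow> 'v" where
  "dpow 0 v = v"
| "dpow (Suc n) v = D (dpow n v)"

lemma N_carrier: "v \<in> N \<Longrightarrow> v \<in> carrier V" using N_mem(1) by blast

lemma act_swap:
  assumes "x \<in> carrier witt" "y \<in> carrier witt" "v \<in> carrier V"
  shows "x \<rhd> y \<rhd> v = y \<rhd> x \<rhd> v \<oplus> bracket witt x y \<rhd> v"
  using assms by (simp add: act_bracket V.M.minus_eq act_closed V.M.a_ac V.M.r_neg2 V.M.r_neg)

lemma fil_carrier: "u \<in> fil n \<Longrightarrow> u \<in> carrier V"
  by (induction n arbitrary: u) (auto simp: N_carrier act_closed)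

lemma fil_zero: "\<zero> \<in> fil n"
proof (induction n)
  case (Suc n)
  then show ?case using N_mem(2) by (auto intro!: exI[of _ "\<zero>"])
qed simp

lemma fil_add: "u \<in> fil n \<Longrightarrow> w \<in> fil n \<Longrightarrow> u \<oplus> w \<in> fil n"
proof (induction n arbitrary: u w)
  case (Suc n)
  then obtain v u' v' w' where u: "u = v \<oplus> D u'" "v \<in> N" "u' \<in> fil n" and w: "w = v' \<oplus> D w'" "v' \<in> N" "w' \<in> fil n"
    by auto
  have "u \<oplus> w = (v \<oplus> v') \<oplus> D (u' \<oplus> w')"
    using u w by (simp add: act_add_right act_closed N_carrier fil_carrier V.M.a_ac)
  moreover have "v \<oplus> v' \<in> N" "u' \<oplus> w' \<in> fil n" using u w Suc.IH N_mem(3) by auto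
  ultimately show ?case by auto
qed simp

lemma fil_smult: "u \<in> fil n \<Longrightarrow> a \<odot> u \<in> fil n"
proof (induction n arbitrary: u)
  case (Suc n)
  then obtain v u' where u: "u = v \<oplus> D u'" "v \<in> N" "u' \<in> fil n" by auto
  have "a \<odot> u = a \<odot> v \<oplus> D (a \<odot> u')"
    using u by (simp add: act_smult_right act_closed N_carrier fil_carrier V.smult_r_distr)
  moreover have "a \<odot> v \<in> N" "a \<odot> u' \<in> fil n" using u Suc.IH N_mem(4) by auto
  ultimately show ?case by auto
qed simp

lemma fil_SucI: "v \<in> N \<Longrightarrow> u \<in> fil n \<Longrightarrow> v \<oplus> D u \<in> fil (Suc n)"
  by auto

lemma fil_D: "u \<in> fil n \<Longrightarrow> D u \<in> fil (Suc n)"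
  using fil_SucI[OF N_mem(2), of u n] fil_carrier[of u n] by (simp add: act_closed del: fil.simps)

lemma fil_N: "v \<in> N \<Longrightarrow> v \<in> fil (Suc n)"
  using fil_SucI[OF _ fil_zero, of v n] N_carrier[of v] by (simp del: fil.simps)

lemma fil_Suc: "u \<in> fil n \<Longrightarrow> u \<in> fil (Suc n)"
proof (induction n arbitrary: u)
  case 0 then show ?case using fil_zero[of 1] by simp
next
  case (Suc n)
  then obtain v u' where u: "u = v \<oplus> D u'" "v \<in> N" "u' \<in> fil n" by auto
  then have "u' \<in> fil (Suc n)" using Suc.IH by blast
  then show ?case using u(1,2) unfolding fil.simps(2)[of "Suc n"] by blast
qed

lemma fil_mono: "m \<le> n \<Longrightarrow> u \<in> fil m \<Longrightarrow> u \<in> fil n"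
  by (induction n rule: dec_induct) (auto intro: fil_Suc simp del: fil.simps)

lemma fil_b: "x \<in> carrier witt_b \<Longrightarrow> u \<in> fil n \<Longrightarrow> x \<rhd> u \<in> fil n"
proof (induction n arbitrary: x u)
  case 0 then show ?case by (simp add: witt_b_mem)
next
  case (Suc n)
  then obtain v u' where u: "u = v \<oplus> D u'" "v \<in> N" "u' \<in> fil n" by auto
  have x: "x \<in> carrier witt" using Suc.prems witt_b_mem by blast
  let ?y = "bracket witt x (witt_d (- 1))"
  have y: "?y \<in> carrier witt" using x by (simp add: bracket_closed)
  have u': "u' \<in> carrier V" "v \<in> carrier V" using u by (simp_all add: fil_carrier N_carrier)
  have "x \<rhd> u = x \<rhd> v \<oplus> (D (x \<rhd> u') \<oplus> ?y \<rhd> u')"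
    using x u' act_swap[OF x, of "witt_d (- 1)" u'] by (simp add: u(1) act_add_right act_closed)
  also have "?y \<rhd> u' = (witt_proj ?y \<oplus>\<^bsub>witt\<^esub> witt_const ?y \<odot>\<^bsub>witt\<^esub> witt_d (- 1)) \<rhd> u'"
    using witt_decomp(2)[OF y] by simp
  also have "\<dots> = witt_proj ?y \<rhd> u' \<oplus> witt_const ?y \<odot> D u'"
    using u' witt_decomp(1)[OF y] witt_b_mem by (simp add: act_add_left act_smult_left)
  finally have eq: "x \<rhd> u = x \<rhd> v \<oplus> (D (x \<rhd> u') \<oplus> (witt_proj ?y \<rhd> u' \<oplus> witt_const ?y \<odot> D u'))" .
  have "x \<rhd> v \<in> fil (Suc n)" using Suc.prems(1) u(2) N_mem(6) fil_N by blast
  moreover have "D (x \<rhd> u') \<in> fil (Suc n)" using Suc.IH[OF Suc.prems(1) u(3)] by (rule fil_D)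
  moreover have "witt_proj ?y \<rhd> u' \<in> fil (Suc n)" using Suc.IH[OF witt_decomp(1)[OF y] u(3)] by (rule fil_Suc)
  moreover have "witt_const ?y \<odot> D u' \<in> fil (Suc n)" using fil_D[OF u(3)] by (rule fil_smult)
  ultimately show ?case unfolding eq by (intro fil_add)
qed

text \<open>Stability under \<open>\<bb>\<close> and under \<open>d\<^sub>-\<^sub>1\<close> gives stability under \<open>\<WW> = \<bb> \<oplus> \<complex> d\<^sub>-\<^sub>1\<close>.\<close>

lemma fil_total_submodule: "lie_submodule witt (\<Union>n. fil n) V"
proof (rule lie_submoduleI)
  show "(\<Union>n. fil n) \<subseteq> carrier V" using fil_carrier by blast
  show "\<zero> \<in> (\<Union>n. fil n)" using fil_zero by blast
  fix u assume "u \<in> (\<Union>n. fil n)"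
  then obtain n where n: "u \<in> fil n" by (elim UN_E)
  show "a \<odot> u \<in> (\<Union>n. fil n)" for a using fil_smult[OF n] by blast
  show "u \<oplus> w \<in> (\<Union>n. fil n)" if w: "w \<in> (\<Union>n. fil n)" for w
  proof -
    obtain m where m: "w \<in> fil m" using w by (elim UN_E)
    have "u \<in> fil (max m n)" "w \<in> fil (max m n)" using m n by (auto intro: fil_mono[rotated])
    then show ?thesis using fil_add by blast
  qed
  fix x assume x: "x \<in> carrier witt"
  have "x \<rhd> u = (witt_proj x \<oplus>\<^bsub>witt\<^esub> witt_const x \<odot>\<^bsub>witt\<^esub> witt_d (- 1)) \<rhd> u"
    using witt_decomp(2)[OF x] by simp
  also have "\<dots> = witt_proj x \<rhd> u \<oplus> witt_const x \<odot> D u"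
    using fil_carrier[OF n] witt_decomp(1)[OF x] witt_b_mem by (simp add: act_add_left act_smult_left)
  also have "\<dots> \<in> fil (Suc n)"
    using witt_decomp(1)[OF x] n by (intro fil_add fil_smult fil_D fil_Suc[OF fil_b])
  finally show "x \<rhd> u \<in> (\<Union>n. fil n)" by blast
qed

lemma N_fil_total: "N \<subseteq> (\<Union>n. fil n)"
  using fil_N by blast

lemma dpow_fil: "v \<in> N \<Longrightarrow> dpow n v \<in> fil (Suc n)"
proof (induction n)
  case 0 then show ?case using fil_N[of v 0] by (simp del: fil.simps)
next
  case (Suc n) then show ?case using fil_D[of "dpow n v" "Suc n"] by (simp del: fil.simps)
qed

lemma dpow_carrier: "v \<in> carrier V \<Longrightarrow> dpow n v \<in> carrier V"
  by (induction n) (simp_all add: act_closed)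

lemma dpow_add: "v \<in> carrier V \<Longrightarrow> w \<in> carrier V \<Longrightarrow> dpow n (v \<oplus> w) = dpow n v \<oplus> dpow n w"
  by (induction n) (simp_all add: act_add_right dpow_carrier)

lemma dpow_smult: "v \<in> carrier V \<Longrightarrow> dpow n (a \<odot> v) = a \<odot> dpow n v"
  by (induction n) (simp_all add: act_smult_right dpow_carrier)

lemma fil_normal_form:
  "x \<in> fil n \<Longrightarrow> x \<noteq> \<zero> \<Longrightarrow> \<exists>m v u. m < n \<and> v \<in> N \<and> v \<noteq> \<zero> \<and> u \<in> fil m \<and> x = dpow m v \<oplus> u"
proof (induction n arbitrary: x)
  case (Suc n)
  then obtain v u where x: "x = v \<oplus> D u" "v \<in> N" "u \<in> fil n" by auto
  show ?case
  proof (cases "u = \<zero>")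
    case True
    then have "x = dpow 0 v \<oplus> \<zero>" "v \<noteq> \<zero>" using x Suc.prems(2) N_carrier by auto
    moreover have "\<zero> \<in> fil 0" by simp
    ultimately show ?thesis using x(2) by blast
  next
    case False
    then obtain m v' u' where m: "m < n" "v' \<in> N" "v' \<noteq> \<zero>" "u' \<in> fil m" "u = dpow m v' \<oplus> u'"
      using Suc.IH x(3) by blast
    have "x = dpow (Suc m) v' \<oplus> (v \<oplus> D u')"
      using x m by (simp add: act_add_right act_closed dpow_carrier N_carrier fil_carrier V.M.a_ac)
    moreover have "v \<oplus> D u' \<in> fil (Suc m)" using m(4) x(2) by (rule fil_SucI[rotated])
    ultimately show ?thesis using m(1,2,3) by blast
  qed
qed simp

lemma e_Suc_D:
  assumes "u \<in> carrier V" shows "e (Suc i) (D u) = D (e (Suc i) u) \<oplus> (- of_nat (i + 2)) \<odot> e i u"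
proof -
  have "bracket witt (witt_d (int (Suc i))) (witt_d (- 1)) = of_int (- int (i + 2)) \<odot>\<^bsub>witt\<^esub> witt_d (int i)"
    using witt_d_bracket[of "int (Suc i)" "-1"] by (simp add: algebra_simps)
  then show ?thesis using assms act_swap[of "witt_d (int (Suc i))" "witt_d (- 1)" u]
    by (simp add: act_smult_left)
qed

lemma e_0_D:
  assumes "u \<in> carrier V" shows "e 0 (D u) = D (e 0 u) \<oplus> (- 1) \<odot> D u"
proof -
  have "bracket witt (witt_d (int 0)) (witt_d (- 1)) = (- 1) \<odot>\<^bsub>witt\<^esub> witt_d (- 1)"
    using witt_d_bracket[of 0 "-1"] by simp
  then show ?thesis using assms act_swap[of "witt_d (int 0)" "witt_d (- 1)" u]
    by (simp add: act_smult_left)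
qed

lemma e_fil: "u \<in> fil n \<Longrightarrow> e i u \<in> fil n"
  by (rule fil_b) simp_all

end

context lie_module begin

lemma smult_smult: "v \<in> carrier V \<Longrightarrow> a \<odot>\<^bsub>V\<^esub> (b \<odot>\<^bsub>V\<^esub> v) = (a * b) \<odot>\<^bsub>V\<^esub> v"
  by (simp add: smult_assoc1V)

lemma smult_collect:
  "v \<in> carrier V \<Longrightarrow> a \<odot>\<^bsub>V\<^esub> v \<oplus>\<^bsub>V\<^esub> b \<odot>\<^bsub>V\<^esub> v = (a + b) \<odot>\<^bsub>V\<^esub> v"
  by (simp add: smult_l_distrV)

lemma smult_eq_zeroD: "a \<odot>\<^bsub>V\<^esub> v = \<zero>\<^bsub>V\<^esub> \<Longrightarrow> v \<in> carrier V \<Longrightarrow> a \<noteq> 0 \<Longrightarrow> v = \<zero>\<^bsub>V\<^esub>"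
  using smult_smult[of v "inverse a" a] by simp

end

locale witt_lowering = witt_submodule V N for V :: "(poly_op, 'v) lie_mod" (structure) and N +
  fixes r :: nat
  assumes kill: "r < i \<Longrightarrow> v \<in> N \<Longrightarrow> e i v = \<zero>"
    and inj: "v \<in> N \<Longrightarrow> e r v = \<zero> \<Longrightarrow> v = \<zero>"
begin

lemma e_N: "v \<in> N \<Longrightarrow> e i v \<in> N"
  by (rule N_mem(6)) simp_all

lemmas cl = N_carrier fil_carrier act_closed dpow_carrier smult_closedV

text \<open>Moving \<open>d\<^sub>i\<close> past a factor \<open>d\<^sub>-\<^sub>1\<close> costs that factor and lowers the index by one; with \<open>i > r\<close> at least
  one factor is lost before the operator reaches \<open>N\<close> with an index that need not kill.\<close>

lemma e_lower: "r < i \<Longrightarrow> u \<in> fil n \<Longrightarrow> e i u \<in> fil (n - 1)"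
proof (induction n arbitrary: i u)
  case (Suc n)
  then obtain v u' where u: "u = v \<oplus> D u'" "v \<in> N" "u' \<in> fil n" by auto
  obtain j where i: "i = Suc j" using Suc.prems(1) by (cases i) auto
  have "e i u = D (e i u') \<oplus> (- of_nat (j + 2)) \<odot> e j u'"
    using u Suc.prems(1) kill[of i v] e_Suc_D[of u' j] by (simp add: i act_add_right cl del: of_nat_Suc)
  moreover have "D (e i u') \<in> fil n"
  proof (cases n)
    case 0 then show ?thesis using u(3) by simp
  next
    case (Suc m)
    have "e i u' \<in> fil (n - 1)" by (rule Suc.IH) (use Suc.prems u in auto)
    from fil_D[OF this] show ?thesis by (simp add: Suc del: fil.simps)
  qed
  moreover have "(- of_nat (j + 2)) \<odot> e j u' \<in> fil n" using u(3) by (intro fil_smult e_fil)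
  ultimately show ?case by (simp only: diff_Suc_1 fil_add)
qed simp

text \<open>If \<open>r = 0\<close>, an index of at least two has to be lowered twice before it reaches \<open>d\<^sub>0\<close>.\<close>

lemma e_lower2:
  assumes "r = 0" shows "1 < i \<Longrightarrow> u \<in> fil n \<Longrightarrow> e i u \<in> fil (n - 2)"
proof (induction n arbitrary: i u)
  case (Suc n)
  then obtain v u' where u: "u = v \<oplus> D u'" "v \<in> N" "u' \<in> fil n" by auto
  obtain j where i: "i = Suc j" "0 < j" using Suc.prems(1) by (cases i) auto
  have "e i u = D (e i u') \<oplus> (- of_nat (j + 2)) \<odot> e j u'"
    using u assms kill[of i v] e_Suc_D[of u' j] by (simp add: i act_add_right cl del: of_nat_Suc)
  moreover have "D (e i u') \<in> fil (n - 1)"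
  proof (cases "n \<le> 1")
    case True
    have "e i u' \<in> fil (n - 2)" by (rule Suc.IH) (use Suc.prems u in auto)
    then show ?thesis using True by simp
  next
    case False
    have "e i u' \<in> fil (n - 2)" by (rule Suc.IH) (use Suc.prems u in auto)
    from fil_D[OF this] show ?thesis using False by (simp add: Suc_diff_Suc numeral_2_eq_2 del: fil.simps)
  qed
  moreover have "(- of_nat (j + 2)) \<odot> e j u' \<in> fil (n - 1)"
    using u(3) i assms by (intro fil_smult e_lower) auto
  ultimately have "e i u \<in> fil (n - 1)" by (simp only: fil_add)
  then show ?case by (simp add: numeral_2_eq_2 del: fil.simps)
qed simp

text \<open>If \<open>r \<ge> 1\<close>, then \<open>d\<^sub>r\<close> commutes with powers of \<open>d\<^sub>-\<^sub>1\<close> up to lower terms, because \<open>d\<^sub>r\<^sub>-\<^sub>1\<close> still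
  lies in \<open>\<bb>\<close> and does not raise the degree. Each commutation of \<open>d\<^sub>r\<^sub>+\<^sub>1\<close> with \<open>d\<^sub>-\<^sub>1\<close> therefore contributes the same
  leading term, and all other terms are of lower degree.\<close>

lemma e_dpow_Suc:
  assumes "v \<in> N" shows "\<exists>u\<in>fil m. e (Suc s) (dpow m v) = dpow m (e (Suc s) v) \<oplus> u"
proof (induction m)
  case 0
  show ?case using assms by (auto simp: cl)
next
  case (Suc m)
  then obtain u where u: "u \<in> fil m" "e (Suc s) (dpow m v) = dpow m (e (Suc s) v) \<oplus> u" by blast
  let ?u = "D u \<oplus> (- of_nat (s + 2)) \<odot> e s (dpow m v)"
  have "e (Suc s) (dpow (Suc m) v) = D (dpow m (e (Suc s) v) \<oplus> u) \<oplus> (- of_nat (s + 2)) \<odot> e s (dpow m v)"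
    using assms e_Suc_D[of "dpow m v" s] by (simp add: u(2) cl del: of_nat_Suc)
  also have "\<dots> = dpow (Suc m) (e (Suc s) v) \<oplus> ?u"
    using assms u(1) by (simp add: act_add_right cl V.M.a_assoc del: of_nat_Suc)
  finally have "e (Suc s) (dpow (Suc m) v) = dpow (Suc m) (e (Suc s) v) \<oplus> ?u" .
  moreover have "?u \<in> fil (Suc m)" using fil_D[OF u(1)] dpow_fil[OF assms, of m]
    by (intro fil_add fil_smult e_fil)
  ultimately show ?case by blast
qed

lemma e_leading_Suc:
  assumes v: "v \<in> N" and r: "r = Suc s"
  shows "\<exists>u\<in>fil m. e (Suc r) (dpow (Suc m) v) =
    dpow m ((- (of_nat (Suc m) * of_nat (r + 2))) \<odot> e r v) \<oplus> u"
proof (induction m)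
  case 0
  have "e (Suc r) (D v) = (- of_nat (r + 2)) \<odot> e r v"
    using v kill[of "Suc r" v] e_Suc_D[of v r] by (simp add: cl del: of_nat_Suc)
  then show ?case using v by (simp add: cl)
next
  case (Suc m)
  let ?a = "- (of_nat (Suc m) * of_nat (r + 2)) :: complex" and ?b = "- of_nat (r + 2) :: complex"
  obtain u where u: "u \<in> fil m" "e (Suc r) (dpow (Suc m) v) = dpow m (?a \<odot> e r v) \<oplus> u"
    using Suc by blast
  obtain u' where u': "u' \<in> fil (Suc m)" "e r (dpow (Suc m) v) = dpow (Suc m) (e r v) \<oplus> u'"
    using e_dpow_Suc[OF v, of "Suc m" s] r by blast
  have ab: "?a + ?b = - (of_nat (Suc (Suc m)) * of_nat (r + 2))" by (simp add: algebra_simps)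
  have "e (Suc r) (dpow (Suc (Suc m)) v) = D (dpow m (?a \<odot> e r v) \<oplus> u) \<oplus> ?b \<odot> (dpow (Suc m) (e r v) \<oplus> u')"
    using v e_Suc_D[of "dpow (Suc m) v" r] unfolding u(2) u'(2) by (simp add: cl)
  also have "\<dots> = (?a \<odot> dpow (Suc m) (e r v) \<oplus> ?b \<odot> dpow (Suc m) (e r v)) \<oplus> (D u \<oplus> ?b \<odot> u')"
  proof -
    have "D (dpow m (?a \<odot> e r v) \<oplus> u) = ?a \<odot> dpow (Suc m) (e r v) \<oplus> D u"
      using v u(1) dpow_smult[of "e r v" "Suc m" ?a] by (simp add: act_add_right cl)
    moreover have "?b \<odot> (dpow (Suc m) (e r v) \<oplus> u') = ?b \<odot> dpow (Suc m) (e r v) \<oplus> ?b \<odot> u'"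
      using v fil_carrier[OF u'(1)] dpow_carrier[of "e r v" "Suc m"]
      by (intro V.smult_r_distr) (simp_all add: cl)
    moreover have "(p \<oplus> q) \<oplus> (s \<oplus> t) = (p \<oplus> s) \<oplus> (q \<oplus> t)"
      if "p \<in> carrier V" "q \<in> carrier V" "s \<in> carrier V" "t \<in> carrier V" for p q s t
      using that by (simp add: V.M.a_ac)
    ultimately show ?thesis
      using v u(1) fil_carrier[OF u'(1)] dpow_carrier[of "e r v" "Suc m"] by (simp add: cl del: dpow.simps)
  qed
  also have "\<dots> = dpow (Suc m) ((- (of_nat (Suc (Suc m)) * of_nat (r + 2))) \<odot> e r v) \<oplus> (D u \<oplus> ?b \<odot> u')"
    using v dpow_carrier[of "e r v" "Suc m"] smult_collect[of "dpow (Suc m) (e r v)" ?a ?b]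
    unfolding ab by (simp add: dpow_smult cl del: dpow.simps)
  finally have "e (Suc r) (dpow (Suc (Suc m)) v) =
      dpow (Suc m) ((- (of_nat (Suc (Suc m)) * of_nat (r + 2))) \<odot> e r v) \<oplus> (D u \<oplus> ?b \<odot> u')" .
  moreover have "D u \<oplus> ?b \<odot> u' \<in> fil (Suc m)" using fil_D[OF u(1)] u'(1) by (intro fil_add fil_smult)
  ultimately show ?case by blast
qed

text \<open>If \<open>r = 0\<close>, lower terms cannot be neglected: \<open>d\<^sub>0\<close> also acts by the degree, since
  \<open>[d\<^sub>0, d\<^sub>-\<^sub>1] = - d\<^sub>-\<^sub>1\<close>. The following formulas are exact.\<close>

lemma e0_dpow:
  assumes "v \<in> N" shows "e 0 (dpow m v) = dpow m (e 0 v \<oplus> (- of_nat m) \<odot> v)"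
proof (induction m)
  case 0 show ?case using assms by (simp add: cl)
next
  case (Suc m)
  let ?p = "dpow (Suc m) (e 0 v)" and ?q = "dpow (Suc m) v"
  have c: "?p \<in> carrier V" "?q \<in> carrier V" using assms by (simp_all add: cl)
  have "e 0 (dpow (Suc m) v) = D (dpow m (e 0 v \<oplus> (- of_nat m) \<odot> v)) \<oplus> (- 1) \<odot> ?q"
    using assms e_0_D[of "dpow m v"] Suc by (simp add: cl)
  also have "D (dpow m (e 0 v \<oplus> (- of_nat m) \<odot> v)) = ?p \<oplus> (- of_nat m) \<odot> ?q"
    using assms by (simp add: dpow_add dpow_smult act_add_right act_smult_right cl)
  also have "?p \<oplus> (- of_nat m) \<odot> ?q \<oplus> (- 1) \<odot> ?q = ?p \<oplus> (- of_nat (Suc m)) \<odot> ?q"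
  proof -
    have "(- of_nat m) \<odot> ?q \<oplus> (- 1) \<odot> ?q = (- of_nat (Suc m)) \<odot> ?q"
      unfolding smult_collect[OF c(2)] by (simp add: algebra_simps)
    then show ?thesis using c by (simp only: V.M.a_assoc smult_closedV)
  qed
  finally show ?case using assms by (simp add: dpow_add dpow_smult cl del: dpow.simps of_nat_Suc)
qed

lemma e1_dpow:
  assumes r: "r = 0" and v: "v \<in> N"
  shows "e 1 (dpow (Suc m) v) =
    dpow m ((of_nat m * of_nat (Suc m)) \<odot> v \<oplus> (- 2 * of_nat (Suc m)) \<odot> e 0 v)"
proof (induction m)
  case 0
  show ?case using v kill[of 1 v] r e_Suc_D[of v 0] by (simp add: cl)
next
  case (Suc m)
  let ?p = "dpow (Suc m) v" and ?q = "dpow (Suc m) (e 0 v)"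
  let ?a = "of_nat m * of_nat (Suc m) :: complex" and ?b = "- 2 * of_nat (Suc m) :: complex"
  have c: "?p \<in> carrier V" "?q \<in> carrier V" using v by (simp_all add: cl)
  have "e 1 (dpow (Suc (Suc m)) v) = D (e 1 ?p) \<oplus> (- 2) \<odot> e 0 ?p"
    using v e_Suc_D[of ?p 0] c by simp
  also have "D (e 1 ?p) = ?a \<odot> ?p \<oplus> ?b \<odot> ?q"
    unfolding Suc using v by (simp add: dpow_add dpow_smult act_add_right act_smult_right cl)
  also have "e 0 ?p = ?q \<oplus> (- of_nat (Suc m)) \<odot> ?p"
    unfolding e0_dpow[OF v] using v by (simp add: dpow_add dpow_smult cl del: dpow.simps)
  also have "?a \<odot> ?p \<oplus> ?b \<odot> ?q \<oplus> (- 2) \<odot> (?q \<oplus> (- of_nat (Suc m)) \<odot> ?p) =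
      (?a \<odot> ?p \<oplus> (2 * of_nat (Suc m)) \<odot> ?p) \<oplus> (?b \<odot> ?q \<oplus> (- 2) \<odot> ?q)"
    using c V.smult_r_distr[of "- 2" ?q "(- of_nat (Suc m)) \<odot> ?p"]
      smult_smult[of ?p "- 2" "- of_nat (Suc m)"]
    by (simp add: V.M.a_ac del: dpow.simps of_nat_Suc)
  also have "?a \<odot> ?p \<oplus> (2 * of_nat (Suc m)) \<odot> ?p = (of_nat (Suc m) * of_nat (Suc (Suc m))) \<odot> ?p"
    unfolding smult_collect[OF c(1)] by (simp add: algebra_simps)
  also have "?b \<odot> ?q \<oplus> (- 2) \<odot> ?q = (- 2 * of_nat (Suc (Suc m))) \<odot> ?q"
    unfolding smult_collect[OF c(2)] by (simp add: algebra_simps)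
  finally show ?case using v by (simp add: dpow_add dpow_smult cl del: dpow.simps of_nat_Suc)
qed

lemma e2_dpow:
  assumes r: "r = 0" and v: "v \<in> N"
  shows "e 2 (dpow (Suc (Suc m)) v) =
    dpow m ((3 * of_nat (Suc m) * of_nat (m + 2)) \<odot> e 0 v \<oplus>
      (- (of_nat m * of_nat (Suc m) * of_nat (m + 2))) \<odot> v)"
proof (induction m)
  case 0
  have 1: "e 1 (D v) = (- 2) \<odot> e 0 v"
    using v kill[of 1 v] r e_Suc_D[of v 0] by (simp add: cl)
  have 2: "e 2 (D v) = \<zero>"
    using v kill[of 2 v] kill[of 1 v] r e_Suc_D[of v 1] by (simp add: cl numeral_2_eq_2)
  have "e 2 (D (D v)) = (- 3) \<odot> ((- 2) \<odot> e 0 v)"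
    using v e_Suc_D[of "D v" 1] 1 2 by (simp add: cl numeral_2_eq_2)
  then show ?case using v smult_smult[of "e 0 v" "- 3" "- 2"] by (simp add: cl)
next
  case (Suc m)
  let ?P = "dpow (Suc (Suc m)) v"
  let ?p = "dpow (Suc m) v" and ?q = "dpow (Suc m) (e 0 v)"
  let ?a = "3 * of_nat (Suc m) * of_nat (m + 2) :: complex"
    and ?b = "- (of_nat m * of_nat (Suc m) * of_nat (m + 2)) :: complex"
    and ?a' = "of_nat (Suc m) * of_nat (Suc (Suc m)) :: complex" and ?b' = "- 2 * of_nat (Suc (Suc m)) :: complex"
  have c: "?p \<in> carrier V" "?q \<in> carrier V" "?P \<in> carrier V" using v by (simp_all add: cl)
  have "e 2 (dpow (Suc (Suc (Suc m))) v) = D (e 2 ?P) \<oplus> (- 3) \<odot> e 1 ?P"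
    using e_Suc_D[OF c(3), of 1] by (simp add: numeral_2_eq_2)
  also have "D (e 2 ?P) = ?a \<odot> ?q \<oplus> ?b \<odot> ?p"
    unfolding Suc using v by (simp add: dpow_add dpow_smult act_add_right act_smult_right cl del: of_nat_Suc of_nat_add)
  also have "e 1 ?P = ?a' \<odot> ?p \<oplus> ?b' \<odot> ?q"
    unfolding e1_dpow[OF r v] using v by (simp add: dpow_add dpow_smult cl del: dpow.simps of_nat_Suc)
  also have "?a \<odot> ?q \<oplus> ?b \<odot> ?p \<oplus> (- 3) \<odot> (?a' \<odot> ?p \<oplus> ?b' \<odot> ?q) =
      (?a \<odot> ?q \<oplus> (- 3 * ?b') \<odot> ?q) \<oplus> (?b \<odot> ?p \<oplus> (- 3 * ?a') \<odot> ?p)"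
  proof -
    have ac: "(s \<oplus> t) \<oplus> (x \<oplus> y) = (s \<oplus> y) \<oplus> (t \<oplus> x)"
      if "s \<in> carrier V" "t \<in> carrier V" "x \<in> carrier V" "y \<in> carrier V" for s t x y
      using that by (simp add: V.M.a_ac)
    have "(- 3) \<odot> (?a' \<odot> ?p \<oplus> ?b' \<odot> ?q) = (- 3 * ?a') \<odot> ?p \<oplus> (- 3 * ?b') \<odot> ?q"
      using V.smult_r_distr[of "- 3" "?a' \<odot> ?p" "?b' \<odot> ?q"] c smult_smult[OF c(1), of "- 3" ?a']
        smult_smult[OF c(2), of "- 3" ?b'] by (simp del: dpow.simps of_nat_Suc)
    then show ?thesis by (simp only:) (rule ac; use c in simp)
  qed
  also have "?a \<odot> ?q \<oplus> (- 3 * ?b') \<odot> ?q = (3 * of_nat (Suc (Suc m)) * of_nat (Suc m + 2)) \<odot> ?q"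
    unfolding smult_collect[OF c(2)] by (simp add: algebra_simps)
  also have "?b \<odot> ?p \<oplus> (- 3 * ?a') \<odot> ?p = (- (of_nat (Suc m) * of_nat (Suc (Suc m)) * of_nat (Suc m + 2))) \<odot> ?p"
    unfolding smult_collect[OF c(1)] by (simp add: algebra_simps)
  finally show ?case using v by (simp add: dpow_add dpow_smult cl del: dpow.simps of_nat_Suc of_nat_add)
qed

text \<open>Induction on the degree \<open>n\<close>. For \<open>r \<ge> 1\<close> the operator \<open>d\<^sub>r\<^sub>+\<^sub>1\<close> lowers it by one. For \<open>r = 0\<close> the
  operator \<open>d\<^sub>1\<close> does so unless the new leading coefficient vanishes; that determines \<open>d\<^sub>0 v\<close>, and with
  this value the leading coefficient after applying \<open>d\<^sub>2\<close> is nonzero.\<close>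

lemma lowering:
  assumes M: "lie_submodule witt_b M V"
  shows "v \<in> N \<Longrightarrow> v \<noteq> \<zero> \<Longrightarrow> u \<in> fil n \<Longrightarrow> dpow n v \<oplus> u \<in> M \<Longrightarrow> \<exists>w\<in>N \<inter> M. w \<noteq> \<zero>"
proof (induction n arbitrary: v u rule: less_induct)
  case (less n)
  note v = less.prems(1) and u = less.prems(3)
  have eM: "e i (dpow n v \<oplus> u) \<in> M" for i
    by (rule b.lie_submoduleD(6)[OF M _ less.prems(4)]) simp
  have split: "e i (dpow n v \<oplus> u) = e i (dpow n v) \<oplus> e i u" for i
    using v u by (simp add: act_add_right cl)
  show ?case
  proof (cases n)
    case 0
    then have "v \<in> M" using less.prems N_carrier[OF v] by simp
    then show ?thesis using v less.prems(2) by blast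
  next
    case n: (Suc m)
    show ?thesis
    proof (cases r)
      case r: (Suc s)
      let ?a = "- (of_nat (Suc m) * of_nat (r + 2)) :: complex"
      obtain u' where u': "u' \<in> fil m" "e (Suc r) (dpow n v) = dpow m (?a \<odot> e r v) \<oplus> u'"
        using e_leading_Suc[OF v r, of m] n by blast
      have "e (Suc r) u \<in> fil m" using e_lower[of "Suc r" u n] u n by (simp del: fil.simps)
      then have f: "u' \<oplus> e (Suc r) u \<in> fil m" using u' fil_add by blast
      have "?a \<odot> e r v \<noteq> \<zero>"
      proof
        assume "?a \<odot> e r v = \<zero>"
        moreover have "?a \<noteq> 0" by (simp del: of_nat_Suc of_nat_add)
        ultimately have "e r v = \<zero>" using smult_eq_zeroD v by (simp add: cl)
        then show False using inj[OF v] less.prems(2) by simp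
      qed
      moreover have "?a \<odot> e r v \<in> N" using e_N[OF v] N_mem(4) by blast
      moreover have "dpow m (?a \<odot> e r v) \<oplus> (u' \<oplus> e (Suc r) u) \<in> M"
        using eM[of "Suc r"] v u u'(1) unfolding split u'(2) by (simp add: V.M.a_assoc cl)
      ultimately show ?thesis using less.IH[of m] f n by blast
    next
      case r: 0
      let ?w = "(of_nat m * of_nat (Suc m)) \<odot> v \<oplus> (- 2 * of_nat (Suc m)) \<odot> e 0 v"
      have wN: "?w \<in> N" using e_N[OF v] v N_mem(3,4) by blast
      show ?thesis
      proof (cases "?w = \<zero>")
        case False
        have "e 1 u \<in> fil m" using e_lower[of 1 u n] u n r by (simp del: fil.simps)
        moreover have "dpow m ?w \<oplus> e 1 u \<in> M"
          using eM[of 1] unfolding split unfolding n e1_dpow[OF r v] .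
        ultimately show ?thesis using less.IH[of m ?w "e 1 u"] n wN False by blast
      next
        case True
        \<comment> \<open>The leading coefficient vanishes exactly if \<open>v\<close> is an eigenvector of \<open>d\<^sub>0\<close> with eigenvalue \<open>m/2\<close>.\<close>
        have e0: "e 0 v = (of_nat m / 2) \<odot> v"
        proof -
          have nz: "- 2 * of_nat (Suc m) \<noteq> (0 :: complex)" by (simp del: of_nat_Suc)
          have c: "v \<in> carrier V" "e 0 v \<in> carrier V" using v by (simp_all add: cl)
          have "(inverse (- 2 * of_nat (Suc m))) \<odot> ?w = \<zero>" using True by simp
          moreover have "(inverse (- 2 * of_nat (Suc m))) \<odot> ?w =
              (inverse (- 2 * of_nat (Suc m)) * (of_nat m * of_nat (Suc m))) \<odot> v \<oplus> e 0 v"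
            using c nz V.smult_r_distr[of "inverse (- 2 * of_nat (Suc m))"
                "(of_nat m * of_nat (Suc m)) \<odot> v" "(- 2 * of_nat (Suc m)) \<odot> e 0 v"]
            by (simp add: smult_smult del: of_nat_Suc)
          moreover have "inverse (- 2 * of_nat (Suc m)) * (of_nat m * of_nat (Suc m)) = (- (of_nat m / 2) :: complex)"
            using of_nat_neq_0[of m, where ?'a = complex] by (simp add: field_simps del: of_nat_Suc)
          ultimately have "(- (of_nat m / 2)) \<odot> v \<oplus> e 0 v = \<zero>" by simp
          then have "(of_nat m / 2) \<odot> v \<oplus> ((- (of_nat m / 2)) \<odot> v \<oplus> e 0 v) = (of_nat m / 2) \<odot> v"
            using c by simp
          moreover have "(of_nat m / 2) \<odot> v \<oplus> ((- (of_nat m / 2)) \<odot> v \<oplus> e 0 v) =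
              ((of_nat m / 2) \<odot> v \<oplus> (- (of_nat m / 2)) \<odot> v) \<oplus> e 0 v"
            using c by (simp add: V.M.a_assoc)
          ultimately show ?thesis using c by (simp add: smult_collect)
        qed
        show ?thesis
        \<comment> \<open>In degree one the eigenvalue is \<open>0\<close>, contrary to injectivity of \<open>d\<^sub>0\<close>.\<close>
        proof (cases m)
          case 0
          then have "e 0 v = \<zero>" using e0 v by (simp add: cl)
          then show ?thesis using inj[OF v] r less.prems(2) by simp
        next
          case m: (Suc p)
          \<comment> \<open>With the eigenvalue \<open>(p + 1)/2\<close> the coefficient in \<open>e2_dpow\<close> is \<open>(p + 1) (p + 2) (p + 3)/2\<close> times \<open>v\<close>.\<close>
          let ?c = "3 * of_nat (Suc p) * of_nat (p + 2) :: complex"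
            and ?d = "- (of_nat p * of_nat (Suc p) * of_nat (p + 2)) :: complex"
          have "?c \<odot> e 0 v \<oplus> ?d \<odot> v = (?c * (of_nat m / 2) + ?d) \<odot> v"
            using v unfolding e0 by (simp add: smult_smult smult_collect cl del: of_nat_Suc of_nat_add)
          also have "?c * (of_nat m / 2) + ?d = of_nat (Suc p) * of_nat (p + 2) * of_nat (p + 3) / 2"
            unfolding m by (simp add: field_simps)
          finally have w: "?c \<odot> e 0 v \<oplus> ?d \<odot> v = (of_nat (Suc p) * of_nat (p + 2) * of_nat (p + 3) / 2) \<odot> v"
            (is "_ = ?k \<odot> v") .
          have "?k \<noteq> 0"
            using of_nat_neq_0[of p, where ?'a = complex] of_nat_neq_0[of "Suc p", where ?'a = complex]
              of_nat_neq_0[of "p + 2", where ?'a = complex] by (simp add: numeral_3_eq_3 del: of_nat_Suc of_nat_add)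
          then have "?k \<odot> v \<noteq> \<zero>" using smult_eq_zeroD[of ?k v] v less.prems(2) by (auto simp: cl)
          moreover have "e 2 u \<in> fil p" using e_lower2[OF r, of 2 u n] u n m by (simp del: fil.simps)
          moreover have "dpow p (?k \<odot> v) \<oplus> e 2 u \<in> M"
            using eM[of 2] unfolding split unfolding n m e2_dpow[OF r v] w .
          ultimately show ?thesis using less.IH[of p "?k \<odot> v" "e 2 u"] n m v N_mem(4)[of v ?k] by auto
        qed
      qed
    qed
  qed
qed

text \<open>A nonzero element of the submodule generated by \<open>N\<close> has a leading term, so lowering applies.\<close>

lemma meets:
  assumes "lie_submodule witt_b M V" "x \<in> M" "x \<in> fil n" "x \<noteq> \<zero>"
  shows "\<exists>w\<in>N \<inter> M. w \<noteq> \<zero>"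
proof -
  obtain m v u where "v \<in> N" "v \<noteq> \<zero>" "u \<in> fil m" "x = dpow m v \<oplus> u"
    using fil_normal_form[OF assms(3,4)] by blast
  then show ?thesis using lowering[OF assms(1)] assms(2) by blast
qed

lemma zero_submodule: "lie_submodule witt_b {\<zero>} V"
  by (rule b.lie_submoduleI) (simp_all add: witt_b_mem)

text \<open>If \<open>u \<noteq> 0\<close>, then \<open>d\<^sub>-\<^sub>1 u - d\<^sub>-\<^sub>1 u = 0\<close> is an expression of positive degree with nonzero leading
  coefficient, because the subtracted \<open>d\<^sub>-\<^sub>1 u\<close>, lying in \<open>N\<close>, is a term of degree \<open>0\<close>. Lowering from the zero submodule
  would find a nonzero vector in it.\<close>

lemma D_independent:
  assumes "u \<in> fil n" "D u \<in> N" shows "u = \<zero>"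
proof (rule ccontr)
  assume "u \<noteq> \<zero>"
  then obtain m v w where m: "v \<in> N" "v \<noteq> \<zero>" "w \<in> fil m" "u = dpow m v \<oplus> w"
    using fil_normal_form[OF assms(1)] by blast
  have "(\<ominus> D u) \<oplus> D w \<in> fil (Suc m)" using N_mem(5)[OF assms(2)] m(3) by (rule fil_SucI)
  moreover have "dpow (Suc m) v \<oplus> (\<ominus> D u \<oplus> D w) = \<zero>"
    using m by (simp add: act_add_right cl V.M.minus_add V.M.a_ac V.M.r_neg V.M.r_neg1 V.M.r_neg2)
  ultimately have "\<exists>w\<in>N \<inter> {\<zero>}. w \<noteq> \<zero>" using lowering[OF zero_submodule m(1,2)] by blast
  then show False by simp
qed

end

section \<open>Isomorphisms, socles and quotients\<close>

lemma lie_mod_iso_inverse: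
  assumes V: "lie_module L V" and f: "f \<in> lie_mod_iso L V W"
  shows "inv_into (carrier V) f \<in> lie_mod_iso L W V"
proof -
  interpret V: lie_module L V by (rule V)
  let ?g = "inv_into (carrier V) f"
  have bij: "bij_betw f (carrier V) (carrier W)" using f by (simp add: lie_mod_iso_def)
  have g: "?g w \<in> carrier V" "f (?g w) = w" if "w \<in> carrier W" for w
    using bij that by (metis bij_betw_def inv_into_into, metis bij_betw_inv_into_right)
  have eq: "?g w = v" if "v \<in> carrier V" "f v = w" for v w
    using bij that by (metis bij_betw_inv_into_left)
  show ?thesis
    unfolding lie_mod_iso_def
    by (intro CollectI conjI allI ballI bij_betw_inv_into[OF bij] eq)
      (use f g in \<open>simp_all add: lie_mod_iso_def V.act_closed\<close>)
qed

lemma lie_mod_isomorphic_sym: "lie_module L V \<Longrightarrow> lie_mod_isomorphic L V W \<Longrightarrow> lie_mod_isomorphic L W V"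
  using lie_mod_iso_inverse unfolding lie_mod_isomorphic_def by blast

lemma lie_mod_iso_compose:
  "f \<in> lie_mod_iso L U V \<Longrightarrow> g \<in> lie_mod_iso L V W \<Longrightarrow> g \<circ> f \<in> lie_mod_iso L U W"
  by (auto simp: lie_mod_iso_def dest: bij_betwE intro: bij_betw_trans)

lemma lie_mod_isomorphic_trans:
  "lie_mod_isomorphic L U V \<Longrightarrow> lie_mod_isomorphic L V W \<Longrightarrow> lie_mod_isomorphic L U W"
  using lie_mod_iso_compose unfolding lie_mod_isomorphic_def by blast

text \<open>A module over a quotient of \<open>\<bb>\<close> and its inflation are different records with the same module structure.
  Fields without meaning for this structure may differ as well.\<close>

lemma module_cong:
  assumes "Module.module complex_ring V"
    and eq: "carrier W = carrier V" "\<zero>\<^bsub>W\<^esub> = \<zero>\<^bsub>V\<^esub>" "add W = add V" "module.smult W = module.smult V"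
  shows "Module.module complex_ring W" "\<And>v. v \<in> carrier V \<Longrightarrow> \<ominus>\<^bsub>W\<^esub> v = \<ominus>\<^bsub>V\<^esub> v"
proof -
  interpret V: Module.module complex_ring V by fact
  have "abelian_group W"
  proof (rule abelian_groupI, goal_cases)
    case (6 v)
    then show ?case using V.M.l_neg[of v] V.M.a_inv_closed[of v] unfolding eq by blast
  qed (simp_all add: eq V.M.a_ac)
  then show W: "Module.module complex_ring W"
    by (rule Module.moduleI[OF cring_complex])
      (use V.smult_l_distr V.smult_assoc1 V.smult_one in \<open>simp_all add: eq V.smult_r_distr\<close>)
  interpret W: Module.module complex_ring W by (rule W)
  show "\<ominus>\<^bsub>W\<^esub> v = \<ominus>\<^bsub>V\<^esub> v" if "v \<in> carrier V" for v
    using that V.M.l_neg[of v] by (intro W.M.minus_equality) (simp_all add: eq)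
qed

lemma lie_module_cong:
  assumes V: "lie_module L V"
    and eq: "carrier W = carrier V" "\<zero>\<^bsub>W\<^esub> = \<zero>\<^bsub>V\<^esub>" "add W = add V" "module.smult W = module.smult V"
      "\<And>x v. x \<in> carrier L \<Longrightarrow> v \<in> carrier V \<Longrightarrow> x \<rhd>\<^bsub>W\<^esub> v = x \<rhd>\<^bsub>V\<^esub> v"
  shows "lie_module L W"
proof -
  interpret V: lie_module L V by (rule V)
  note W = module_cong[OF V.V.module_axioms eq(1-4)]
  show ?thesis
    by (intro lie_module.intro V.lie_algebra_axioms W lie_module_axioms.intro)
      (simp_all add: eq V.act_closed V.act_add_left V.act_add_right V.act_smult_left V.act_smult_right
        V.act_bracket V.bracket_closed a_minus_def W(2))
qed

lemma (in lie_module) lie_module_submodule: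
  assumes "lie_submodule L N V" shows "lie_module L (V\<lparr>carrier := N\<rparr>)"
proof -
  note D = lie_submoduleD[OF assms]
  have s: "submodule N complex_ring V" using assms by (simp add: lie_submodule_def)
  have m: "Module.module complex_ring (V\<lparr>carrier := N\<rparr>)"
    by (rule submodule.submodule_is_module[OF s V.module_axioms])
  interpret N: Module.module complex_ring "V\<lparr>carrier := N\<rparr>" by (rule m)
  have mem: "v \<in> carrier V" if "v \<in> N" for v using D(1) that by blast
  have neg: "\<ominus>\<^bsub>V\<lparr>carrier := N\<rparr>\<^esub> v = \<ominus>\<^bsub>V\<^esub> v" if "v \<in> N" for v
    using D(5)[OF that] mem[OF that] that by (intro N.M.minus_equality) (simp_all add: V.M.l_neg)
  show ?thesis
    by (intro lie_module.intro lie_algebra_axioms m lie_module_axioms.intro)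
      (simp_all add: D(6) mem act_add_left act_add_right act_smult_left act_smult_right act_bracket
        N.M.minus_eq V.M.minus_eq neg)
qed

lemma (in lie_module) lie_submodule_of_submodule:
  assumes N: "lie_submodule L N V" and M: "lie_submodule L M (V\<lparr>carrier := N\<rparr>)"
  shows "lie_submodule L M V" "M \<subseteq> N"
proof -
  interpret N: lie_module L "V\<lparr>carrier := N\<rparr>" by (rule lie_module_submodule[OF N])
  note D = N.lie_submoduleD[OF M]
  show "M \<subseteq> N" using D(1) by simp
  then show "lie_submodule L M V"
    using lie_submoduleD(1)[OF N] D by (intro lie_submoduleI) auto
qed

lemma (in lie_module) lie_submodule_inter:
  assumes "lie_submodule L M V" "lie_submodule L N V" shows "lie_submodule L (M \<inter> N) V"
  using lie_submoduleD[OF assms(1)] lie_submoduleD[OF assms(2)]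
  by (intro lie_submoduleI) auto

lemma (in lie_module) lie_submodule_carrier: "lie_submodule L (carrier V) V"
  by (rule lie_submoduleI) (simp_all add: act_closed)

text \<open>The least nonzero submodule is the only minimal one.\<close>

lemma (in lie_module) socle_least_submodule:
  assumes N: "lie_submodule L N V" "N \<noteq> {\<zero>\<^bsub>V\<^esub>}"
    and least: "\<And>M. lie_submodule L M V \<Longrightarrow> M \<noteq> {\<zero>\<^bsub>V\<^esub>} \<Longrightarrow> N \<subseteq> M"
  shows "lie_socle L V = N" "simple_lie_module L (V\<lparr>carrier := N\<rparr>)"
    "\<Inter>{M. lie_submodule L M V \<and> M \<noteq> {\<zero>\<^bsub>V\<^esub>}} = N"
proof -
  have "minimal_lie_submodule L M V \<longleftrightarrow> M = N" for M
    unfolding minimal_lie_submodule_def using N least by blast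
  then have "{M. minimal_lie_submodule L M V} = {N}" by blast
  then have "lie_socle L V = lin_span V N" by (simp add: lie_socle_def)
  also have "\<dots> = N" unfolding lin_span_def using N(1) by (intro hull_same) (simp add: lie_submodule_def)
  finally show "lie_socle L V = N" .
  show "simple_lie_module L (V\<lparr>carrier := N\<rparr>)"
    unfolding simple_lie_module_def
  proof (intro conjI allI impI)
    show "lie_module L (V\<lparr>carrier := N\<rparr>)" by (rule lie_module_submodule[OF N(1)])
    show "carrier (V\<lparr>carrier := N\<rparr>) \<noteq> {\<zero>\<^bsub>V\<lparr>carrier := N\<rparr>\<^esub>}" using N(2) by simp
    fix M assume "lie_submodule L M (V\<lparr>carrier := N\<rparr>)"
    then have "lie_submodule L M V" "M \<subseteq> N" using lie_submodule_of_submodule[OF N(1)] by blast+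
    then show "M = {\<zero>\<^bsub>V\<lparr>carrier := N\<rparr>\<^esub>} \<or> M = carrier (V\<lparr>carrier := N\<rparr>)"
      using least by auto
  qed
  show "\<Inter>{M. lie_submodule L M V \<and> M \<noteq> {\<zero>\<^bsub>V\<^esub>}} = N" using N least by blast
qed

text \<open>In \<open>quot_lie_alg\<close> scalar multiples and brackets of cosets are unions over all representatives. For
  an ideal these unions are single cosets.\<close>

locale lie_ideal = lie_algebra L for L :: "'l lie_alg" (structure) and I :: "'l set" +
  assumes sub: "submodule I complex_ring L"
    and bracket_ideal: "x \<in> carrier L \<Longrightarrow> y \<in> I \<Longrightarrow> bracket L x y \<in> I"
begin

abbreviation coset :: "'l \<Rightarrow> 'l set" where "coset x \<equiv> I +> x"
abbreviation Q where "Q \<equiv> quot_lie_alg L I"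

lemma I_mem: "x \<in> I \<Longrightarrow> x \<in> carrier L" using submoduleE(1)[OF sub] by blast

lemma I_subgroup: "subgroup I (add_monoid L)" using sub by (simp add: submodule_def)

lemma I_closed: "\<zero> \<in> I" "x \<in> I \<Longrightarrow> y \<in> I \<Longrightarrow> x \<oplus> y \<in> I" "x \<in> I \<Longrightarrow> c \<odot> x \<in> I" "x \<in> I \<Longrightarrow> \<ominus> x \<in> I"
  using submoduleE[OF sub] subgroup.one_closed[OF I_subgroup] by auto

lemma bracket_ideal': "x \<in> I \<Longrightarrow> y \<in> carrier L \<Longrightarrow> bracket L x y \<in> I"
  using bracket_antisym[of y x] bracket_ideal[of y x] I_closed(4) I_mem by simp

lemma coset_mem: "y \<in> coset x \<longleftrightarrow> (\<exists>h\<in>I. y = h \<oplus> x)"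
  by (auto simp: a_r_coset_def')

lemma coset_self: "x \<in> carrier L \<Longrightarrow> x \<in> coset x"
  using I_closed(1) by (auto simp: coset_mem intro!: bexI[of _ \<zero>])

lemma coset_eqI: "x \<in> carrier L \<Longrightarrow> h \<in> I \<Longrightarrow> coset (h \<oplus> x) = coset x"
  by (rule M.a_repr_independence[symmetric, OF _ _ I_subgroup]) (auto simp: coset_mem)

lemma Q_carrier: "carrier Q = coset ` carrier L"
  by (auto simp: quot_lie_alg_def A_RCOSETS_def')

lemma Q_zero: "\<zero>\<^bsub>Q\<^esub> = coset \<zero>"
  using M.a_coset_join2[OF _ I_subgroup I_closed(1)] by (simp add: quot_lie_alg_def)

lemma Q_add: "x \<in> carrier L \<Longrightarrow> y \<in> carrier L \<Longrightarrow> coset x \<oplus>\<^bsub>Q\<^esub> coset y = coset (x \<oplus> y)"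
proof -
  interpret abelian_subgroup I L
    by (rule abelian_subgroupI3) (simp_all add: additive_subgroup.intro I_subgroup M.abelian_group_axioms)
  show "x \<in> carrier L \<Longrightarrow> y \<in> carrier L \<Longrightarrow> coset x \<oplus>\<^bsub>Q\<^esub> coset y = coset (x \<oplus> y)"
    by (simp add: quot_lie_alg_def a_rcos_sum)
qed

lemma Q_smult:
  assumes "x \<in> carrier L" shows "c \<odot>\<^bsub>Q\<^esub> coset x = coset (c \<odot> x)"
proof -
  have "coset (c \<odot> y) = coset (c \<odot> x)" if y: "y \<in> coset x" for y
  proof -
    obtain h where h: "h \<in> I" "y = h \<oplus> x" using y by (auto simp: coset_mem)
    then have "c \<odot> y = c \<odot> h \<oplus> c \<odot> x" using assms I_mem smult_r_distr[of c h x] by simp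
    then show ?thesis using assms h I_closed(3) by (simp add: coset_eqI)
  qed
  moreover have "c \<odot>\<^bsub>Q\<^esub> coset x = (\<Union>y\<in>coset x. coset (c \<odot> y))" by (simp add: quot_lie_alg_def)
  ultimately show ?thesis using coset_self[OF assms] by blast
qed

lemma Q_bracket:
  assumes "x \<in> carrier L" "y \<in> carrier L" shows "bracket Q (coset x) (coset y) = coset (bracket L x y)"
proof -
  have "coset (bracket L x' y') = coset (bracket L x y)" if xy: "x' \<in> coset x" "y' \<in> coset y" for x' y'
  proof -
    obtain h k where h: "h \<in> I" "x' = h \<oplus> x" and k: "k \<in> I" "y' = k \<oplus> y" using xy by (auto simp: coset_mem)
    have "bracket L x' y' = (bracket L h (k \<oplus> y) \<oplus> bracket L x k) \<oplus> bracket L x y"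
      using assms h k I_mem by (simp add: bracket_add_left bracket_add_right bracket_closed M.a_ac)
    moreover have "bracket L h (k \<oplus> y) \<oplus> bracket L x k \<in> I"
      using assms h k I_mem by (simp add: bracket_ideal bracket_ideal' I_closed)
    ultimately show ?thesis using assms by (simp add: coset_eqI bracket_closed)
  qed
  moreover have "bracket Q (coset x) (coset y) = (\<Union>x'\<in>coset x. \<Union>y'\<in>coset y. coset (bracket L x' y'))"
    by (simp add: quot_lie_alg_def)
  ultimately show ?thesis using coset_self[OF assms(1)] coset_self[OF assms(2)] by blast
qed

lemma Q_cases: "X \<in> carrier Q \<Longrightarrow> (\<And>x. x \<in> carrier L \<Longrightarrow> X = coset x \<Longrightarrow> P) \<Longrightarrow> P"
  by (auto simp: Q_carrier)

lemma lie_algebra_quotient: "lie_algebra Q"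
proof -
  note ops = Q_add Q_smult Q_bracket bracket_closed
  have mem: "coset x \<in> carrier Q" if "x \<in> carrier L" for x using that by (simp add: Q_carrier)
  have "abelian_group Q"
  proof (rule abelian_groupI, goal_cases)
    case (6 X)
    then obtain x where "x \<in> carrier L" "X = coset x" by (rule Q_cases)
    then show ?case
      by (intro bexI[of _ "coset (\<ominus> x)"]) (simp_all add: ops mem Q_zero M.l_neg)
  qed (auto elim!: Q_cases simp: ops mem Q_zero M.a_ac)
  then have "Module.module complex_ring Q"
    by (rule Module.moduleI[OF cring_complex])
      (auto elim!: Q_cases simp: ops mem smult_l_distr' smult_assoc1' smult_r_distr)
  then show ?thesis
  proof (rule lie_algebra.intro, unfold_locales, goal_cases)
    case (7 X Y Z)
    then obtain x y z where "x \<in> carrier L" "X = coset x" "y \<in> carrier L" "Y = coset y" "z \<in> carrier L" "Z = coset z"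
      by (elim Q_cases)
    then show ?case by (simp add: ops Q_zero jacobi)
  qed (auto elim!: Q_cases simp: ops mem Q_zero bracket_add_left bracket_add_right bracket_smult_left
      bracket_smult_right bracket_self)
qed

text \<open>A coset acts through an arbitrarily chosen representative. If the ideal acts as zero, the choice
  does not matter.\<close>

definition descend :: "('l, 'v) lie_mod \<Rightarrow> ('l set, 'v) lie_mod" where
  "descend V = \<lparr>carrier = carrier V, monoid.mult = undefined, one = undefined, ring.zero = \<zero>\<^bsub>V\<^esub>,
     add = add V, smult = module.smult V, act = (\<lambda>X. act V (SOME x. x \<in> X))\<rparr>"

lemma descend_act:
  assumes V: "lie_module L V" and kill: "\<And>x v. x \<in> I \<Longrightarrow> v \<in> carrier V \<Longrightarrow> x \<rhd>\<^bsub>V\<^esub> v = \<zero>\<^bsub>V\<^esub>"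
    and x: "x \<in> carrier L" and v: "v \<in> carrier V"
  shows "coset x \<rhd>\<^bsub>descend V\<^esub> v = x \<rhd>\<^bsub>V\<^esub> v"
proof -
  interpret V: lie_module L V by (rule V)
  have "(SOME y. y \<in> coset x) \<in> coset x" using coset_self[OF x] by (rule someI)
  then obtain h where "h \<in> I" "(SOME y. y \<in> coset x) = h \<oplus> x" by (auto simp: coset_mem)
  then show ?thesis using x v kill[of h v] I_mem by (simp add: descend_def V.act_add_left V.act_closed)
qed

lemma lie_module_descend:
  assumes V: "lie_module L V" and kill: "\<And>x v. x \<in> I \<Longrightarrow> v \<in> carrier V \<Longrightarrow> x \<rhd>\<^bsub>V\<^esub> v = \<zero>\<^bsub>V\<^esub>"
  shows "lie_module Q (descend V)"
proof -
  interpret V: lie_module L V by (rule V)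
  have c: "carrier (descend V) = carrier V" "\<zero>\<^bsub>descend V\<^esub> = \<zero>\<^bsub>V\<^esub>" "add (descend V) = add V"
    "module.smult (descend V) = module.smult V" by (simp_all add: descend_def)
  note D = module_cong[OF V.V.module_axioms c]
  note act = descend_act[OF V kill]
  show ?thesis
    by (intro lie_module.intro lie_algebra_quotient D lie_module_axioms.intro)
      (auto elim!: Q_cases simp: c act Q_add Q_smult Q_bracket bracket_closed V.act_closed V.act_add_left
        V.act_add_right V.act_smult_left V.act_smult_right V.act_bracket a_minus_def D(2))
qed

lemma simple_descend:
  assumes V: "simple_lie_module L V" and kill: "\<And>x v. x \<in> I \<Longrightarrow> v \<in> carrier V \<Longrightarrow> x \<rhd>\<^bsub>V\<^esub> v = \<zero>\<^bsub>V\<^esub>"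
  shows "simple_lie_module Q (descend V)"
proof -
  have V': "lie_module L V" using V by (simp add: simple_lie_module_def)
  interpret V: lie_module L V by (rule V')
  interpret D: lie_module Q "descend V" by (rule lie_module_descend[OF V' kill])
  have c: "carrier (descend V) = carrier V" "\<zero>\<^bsub>descend V\<^esub> = \<zero>\<^bsub>V\<^esub>" "add (descend V) = add V"
    "module.smult (descend V) = module.smult V" by (simp_all add: descend_def)
  have "lie_submodule L N V" if N: "lie_submodule Q N (descend V)" for N
  proof (rule V.lie_submoduleI)
    note E = D.lie_submoduleD[OF N, unfolded c]
    show "N \<subseteq> carrier V" "\<zero>\<^bsub>V\<^esub> \<in> N" using E(1,2) by auto
    fix v assume v: "v \<in> N"
    show "v \<oplus>\<^bsub>V\<^esub> w \<in> N" if "w \<in> N" for w using E(3) v that by blast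
    show "a \<odot>\<^bsub>V\<^esub> v \<in> N" for a using E(4) v by blast
    show "x \<rhd>\<^bsub>V\<^esub> v \<in> N" if "x \<in> carrier L" for x
      using E(6)[of "coset x" v] v E(1) that descend_act[OF V' kill that, of v] by (auto simp: Q_carrier)
  qed
  then show ?thesis
    using V D.lie_module_axioms by (auto simp: simple_lie_module_def c)
qed

end

section \<open>Modules induced from the subalgebra\<close>

lemmas (in induced_module)
  lie_module_ind = lie_module_Ind[unfolded Ind_def] and
  ind_unit_ind_closed = ind_unit_closed[unfolded Ind_def] and
  ind_unit_ind_add = ind_unit_add[unfolded Ind_def] and
  ind_unit_ind_smult = ind_unit_smult[unfolded Ind_def] and
  ind_unit_ind_act = ind_unit_act[unfolded Ind_def] and
  ind_generated = Ind_generated[unfolded Ind_def] and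
  ind_universal = Ind_universal[unfolded Ind_def]

lemma induced_witt: "lie_module witt_b B \<Longrightarrow> induced_module witt_b witt B"
  by (intro induced_module.intro lie_subalgebra_witt)

lemmas lie_module_Ind_W = induced_module.lie_module_ind[OF induced_witt]
lemmas Ind_W_generated = induced_module.ind_generated[OF induced_witt]
lemmas ind_unit_W_inj = codim_one_induced.ind_unit_inj[OF codim_one_witt]

lemma ind_unit_W_hom:
  assumes "lie_module witt_b B"
  shows "v \<in> carrier B \<Longrightarrow> ind_unit witt_b witt B v \<in> carrier (Ind_W B)"
    "v \<in> carrier B \<Longrightarrow> w \<in> carrier B \<Longrightarrow>
      ind_unit witt_b witt B (v \<oplus>\<^bsub>B\<^esub> w) = ind_unit witt_b witt B v \<oplus>\<^bsub>Ind_W B\<^esub> ind_unit witt_b witt B w"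
    "v \<in> carrier B \<Longrightarrow> ind_unit witt_b witt B (a \<odot>\<^bsub>B\<^esub> v) = a \<odot>\<^bsub>Ind_W B\<^esub> ind_unit witt_b witt B v"
    "x \<in> carrier witt_b \<Longrightarrow> v \<in> carrier B \<Longrightarrow>
      ind_unit witt_b witt B (x \<rhd>\<^bsub>B\<^esub> v) = x \<rhd>\<^bsub>Ind_W B\<^esub> ind_unit witt_b witt B v"
  using induced_module.ind_unit_ind_closed[OF induced_witt[OF assms]]
    induced_module.ind_unit_ind_add[OF induced_witt[OF assms]]
    induced_module.ind_unit_ind_smult[OF induced_witt[OF assms]]
    induced_module.ind_unit_ind_act[OF induced_witt[OF assms]] by blast+

lemma hom_zero:
  assumes "lie_module K B" "lie_module L V" "\<And>v. v \<in> carrier B \<Longrightarrow> f v \<in> carrier V"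
    "\<And>c v. v \<in> carrier B \<Longrightarrow> f (c \<odot>\<^bsub>B\<^esub> v) = c \<odot>\<^bsub>V\<^esub> f v"
  shows "f \<zero>\<^bsub>B\<^esub> = \<zero>\<^bsub>V\<^esub>"
proof -
  interpret B: lie_module K B by fact
  interpret V: lie_module L V by fact
  show ?thesis using assms(4)[of "\<zero>\<^bsub>B\<^esub>" 0] assms(3)[of "\<zero>\<^bsub>B\<^esub>"] by simp
qed

lemma image_lie_submodule:
  assumes "lie_module L B" "lie_module L V"
    and f: "\<And>v. v \<in> carrier B \<Longrightarrow> f v \<in> carrier V"
      "\<And>v w. v \<in> carrier B \<Longrightarrow> w \<in> carrier B \<Longrightarrow> f (v \<oplus>\<^bsub>B\<^esub> w) = f v \<oplus>\<^bsub>V\<^esub> f w"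
      "\<And>c v. v \<in> carrier B \<Longrightarrow> f (c \<odot>\<^bsub>B\<^esub> v) = c \<odot>\<^bsub>V\<^esub> f v"
      "\<And>x v. x \<in> carrier L \<Longrightarrow> v \<in> carrier B \<Longrightarrow> f (x \<rhd>\<^bsub>B\<^esub> v) = x \<rhd>\<^bsub>V\<^esub> f v"
    and N: "lie_submodule L N B"
  shows "lie_submodule L (f ` N) V"
proof -
  interpret B: lie_module L B by fact
  interpret V: lie_module L V by fact
  note D = B.lie_submoduleD[OF N]
  have mem: "v \<in> carrier B" if "v \<in> N" for v using D(1) that by blast
  have z: "f \<zero>\<^bsub>B\<^esub> = \<zero>\<^bsub>V\<^esub>" by (rule hom_zero[OF assms(1,2) f(1,3)])
  show ?thesis
  proof (rule V.lie_submoduleI)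
    show "f ` N \<subseteq> carrier V" using f(1) mem by blast
    show "\<zero>\<^bsub>V\<^esub> \<in> f ` N" using z D(2) by force
    fix y assume "y \<in> f ` N"
    then obtain v where v: "v \<in> N" "y = f v" by blast
    show "y \<oplus>\<^bsub>V\<^esub> y' \<in> f ` N" if y': "y' \<in> f ` N" for y'
    proof -
      obtain v' where "v' \<in> N" "y' = f v'" using y' by blast
      then show ?thesis using v D(3)[of v v'] f(2)[of v v'] mem by (metis imageI)
    qed
    show "a \<odot>\<^bsub>V\<^esub> y \<in> f ` N" for a using v D(4)[of v a] f(3)[of v a] mem by (metis imageI)
    show "x \<rhd>\<^bsub>V\<^esub> y \<in> f ` N" if "x \<in> carrier L" for x
      using v D(6)[OF that, of v] f(4)[OF that, of v] mem by (metis imageI)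
  qed
qed

lemma vimage_lie_submodule:
  assumes "lie_module L B" "lie_module L V"
    and f: "\<And>v. v \<in> carrier B \<Longrightarrow> f v \<in> carrier V"
      "\<And>v w. v \<in> carrier B \<Longrightarrow> w \<in> carrier B \<Longrightarrow> f (v \<oplus>\<^bsub>B\<^esub> w) = f v \<oplus>\<^bsub>V\<^esub> f w"
      "\<And>c v. v \<in> carrier B \<Longrightarrow> f (c \<odot>\<^bsub>B\<^esub> v) = c \<odot>\<^bsub>V\<^esub> f v"
      "\<And>x v. x \<in> carrier L \<Longrightarrow> v \<in> carrier B \<Longrightarrow> f (x \<rhd>\<^bsub>B\<^esub> v) = x \<rhd>\<^bsub>V\<^esub> f v"
    and M: "lie_submodule L M V"
  shows "lie_submodule L {v \<in> carrier B. f v \<in> M} B"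
proof -
  interpret B: lie_module L B by fact
  interpret V: lie_module L V by fact
  note D = V.lie_submoduleD[OF M]
  have z: "f \<zero>\<^bsub>B\<^esub> = \<zero>\<^bsub>V\<^esub>" by (rule hom_zero[OF assms(1,2) f(1,3)])
  show ?thesis by (rule B.lie_submoduleI) (auto simp: f z D B.act_closed)
qed

text \<open>The universal property extends \<open>f\<close> to a map from \<open>Ind B\<close>. A nonzero element of \<open>Ind B\<close> has a leading
  term, which is mapped to a leading term over \<open>f(B)\<close>; by lowering from the zero submodule the image is
  not zero. Surjectivity holds because \<open>f(B)\<close> generates \<open>V\<close>.\<close>

lemma Ind_W_iso:
  assumes B: "lie_module witt_b B"
    and f: "\<And>v. v \<in> carrier B \<Longrightarrow> f v \<in> carrier V"
      "\<And>v w. v \<in> carrier B \<Longrightarrow> w \<in> carrier B \<Longrightarrow> f (v \<oplus>\<^bsub>B\<^esub> w) = f v \<oplus>\<^bsub>V\<^esub> f w"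
      "\<And>c v. v \<in> carrier B \<Longrightarrow> f (c \<odot>\<^bsub>B\<^esub> v) = c \<odot>\<^bsub>V\<^esub> f v"
      "\<And>x v. x \<in> carrier witt_b \<Longrightarrow> v \<in> carrier B \<Longrightarrow> f (x \<rhd>\<^bsub>B\<^esub> v) = x \<rhd>\<^bsub>V\<^esub> f v"
      "inj_on f (carrier B)"
    and N: "witt_lowering V (f ` carrier B) r"
    and gen: "(\<Union>n. witt_submodule.fil V (f ` carrier B) n) = carrier V"
  shows "lie_mod_isomorphic witt (Ind_W B) V"
proof -
  let ?I = "Ind_W B" and ?\<iota> = "ind_unit witt_b witt B"
  interpret J: witt_lowering V "f ` carrier B" r by (rule N)
  interpret B: lie_module witt_b B by (rule B)
  have V: "lie_module witt V" by (rule J.lie_module_axioms)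
  have I: "lie_module witt ?I" by (rule lie_module_Ind_W[OF B])
  note \<iota> = ind_unit_W_hom[OF B]
  have Ib: "lie_module witt_b ?I" by (rule lie_subalgebra.lie_module_restrict[OF lie_subalgebra_witt I])
  have E: "lie_submodule witt_b (?\<iota> ` carrier B) ?I"
    by (rule image_lie_submodule[OF B Ib \<iota> B.lie_submodule_carrier])
  interpret I: witt_submodule ?I "?\<iota> ` carrier B"
    using I E by (intro witt_submodule.intro witt_submodule_axioms.intro)
  obtain F where F: "\<And>X. X \<in> carrier ?I \<Longrightarrow> F X \<in> carrier V"
      "\<And>X Y. X \<in> carrier ?I \<Longrightarrow> Y \<in> carrier ?I \<Longrightarrow> F (X \<oplus>\<^bsub>?I\<^esub> Y) = F X \<oplus>\<^bsub>V\<^esub> F Y"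
      "\<And>c X. X \<in> carrier ?I \<Longrightarrow> F (c \<odot>\<^bsub>?I\<^esub> X) = c \<odot>\<^bsub>V\<^esub> F X"
      "\<And>x X. x \<in> carrier witt \<Longrightarrow> X \<in> carrier ?I \<Longrightarrow> F (x \<rhd>\<^bsub>?I\<^esub> X) = x \<rhd>\<^bsub>V\<^esub> F X"
      "\<And>v. v \<in> carrier B \<Longrightarrow> F (?\<iota> v) = f v"
    using induced_module.ind_universal[OF induced_witt[OF B] V f(1-4)] by blast
  have F0: "F \<zero>\<^bsub>?I\<^esub> = \<zero>\<^bsub>V\<^esub>" by (rule hom_zero[OF I V F(1,3)])
  have f0: "f \<zero>\<^bsub>B\<^esub> = \<zero>\<^bsub>V\<^esub>" by (rule hom_zero[OF B V f(1,3)])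
  have total: "(\<Union>n. I.fil n) = carrier ?I"
    by (rule Ind_W_generated[OF B I.fil_total_submodule]) (use I.N_fil_total in blast)
  have F_fil: "F X \<in> J.fil n" if "X \<in> I.fil n" for X n
    using that
  proof (induction n arbitrary: X)
    case 0 then show ?case using F0 by simp
  next
    case (Suc n)
    then obtain v Y where X: "v \<in> carrier B" "Y \<in> I.fil n" "X = ?\<iota> v \<oplus>\<^bsub>?I\<^esub> I.D Y" by auto
    have "F X = f v \<oplus>\<^bsub>V\<^esub> J.D (F Y)"
      using X I.fil_carrier[OF X(2)] by (simp add: F \<iota> I.act_closed)
    then show ?case using J.fil_SucI[of "f v" "F Y" n] X Suc.IH by simp
  qed
  have F_dpow: "F (I.dpow n X) = J.dpow n (F X)" if "X \<in> carrier ?I" for X n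
    using that by (induction n) (simp_all add: F I.dpow_carrier)
  have kernel: "X = \<zero>\<^bsub>?I\<^esub>" if X: "X \<in> carrier ?I" "F X = \<zero>\<^bsub>V\<^esub>" for X
  proof (rule ccontr)
    assume nz: "X \<noteq> \<zero>\<^bsub>?I\<^esub>"
    obtain n where "X \<in> I.fil n" using X(1) total by blast
    from I.fil_normal_form[OF this nz] obtain m v U
      where m: "v \<in> carrier B" "?\<iota> v \<noteq> \<zero>\<^bsub>?I\<^esub>" "U \<in> I.fil m" "X = I.dpow m (?\<iota> v) \<oplus>\<^bsub>?I\<^esub> U" by blast
    have "v \<noteq> \<zero>\<^bsub>B\<^esub>" using m(2) hom_zero[OF B I \<iota>(1,3)] by auto
    then have "f v \<noteq> \<zero>\<^bsub>V\<^esub>" using f0 inj_onD[OF f(5), of v "\<zero>\<^bsub>B\<^esub>"] m(1) by auto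
    moreover have "J.dpow m (f v) \<oplus>\<^bsub>V\<^esub> F U \<in> {\<zero>\<^bsub>V\<^esub>}"
      using X(2) m I.fil_carrier[OF m(3)] by (simp add: F \<iota> F_dpow I.dpow_carrier)
    ultimately have "\<exists>w\<in>f ` carrier B \<inter> {\<zero>\<^bsub>V\<^esub>}. w \<noteq> \<zero>\<^bsub>V\<^esub>"
      using J.lowering[OF J.zero_submodule, of "f v" "F U" m] F_fil[OF m(3)] m(1) by blast
    then show False by simp
  qed
  have "inj_on F (carrier ?I)"
  proof (rule inj_onI)
    fix X Y assume XY: "X \<in> carrier ?I" "Y \<in> carrier ?I" "F X = F Y"
    have Y': "(- 1) \<odot>\<^bsub>?I\<^esub> Y \<in> carrier ?I" using XY(2) by (rule I.smult_closedV)
    have "F (X \<oplus>\<^bsub>?I\<^esub> (- 1) \<odot>\<^bsub>?I\<^esub> Y) = F Y \<oplus>\<^bsub>V\<^esub> (- 1) \<odot>\<^bsub>V\<^esub> F Y"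
      using F(2)[OF XY(1) Y'] F(3)[OF XY(2)] XY(3) by simp
    also have "\<dots> = \<zero>\<^bsub>V\<^esub>" using F(1)[OF XY(2)] by (simp add: J.smult_minus_oneV J.V.M.r_neg)
    finally have "X \<oplus>\<^bsub>?I\<^esub> (- 1) \<odot>\<^bsub>?I\<^esub> Y = \<zero>\<^bsub>?I\<^esub>" using XY(1) Y' I.V.M.a_closed kernel by blast
    then have "X \<ominus>\<^bsub>?I\<^esub> Y = \<zero>\<^bsub>?I\<^esub>" using XY(2) by (simp add: I.smult_minus_oneV I.V.M.minus_eq)
    then show "X = Y" using XY(1,2) I.V.M.eq_of_minus_eq_zero by blast
  qed
  moreover have "F ` carrier ?I = carrier V"
  proof
    show "F ` carrier ?I \<subseteq> carrier V" using F(1) by blast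
    have "\<exists>X\<in>carrier ?I. F X = y" if "y \<in> J.fil n" for y n
      using that
    proof (induction n arbitrary: y)
      case 0 then show ?case using F0 I.V.M.zero_closed by auto
    next
      case (Suc n)
      then obtain v u where y: "v \<in> carrier B" "u \<in> J.fil n" "y = f v \<oplus>\<^bsub>V\<^esub> J.D u" by auto
      obtain X where X: "X \<in> carrier ?I" "F X = u" using Suc.IH y(2) by blast
      then have "F (?\<iota> v \<oplus>\<^bsub>?I\<^esub> I.D X) = y" using y by (simp add: F \<iota> I.act_closed)
      then show ?case using X y \<iota>(1) I.act_closed I.V.M.a_closed witt_d_closed by blast
    qed
    note onto = this
    show "carrier V \<subseteq> F ` carrier ?I"
    proof
      fix y assume "y \<in> carrier V"
      then have "y \<in> (\<Union>n. J.fil n)" unfolding gen .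
      then obtain n where "y \<in> J.fil n" by (rule UN_E)
      from onto[OF this] show "y \<in> F ` carrier ?I" by auto
    qed
  qed
  ultimately have "F \<in> lie_mod_iso witt ?I V"
    by (auto simp: lie_mod_iso_def bij_betw_def F)
  then show ?thesis unfolding lie_mod_isomorphic_def by blast
qed

section \<open>Vectors annihilated by a tail of the filtration\<close>

locale witt_b_module = lie_module witt_b V for V :: "(poly_op, 'v) lie_mod" (structure)
begin

definition annih :: "nat \<Rightarrow> 'v set" where
  "annih n = {v \<in> carrier V. \<forall>x\<in>witt_V n. x \<rhd> v = \<zero>}"

lemma V_mem: "x \<in> witt_V n \<Longrightarrow> x \<in> carrier witt_b" using witt_V_b by blast

text \<open>The tail \<open>\<VV>\<^sup>(\<^sup>n\<^sup>)\<close> is an ideal of \<open>\<bb>\<close>, so its null vectors are stable under \<open>\<bb>\<close>.\<close>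

lemma annih_submodule: "lie_submodule witt_b (annih n) V"
proof (rule lie_submoduleI)
  fix x v assume x: "x \<in> carrier witt_b" and v: "v \<in> annih n"
  have c: "v \<in> carrier V" using v by (simp add: annih_def)
  have "y \<rhd> x \<rhd> v = \<zero>" if y: "y \<in> witt_V n" for y
  proof -
    have "bracket witt_b x y \<rhd> v = x \<rhd> y \<rhd> v \<ominus> y \<rhd> x \<rhd> v"
      using x V_mem[OF y] c by (rule act_bracket)
    moreover have "bracket witt_b x y \<rhd> v = \<zero>" "y \<rhd> v = \<zero>"
      using v y witt_b_ideal[OF x y] by (auto simp: annih_def)
    ultimately have "\<ominus> (y \<rhd> x \<rhd> v) = \<zero>" using x V_mem[OF y] c by (simp add: V.M.minus_eq act_closed)
    then show ?thesis using x V_mem[OF y] c by (simp add: V.M.add.inv_eq_1_iff act_closed)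
  qed
  then show "x \<rhd> v \<in> annih n" using x c by (simp add: annih_def act_closed)
qed (auto simp: annih_def V_mem act_add_right act_smult_right)

lemma annih_iff:
  assumes "v \<in> carrier V" shows "v \<in> annih n \<longleftrightarrow> (\<forall>i\<ge>int n. witt_d i \<rhd> v = \<zero>)"
proof
  assume "v \<in> annih n"
  then show "\<forall>i\<ge>int n. witt_d i \<rhd> v = \<zero>" using witt_d_V by (auto simp: annih_def)
next
  assume kill: "\<forall>i\<ge>int n. witt_d i \<rhd> v = \<zero>"
  let ?S = "{x \<in> carrier witt_b. x \<rhd> v = \<zero>}"
  interpret w: lie_algebra witt by (rule lie_algebra_witt)
  note ops = lie_subalgebra.subalgebra_ops[OF lie_subalgebra_witt, symmetric]
  have "submodule ?S complex_ring witt"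
  proof (rule Module.module.submoduleI[OF module_witt])
    show "?S \<subseteq> carrier witt" using witt_b_mem by blast
    fix x assume x: "x \<in> ?S"
    have "(- 1) \<odot>\<^bsub>witt_b\<^esub> x \<in> ?S" using x assms by (auto simp: act_smult_left)
    then show "\<ominus>\<^bsub>witt\<^esub> x \<in> ?S" using x w.smult_minus_one[of x] witt_b_mem[of x] by (simp add: ops)
  qed (use assms in \<open>auto simp: ops act_add_left act_smult_left\<close>)
  moreover have "{witt_d i | i. i \<ge> int n} \<subseteq> ?S" using kill by auto
  ultimately have "witt_V n \<subseteq> ?S" unfolding witt_V_def lin_span_def by (intro hull_minimal)
  then show "v \<in> annih n" using assms by (auto simp: annih_def)
qed

lemma annih_0: "v \<in> annih 0 \<longleftrightarrow> v \<in> carrier V \<and> (\<forall>x\<in>carrier witt_b. x \<rhd> v = \<zero>)"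
  by (simp add: annih_def witt_b_V)

lemma annih_step:
  assumes "v \<in> annih (Suc n)" "witt_d (int n) \<rhd> v = \<zero>" shows "v \<in> annih n"
proof -
  have v: "v \<in> carrier V" using assms(1) by (simp add: annih_def)
  have "witt_d i \<rhd> v = \<zero>" if "i \<ge> int n" for i
    using that assms annih_iff[OF v, of "Suc n"] by (cases "i = int n") auto
  then show ?thesis by (simp add: annih_iff[OF v])
qed

text \<open>Every vector of a module in \<open>\<O>\<^sub>\<bb>\<close> lies in some \<open>annih n\<close>. Minimality of \<open>n = r + 1\<close> means that
  \<open>d\<^sub>r\<close> is injective on \<open>annih n\<close>, as a vector in its kernel would lie in \<open>annih r\<close>.\<close>

lemma annih_least:
  assumes nz: "carrier V \<noteq> {\<zero>}"
    and O: "\<forall>v\<in>carrier V. \<exists>n::nat. \<forall>i\<ge>int n. witt_d i \<rhd> v = \<zero>"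
  obtains n where "annih n \<noteq> {\<zero>}" "\<And>m. m < n \<Longrightarrow> annih m = {\<zero>}"
proof -
  obtain v where v: "v \<in> carrier V" "v \<noteq> \<zero>" using nz V.M.zero_closed by blast
  then obtain n :: nat where "\<forall>i\<ge>int n. witt_d i \<rhd> v = \<zero>" using O by blast
  then have "v \<in> annih n" using annih_iff[OF v(1)] by blast
  then have "annih n \<noteq> {\<zero>}" using v(2) by blast
  then have "annih (LEAST n. annih n \<noteq> {\<zero>}) \<noteq> {\<zero>}"
    "\<And>m. m < (LEAST n. annih n \<noteq> {\<zero>}) \<Longrightarrow> annih m = {\<zero>}"
    by (rule LeastI, metis not_less_Least)
  then show thesis by (rule that)
qed

lemma annih_kill: "v \<in> annih (Suc r) \<Longrightarrow> r < i \<Longrightarrow> witt_d (int i) \<rhd> v = \<zero>"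
  using annih_iff[of v "Suc r"] by (auto simp: annih_def)

lemma annih_inj:
  assumes "annih r = {\<zero>}" "v \<in> annih (Suc r)" "witt_d (int r) \<rhd> v = \<zero>" shows "v = \<zero>"
  using annih_step[OF assms(2,3)] assms(1) by blast

end

section \<open>Inducing a simple module\<close>

text \<open>By simplicity the first nonzero \<open>annih n\<close> is the whole module, and \<open>n = 0\<close> would make it trivial.\<close>

lemma simple_b_module_lowering:
  assumes O: "in_cat_O witt_b B" and simple: "simple_lie_module witt_b B" and nontriv: "\<not> trivial_lie_module witt_b B"
  obtains r where "\<forall>i>r. \<forall>v\<in>carrier B. witt_d (int i) \<rhd>\<^bsub>B\<^esub> v = \<zero>\<^bsub>B\<^esub>"
    "\<forall>v\<in>carrier B. witt_d (int r) \<rhd>\<^bsub>B\<^esub> v = \<zero>\<^bsub>B\<^esub> \<longrightarrow> v = \<zero>\<^bsub>B\<^esub>"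
proof -
  have B: "lie_module witt_b B" using O by (simp add: in_cat_O_def)
  interpret B: witt_b_module B by (intro witt_b_module.intro B)
  obtain n where n: "B.annih n \<noteq> {\<zero>\<^bsub>B\<^esub>}" "\<And>m. m < n \<Longrightarrow> B.annih m = {\<zero>\<^bsub>B\<^esub>}"
    using B.annih_least O simple by (auto simp: in_cat_O_def simple_lie_module_def)
  have all: "B.annih n = carrier B"
    using simple n(1) B.annih_submodule by (auto simp: simple_lie_module_def)
  obtain r where r: "n = Suc r"
  proof (cases n)
    case 0
    then have "trivial_lie_module witt_b B" using all B.annih_0 by (auto simp: trivial_lie_module_def)
    then show thesis using nontriv by simp
  qed
  show thesis
    by (rule that[of r]) (use all r B.annih_kill B.annih_inj[OF n(2)[of r]] in auto)
qed

lemma simple_lie_moduleD: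
  "simple_lie_module L V \<Longrightarrow> lie_submodule L N V \<Longrightarrow> N = {\<zero>\<^bsub>V\<^esub>} \<or> N = carrier V"
  by (simp add: simple_lie_module_def)

lemma nonzero_submoduleD:
  assumes "lie_module L V" "lie_submodule L N V" "N \<noteq> {\<zero>\<^bsub>V\<^esub>}" obtains v where "v \<in> N" "v \<noteq> \<zero>\<^bsub>V\<^esub>"
proof -
  interpret lie_module L V by fact
  show thesis using lie_submoduleD(2)[OF assms(2)] assms(3) that by blast
qed

lemma submodule_restrict: "lie_submodule witt M V \<Longrightarrow> lie_submodule witt_b M V"
  using witt_b_mem by (auto simp: lie_submodule_def)

text \<open>All of \<open>1 \<otimes> B\<close> satisfies the hypotheses for lowering. Hence a nonzero \<open>\<bb>\<close>-submodule meets
  \<open>1 \<otimes> B\<close>, contains it by simplicity of \<open>B\<close>, and is everything as soon as it is stable under \<open>\<WW>\<close>.\<close>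

lemma induced_simple:
  assumes O: "in_cat_O witt_b B" and simple: "simple_lie_module witt_b B" and nontriv: "\<not> trivial_lie_module witt_b B"
  shows "simple_lie_module witt (Ind_W B)" "in_cat_O witt (Ind_W B)"
    "ind_unit witt_b witt B \<in> lie_mod_iso witt_b B (socle_module witt_b (Ind_W B))"
proof -
  let ?I = "Ind_W B" and ?\<iota> = "ind_unit witt_b witt B" and ?E = "ind_unit witt_b witt B ` carrier B"
  have B: "lie_module witt_b B" using O by (simp add: in_cat_O_def)
  interpret B: lie_module witt_b B by (rule B)
  obtain r where kill: "\<forall>i>r. \<forall>v\<in>carrier B. witt_d (int i) \<rhd>\<^bsub>B\<^esub> v = \<zero>\<^bsub>B\<^esub>"
    and inj: "\<forall>v\<in>carrier B. witt_d (int r) \<rhd>\<^bsub>B\<^esub> v = \<zero>\<^bsub>B\<^esub> \<longrightarrow> v = \<zero>\<^bsub>B\<^esub>"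
    by (rule simple_b_module_lowering[OF assms])
  have I: "lie_module witt ?I" by (rule lie_module_Ind_W[OF B])
  note \<iota> = ind_unit_W_hom[OF B] and \<iota>_inj = ind_unit_W_inj[OF B]
  have \<iota>0: "?\<iota> \<zero>\<^bsub>B\<^esub> = \<zero>\<^bsub>?I\<^esub>" by (rule hom_zero[OF B I \<iota>(1,3)])
  have \<iota>_nz: "v = \<zero>\<^bsub>B\<^esub>" if "v \<in> carrier B" "?\<iota> v = \<zero>\<^bsub>?I\<^esub>" for v
    using inj_onD[OF \<iota>_inj, of v "\<zero>\<^bsub>B\<^esub>"] that \<iota>0 by simp
  have Ib: "lie_module witt_b ?I" by (rule lie_subalgebra.lie_module_restrict[OF lie_subalgebra_witt I])
  have E: "lie_submodule witt_b ?E ?I"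
    by (rule image_lie_submodule[OF B Ib \<iota> B.lie_submodule_carrier])
  interpret I: witt_lowering ?I ?E r
  proof (intro witt_lowering.intro witt_submodule.intro witt_submodule_axioms.intro witt_lowering_axioms.intro I E)
    fix i v assume "r < i" "v \<in> ?E"
    then obtain w where w: "w \<in> carrier B" "v = ?\<iota> w" by blast
    have "witt_d (int i) \<rhd>\<^bsub>?I\<^esub> v = ?\<iota> (witt_d (int i) \<rhd>\<^bsub>B\<^esub> w)" unfolding w(2) using w(1) by (intro \<iota>(4)[symmetric]) simp_all
    also have "\<dots> = \<zero>\<^bsub>?I\<^esub>" using kill \<open>r < i\<close> w(1) \<iota>0 by simp
    finally show "witt_d (int i) \<rhd>\<^bsub>?I\<^esub> v = \<zero>\<^bsub>?I\<^esub>" .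
  next
    fix v assume "v \<in> ?E" "witt_d (int r) \<rhd>\<^bsub>?I\<^esub> v = \<zero>\<^bsub>?I\<^esub>"
    then obtain w where w: "w \<in> carrier B" "v = ?\<iota> w" by blast
    have "?\<iota> (witt_d (int r) \<rhd>\<^bsub>B\<^esub> w) = witt_d (int r) \<rhd>\<^bsub>?I\<^esub> v" unfolding w(2) using w(1) by (intro \<iota>(4)) simp_all
    then have "witt_d (int r) \<rhd>\<^bsub>B\<^esub> w = \<zero>\<^bsub>B\<^esub>"
      using \<open>witt_d (int r) \<rhd>\<^bsub>?I\<^esub> v = \<zero>\<^bsub>?I\<^esub>\<close> w(1) by (intro \<iota>_nz B.act_closed) simp_all
    then have "w = \<zero>\<^bsub>B\<^esub>" using inj w(1) by blast
    then show "v = \<zero>\<^bsub>?I\<^esub>" using w(2) \<iota>0 by simp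
  qed
  have total: "(\<Union>n. I.fil n) = carrier ?I"
    by (rule Ind_W_generated[OF B I.fil_total_submodule]) (use I.N_fil_total in blast)
  have least: "?E \<subseteq> M" if M: "lie_submodule witt_b M ?I" "M \<noteq> {\<zero>\<^bsub>?I\<^esub>}" for M
  proof -
    obtain x where x: "x \<in> M" "x \<noteq> \<zero>\<^bsub>?I\<^esub>" using nonzero_submoduleD[OF Ib M] .
    have "x \<in> carrier ?I" using I.b.lie_submoduleD(1)[OF M(1)] x(1) by blast
    then have "x \<in> (\<Union>n. I.fil n)" unfolding total .
    then obtain n where n: "x \<in> I.fil n" by (rule UN_E)
    obtain w where w: "w \<in> ?E" "w \<in> M" "w \<noteq> \<zero>\<^bsub>?I\<^esub>" using I.meets[OF M(1) x(1) n x(2)] by (metis IntE)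
    let ?P = "{v \<in> carrier B. ?\<iota> v \<in> M}"
    have "lie_submodule witt_b ?P B" by (rule vimage_lie_submodule[OF B Ib \<iota> M(1)])
    then have P: "?P = {\<zero>\<^bsub>B\<^esub>} \<or> ?P = carrier B" by (rule simple_lie_moduleD[OF simple])
    obtain v where v: "v \<in> carrier B" "w = ?\<iota> v" using w(1) by (rule imageE)
    have vP: "v \<in> ?P" using v w(2) by simp
    have "v \<noteq> \<zero>\<^bsub>B\<^esub>" using v(2) w(3) \<iota>0 by metis
    then have "?P \<noteq> {\<zero>\<^bsub>B\<^esub>}" using vP by (metis singletonD)
    then have PB: "?P = carrier B" using P by simp
    show ?thesis
    proof (rule image_subsetI)
      fix v assume "v \<in> carrier B"
      then have "v \<in> ?P" unfolding PB .
      then show "?\<iota> v \<in> M" by simp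
    qed
  qed
  have E_nz: "?E \<noteq> {\<zero>\<^bsub>?I\<^esub>}"
  proof
    assume E0: "?E = {\<zero>\<^bsub>?I\<^esub>}"
    have "v = \<zero>\<^bsub>B\<^esub>" if "v \<in> carrier B" for v
      using \<iota>_nz[OF that] imageI[OF that, of ?\<iota>] unfolding E0 by simp
    then have "carrier B = {\<zero>\<^bsub>B\<^esub>}" using B.V.M.zero_closed by auto
    then show False using simple by (simp add: simple_lie_module_def)
  qed
  show "simple_lie_module witt ?I"
    unfolding simple_lie_module_def
  proof (intro conjI allI impI I)
    show "carrier ?I \<noteq> {\<zero>\<^bsub>?I\<^esub>}" using E_nz I.N_mem(1,2) by (metis empty_iff subset_singletonD)
    fix M assume M: "lie_submodule witt M ?I"
    show "M = {\<zero>\<^bsub>?I\<^esub>} \<or> M = carrier ?I"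
    proof (cases "M = {\<zero>\<^bsub>?I\<^esub>}")
      case False
      then have "?E \<subseteq> M" by (rule least[OF submodule_restrict[OF M]])
      then have "M = carrier ?I" by (intro Ind_W_generated[OF B M]) (rule subsetD, assumption, rule imageI)
      then show ?thesis ..
    qed simp
  qed
  have soc: "lie_socle witt_b ?I = ?E" by (rule I.b.socle_least_submodule(1)[OF E E_nz least])
  show "?\<iota> \<in> lie_mod_iso witt_b B (socle_module witt_b ?I)"
    using \<iota> \<iota>_inj by (auto simp: lie_mod_iso_def socle_module_def soc bij_betw_def)
  \<comment> \<open>Local nilpotency: if \<open>d\<^sub>j u = 0\<close> for all \<open>j \<ge> n\<close>, then \<open>d\<^sub>i d\<^sub>-\<^sub>1 u = 0\<close> for all \<open>i > n\<close>.\<close>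
  have "\<exists>n. \<forall>i\<ge>n. I.e i x = \<zero>\<^bsub>?I\<^esub>" if "x \<in> I.fil m" for m x
    using that
  proof (induction m arbitrary: x)
    case 0 then show ?case by simp
  next
    case (Suc m)
    then obtain v u where x: "v \<in> ?E" "u \<in> I.fil m" "x = v \<oplus>\<^bsub>?I\<^esub> I.D u" by auto
    obtain n where n: "\<forall>i\<ge>n. I.e i u = \<zero>\<^bsub>?I\<^esub>" using Suc.IH x(2) by blast
    have "I.e i x = \<zero>\<^bsub>?I\<^esub>" if i: "i \<ge> Suc (max n r)" for i
    proof -
      obtain j where j: "i = Suc j" "j \<ge> n" using i by (cases i) auto
      have "I.e i v = \<zero>\<^bsub>?I\<^esub>" using I.kill x(1) i by simp
      moreover have "I.e i (I.D u) = \<zero>\<^bsub>?I\<^esub>"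
      proof -
        have "I.e (Suc j) u = \<zero>\<^bsub>?I\<^esub>" "I.e j u = \<zero>\<^bsub>?I\<^esub>" using n j(2) le_SucI by blast+
        then show ?thesis
          using I.e_Suc_D[OF I.fil_carrier[OF x(2)], of j] unfolding j(1) by (simp del: of_nat_Suc)
      qed
      ultimately show ?thesis
        using x I.N_carrier[OF x(1)] I.fil_carrier[OF x(2)] by (simp add: I.act_add_right I.act_closed)
    qed
    then show ?case by blast
  qed
  note loc = this
  show "in_cat_O witt ?I"
    unfolding in_cat_O_def
  proof (intro conjI I ballI)
    fix x assume "x \<in> carrier ?I"
    then have "x \<in> (\<Union>n. I.fil n)" unfolding total .
    then obtain m where "x \<in> I.fil m" by (rule UN_E)
    from loc[OF this] obtain n where n: "\<forall>i\<ge>n. I.e i x = \<zero>\<^bsub>?I\<^esub>" ..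
    have "witt_d i \<rhd>\<^bsub>?I\<^esub> x = \<zero>\<^bsub>?I\<^esub>" if "i \<ge> int n" for i
      using n[rule_format, of "nat i"] that by simp
    then show "\<exists>n. \<forall>i\<ge>int n. witt_d i \<rhd>\<^bsub>?I\<^esub> x = \<zero>\<^bsub>?I\<^esub>" by blast
  qed
qed

section \<open>The socle of a simple module\<close>

lemma simple_fil_total:
  assumes simple: "simple_lie_module witt W" and N: "lie_submodule witt_b N W" "N \<noteq> {\<zero>\<^bsub>W\<^esub>}"
  shows "(\<Union>n. witt_submodule.fil W N n) = carrier W"
proof -
  have W: "lie_module witt W" using simple by (simp add: simple_lie_module_def)
  interpret W: witt_submodule W N by (intro witt_submodule.intro witt_submodule_axioms.intro W N(1))
  have "(\<Union>n. W.fil n) \<noteq> {\<zero>\<^bsub>W\<^esub>}"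
    using W.N_fil_total N(2) W.N_mem(2) by (metis empty_iff subset_singletonD)
  then show ?thesis using simple_lie_moduleD[OF simple W.fil_total_submodule] by simp
qed

text \<open>Let \<open>A\<close> be the space of vectors annihilated by \<open>\<bb>\<close>. If \<open>d\<^sub>-\<^sub>1 A = 0\<close>, then \<open>A\<close> is a trivial
  \<open>\<WW>\<close>-submodule, so it is zero. Otherwise \<open>d\<^sub>-\<^sub>1 A\<close> is a \<open>\<bb>\<close>-submodule on which \<open>d\<^sub>0\<close> acts as \<open>-1\<close> and
  the \<open>d\<^sub>i\<close> with \<open>i > 0\<close> act as zero. Lowering applies to it with \<open>r = 0\<close> and yields a nonzero vector in
  the intersection of \<open>d\<^sub>-\<^sub>1 A\<close> and \<open>A\<close>, on which \<open>d\<^sub>0\<close> would act both as \<open>-1\<close> and as \<open>0\<close>.\<close>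

lemma no_b_invariants:
  assumes simple: "simple_lie_module witt W" and nontriv: "\<not> trivial_lie_module witt W"
  shows "witt_b_module.annih W 0 = {\<zero>\<^bsub>W\<^esub>}"
proof (rule ccontr)
  have W: "lie_module witt W" using simple by (simp add: simple_lie_module_def)
  have Wb: "lie_module witt_b W" by (rule lie_subalgebra.lie_module_restrict[OF lie_subalgebra_witt W])
  interpret W: lie_module witt W by (rule W)
  interpret b: witt_b_module W by (intro witt_b_module.intro Wb)
  let ?D = "act W (witt_d (- 1))" and ?A = "b.annih 0"
  assume nz: "?A \<noteq> {\<zero>\<^bsub>W\<^esub>}"
  have A: "lie_submodule witt_b ?A W" by (rule b.annih_submodule)
  note Am = b.lie_submoduleD[OF A]
  have Ac: "v \<in> carrier W" and Ak: "\<And>x. x \<in> carrier witt_b \<Longrightarrow> x \<rhd>\<^bsub>W\<^esub> v = \<zero>\<^bsub>W\<^esub>" if "v \<in> ?A" for v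
    using that by (auto simp: b.annih_0)
  have act: "x \<rhd>\<^bsub>W\<^esub> v = witt_proj x \<rhd>\<^bsub>W\<^esub> v \<oplus>\<^bsub>W\<^esub> witt_const x \<odot>\<^bsub>W\<^esub> ?D v"
    if "x \<in> carrier witt" "v \<in> carrier W" for x v
  proof -
    have "x \<rhd>\<^bsub>W\<^esub> v = (witt_proj x \<oplus>\<^bsub>witt\<^esub> witt_const x \<odot>\<^bsub>witt\<^esub> witt_d (- 1)) \<rhd>\<^bsub>W\<^esub> v"
      using witt_decomp(2)[OF that(1)] by simp
    then show ?thesis using that(2) witt_b_mem[OF witt_decomp(1)[OF that(1)]]
      by (simp add: W.act_add_left W.act_smult_left)
  qed
  have bD: "x \<rhd>\<^bsub>W\<^esub> ?D v = ?D (witt_const (bracket witt x (witt_d (- 1))) \<odot>\<^bsub>W\<^esub> v)"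
    if x: "x \<in> carrier witt_b" and v: "v \<in> ?A" for x v
  proof -
    let ?y = "bracket witt x (witt_d (- 1))"
    have y: "?y \<in> carrier witt" using witt_b_mem[OF x] by (simp add: W.bracket_closed)
    have "?y \<rhd>\<^bsub>W\<^esub> v = x \<rhd>\<^bsub>W\<^esub> ?D v \<ominus>\<^bsub>W\<^esub> ?D (x \<rhd>\<^bsub>W\<^esub> v)"
      using witt_b_mem[OF x] Ac[OF v] by (intro W.act_bracket) simp_all
    then have "x \<rhd>\<^bsub>W\<^esub> ?D v = ?y \<rhd>\<^bsub>W\<^esub> v"
      using Ak[OF v x] Ac[OF v] witt_b_mem[OF x] by (simp add: W.V.M.minus_eq W.act_closed)
    also have "\<dots> = witt_const ?y \<odot>\<^bsub>W\<^esub> ?D v"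
      using act[OF y Ac[OF v]] Ak[OF v witt_decomp(1)[OF y]] Ac[OF v] by (simp add: W.act_closed)
    finally show ?thesis using Ac[OF v] by (simp add: W.act_smult_right)
  qed
  have N: "lie_submodule witt_b (?D ` ?A) W"
  proof (rule b.lie_submoduleI)
    show "?D ` ?A \<subseteq> carrier W" using Ac by (auto simp: W.act_closed)
    show "\<zero>\<^bsub>W\<^esub> \<in> ?D ` ?A" using Am(2) by (intro image_eqI[of _ _ "\<zero>\<^bsub>W\<^esub>"]) simp_all
    fix y assume "y \<in> ?D ` ?A"
    then obtain v where v: "v \<in> ?A" "y = ?D v" by blast
    show "y \<oplus>\<^bsub>W\<^esub> y' \<in> ?D ` ?A" if y': "y' \<in> ?D ` ?A" for y'
    proof -
      obtain v' where v': "v' \<in> ?A" "y' = ?D v'" using y' by blast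
      have "y \<oplus>\<^bsub>W\<^esub> y' = ?D (v \<oplus>\<^bsub>W\<^esub> v')" using v v' Ac by (simp add: W.act_add_right)
      then show ?thesis using Am(3) v v' by blast
    qed
    show "a \<odot>\<^bsub>W\<^esub> y \<in> ?D ` ?A" for a
    proof -
      have "a \<odot>\<^bsub>W\<^esub> y = ?D (a \<odot>\<^bsub>W\<^esub> v)" using v Ac by (simp add: W.act_smult_right)
      then show ?thesis using Am(4) v by blast
    qed
    show "x \<rhd>\<^bsub>W\<^esub> y \<in> ?D ` ?A" if "x \<in> carrier witt_b" for x
      using bD[OF that v(1)] Am(4)[OF v(1)] v(2) by simp
  qed
  have e0: "witt_d 0 \<rhd>\<^bsub>W\<^esub> y = (- 1) \<odot>\<^bsub>W\<^esub> y" if y: "y \<in> ?D ` ?A" for y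
  proof -
    obtain v where v: "v \<in> ?A" "y = ?D v" using y by blast
    have "witt_const (bracket witt (witt_d 0) (witt_d (- 1))) = - 1"
      using witt_d_bracket[of 0 "-1"] by (simp add: witt_const_def witt_def witt_d_minus pderiv_pCons)
    then show ?thesis using bD[of "witt_d 0" v] v Ac by (simp add: W.act_smult_right)
  qed
  show False
  proof (cases "?D ` ?A = {\<zero>\<^bsub>W\<^esub>}")
    case True
    have kill: "x \<rhd>\<^bsub>W\<^esub> v = \<zero>\<^bsub>W\<^esub>" if "v \<in> ?A" "x \<in> carrier witt" for x v
    proof -
      have "?D v = \<zero>\<^bsub>W\<^esub>" using True that(1) by blast
      then show ?thesis using act[OF that(2) Ac[OF that(1)]] Ak[OF that(1) witt_decomp(1)[OF that(2)]] by simp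
    qed
    have "lie_submodule witt ?A W"
      by (rule W.lie_submoduleI) (use Am kill in auto)
    then have "?A = carrier W" using simple nz by (auto simp: simple_lie_module_def)
    then show False using nontriv kill by (auto simp: trivial_lie_module_def)
  next
    case False
    interpret L: witt_lowering W "?D ` ?A" 0
    proof (intro witt_lowering.intro witt_submodule.intro witt_submodule_axioms.intro witt_lowering_axioms.intro W N)
      fix i :: nat and y assume i: "0 < i" and "y \<in> ?D ` ?A"
      then obtain v where v: "v \<in> ?A" "y = ?D v" by blast
      obtain j where j: "i = Suc j" using i by (cases i) auto
      have "witt_const (bracket witt (witt_d (int i)) (witt_d (- 1))) = 0"
        using witt_d_bracket[of "int i" "-1"] i
        by (simp add: witt_const_def witt_def witt_d_def pderiv_pCons j nat_add_distrib monom_Suc)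
      then show "witt_d (int i) \<rhd>\<^bsub>W\<^esub> y = \<zero>\<^bsub>W\<^esub>" using bD[of "witt_d (int i)" v] v Ac by simp
    next
      fix y assume y: "y \<in> ?D ` ?A" "witt_d (int 0) \<rhd>\<^bsub>W\<^esub> y = \<zero>\<^bsub>W\<^esub>"
      have "y \<in> carrier W" using y(1) Ac by (auto simp: W.act_closed)
      then show "y = \<zero>\<^bsub>W\<^esub>" using e0[OF y(1)] y(2) W.smult_eq_zeroD[of "- 1" y] by simp
    qed
    obtain v where v: "v \<in> ?A" "v \<noteq> \<zero>\<^bsub>W\<^esub>" using nonzero_submoduleD[OF Wb A nz] .
    have "v \<in> (\<Union>n. L.fil n)" using Ac[OF v(1)] unfolding simple_fil_total[OF simple N False] .
    then obtain n where n: "v \<in> L.fil n" by (rule UN_E)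
    obtain y where y: "y \<in> ?D ` ?A" "y \<in> ?A" "y \<noteq> \<zero>\<^bsub>W\<^esub>"
      using L.meets[OF A v(1) n v(2)] by (metis IntE)
    have "L.e 0 y = \<zero>\<^bsub>W\<^esub>" using Ak[OF y(2)] by simp
    then show False using L.inj[OF y(1)] y(3) by simp
  qed
qed

text \<open>The first nonzero \<open>annih n\<close> is contained in every nonzero \<open>\<bb>\<close>-submodule \<open>M\<close>. By lowering it meets \<open>M\<close>,
  so one may assume \<open>M \<subseteq> annih n\<close>. Then \<open>M\<close> generates \<open>W\<close>, so a vector of \<open>annih n\<close> is a combination
  of translates of \<open>M\<close>; by independence of the translates of \<open>annih n\<close> only the term of degree \<open>0\<close> remains.\<close>

lemma simple_structure:
  assumes O: "in_cat_O witt W" and simple: "simple_lie_module witt W" and nontriv: "\<not> trivial_lie_module witt W"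
  defines "E \<equiv> lie_socle witt_b W"
  obtains r where "witt_lowering W E r" "lie_submodule witt_b E W" "E \<noteq> {\<zero>\<^bsub>W\<^esub>}"
    "\<forall>M. lie_submodule witt_b M W \<longrightarrow> M \<noteq> {\<zero>\<^bsub>W\<^esub>} \<longrightarrow> E \<subseteq> M"
    "\<forall>x\<in>witt_V (Suc r). \<forall>v\<in>E. x \<rhd>\<^bsub>W\<^esub> v = \<zero>\<^bsub>W\<^esub>"
proof -
  have W: "lie_module witt W" using simple by (simp add: simple_lie_module_def)
  have Wb: "lie_module witt_b W" by (rule lie_subalgebra.lie_module_restrict[OF lie_subalgebra_witt W])
  interpret b: witt_b_module W by (intro witt_b_module.intro Wb)
  obtain n where n: "b.annih n \<noteq> {\<zero>\<^bsub>W\<^esub>}" "\<And>m. m < n \<Longrightarrow> b.annih m = {\<zero>\<^bsub>W\<^esub>}"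
    using b.annih_least O simple by (auto simp: in_cat_O_def simple_lie_module_def)
  obtain r where r: "n = Suc r" using no_b_invariants[OF simple nontriv] n(1) by (cases n) auto
  let ?A = "b.annih n"
  have A: "lie_submodule witt_b ?A W" by (rule b.annih_submodule)
  interpret L: witt_lowering W ?A r
    by (intro witt_lowering.intro witt_submodule.intro witt_submodule_axioms.intro witt_lowering_axioms.intro W A)
      (use b.annih_kill b.annih_inj[OF n(2)[of r]] r in auto)
  have total: "(\<Union>k. L.fil k) = carrier W" by (rule simple_fil_total[OF simple A n(1)])
  have sub: "?A \<subseteq> M" if M: "lie_submodule witt_b M W" "M \<noteq> {\<zero>\<^bsub>W\<^esub>}" "M \<subseteq> ?A" for M
  proof
    interpret M: witt_submodule W M by (intro witt_submodule.intro witt_submodule_axioms.intro W M(1))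
    have fil: "M.fil k \<subseteq> L.fil k" for k
    proof (induction k)
      case (Suc k)
      show ?case
      proof
        fix y assume "y \<in> M.fil (Suc k)"
        then obtain m u where "m \<in> M" "u \<in> M.fil k" "y = m \<oplus>\<^bsub>W\<^esub> M.D u" by auto
        then show "y \<in> L.fil (Suc k)" using L.fil_SucI[OF subsetD[OF M(3)] subsetD[OF Suc]] by simp
      qed
    qed simp
    fix v assume v: "v \<in> ?A"
    then have "v \<in> (\<Union>k. M.fil k)" unfolding simple_fil_total[OF simple M(1,2)] by (rule L.N_carrier)
    then obtain k where k: "v \<in> M.fil k" by (rule UN_E)
    show "v \<in> M"
    proof (cases k)
      case 0 then show ?thesis using k M.N_mem(2) by simp
    next
      case (Suc j)
      then obtain m u where u: "m \<in> M" "u \<in> M.fil j" "v = m \<oplus>\<^bsub>W\<^esub> M.D u" using k by auto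
      have c: "m \<in> carrier W" "u \<in> carrier W" using u by (simp_all add: M.N_carrier M.fil_carrier)
      have "M.D u = \<ominus>\<^bsub>W\<^esub> m \<oplus>\<^bsub>W\<^esub> v" using c u(3) by (simp add: L.act_closed b.V.M.r_neg1)
      moreover have "\<ominus>\<^bsub>W\<^esub> m \<oplus>\<^bsub>W\<^esub> v \<in> ?A" 
        by (rule L.N_mem(3)[OF L.N_mem(5)[OF subsetD[OF M(3) u(1)]] v])
      ultimately have "u = \<zero>\<^bsub>W\<^esub>" using L.D_independent[OF subsetD[OF fil u(2)]] by simp
      then show ?thesis using u c by simp
    qed
  qed
  have least: "?A \<subseteq> M" if M: "lie_submodule witt_b M W" "M \<noteq> {\<zero>\<^bsub>W\<^esub>}" for M
  proof -
    obtain x where x: "x \<in> M" "x \<noteq> \<zero>\<^bsub>W\<^esub>" using nonzero_submoduleD[OF Wb M] .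
    have "x \<in> carrier W" using b.lie_submoduleD(1)[OF M(1)] x(1) by blast
    then have "x \<in> (\<Union>k. L.fil k)" unfolding total .
    then obtain k where k: "x \<in> L.fil k" by (rule UN_E)
    have "M \<inter> ?A \<noteq> {\<zero>\<^bsub>W\<^esub>}" using L.meets[OF M(1) x(1) k x(2)] by (metis Int_commute singletonD)
    then have "?A \<subseteq> M \<inter> ?A" by (intro sub b.lie_submodule_inter[OF M(1) A]) simp_all
    then show ?thesis by simp
  qed
  have EA: "E = ?A" unfolding E_def by (rule b.socle_least_submodule(1)[OF A n(1) least])
  show thesis
    by (rule that[of r]) (use L.witt_lowering_axioms A n(1) least r in \<open>auto simp: EA b.annih_def\<close>)
qed

section \<open>Simple modules as induced modules\<close>

lemma lie_module_socle:
  assumes "lie_module witt_b W" "lie_submodule witt_b (lie_socle witt_b W) W"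
  shows "lie_module witt_b (socle_module witt_b W)"
  unfolding socle_module_def using lie_module.lie_module_submodule[OF assms] .

text \<open>Allowing an isomorphic copy \<open>B\<close> of the socle serves three purposes: \<open>B\<close> is the socle itself, the
  socle of another module, or a module inflated from a quotient of \<open>\<bb>\<close>.\<close>

lemma simple_iso_Ind_W:
  assumes W: "in_cat_O witt W" "simple_lie_module witt W" "\<not> trivial_lie_module witt W"
    and B: "lie_module witt_b B"
    and f: "f ` carrier B = lie_socle witt_b W" "inj_on f (carrier B)"
      "\<And>v w. v \<in> carrier B \<Longrightarrow> w \<in> carrier B \<Longrightarrow> f (v \<oplus>\<^bsub>B\<^esub> w) = f v \<oplus>\<^bsub>W\<^esub> f w"
      "\<And>c v. v \<in> carrier B \<Longrightarrow> f (c \<odot>\<^bsub>B\<^esub> v) = c \<odot>\<^bsub>W\<^esub> f v"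
      "\<And>x v. x \<in> carrier witt_b \<Longrightarrow> v \<in> carrier B \<Longrightarrow> f (x \<rhd>\<^bsub>B\<^esub> v) = x \<rhd>\<^bsub>W\<^esub> f v"
  shows "lie_mod_isomorphic witt (Ind_W B) W"
proof -
  obtain r where r: "witt_lowering W (lie_socle witt_b W) r"
    and E: "lie_submodule witt_b (lie_socle witt_b W) W" "lie_socle witt_b W \<noteq> {\<zero>\<^bsub>W\<^esub>}"
    by (rule simple_structure[OF W])
  interpret L: witt_lowering W "lie_socle witt_b W" r by (rule r)
  show ?thesis
  proof (rule Ind_W_iso[OF B _ f(3,4,5,2)])
    show "f v \<in> carrier W" if "v \<in> carrier B" for v
      using imageI[OF that, of f] L.N_carrier unfolding f(1) by simp
    show "witt_lowering W (f ` carrier B) r" unfolding f(1) by (rule r)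
    show "(\<Union>n. witt_submodule.fil W (f ` carrier B) n) = carrier W"
      unfolding f(1) by (rule simple_fil_total[OF W(2) E])
  qed
qed

lemma simple_iso_Ind_socle:
  assumes W: "in_cat_O witt W" "simple_lie_module witt W" "\<not> trivial_lie_module witt W"
  shows "lie_mod_isomorphic witt (Ind_W (socle_module witt_b W)) W"
proof -
  obtain r where E: "lie_submodule witt_b (lie_socle witt_b W) W"
    by (rule simple_structure[OF W])
  have "lie_module witt_b W"
    using W(2) by (intro lie_subalgebra.lie_module_restrict[OF lie_subalgebra_witt]) (simp add: simple_lie_module_def)
  from lie_module_socle[OF this E] show ?thesis
    by (rule simple_iso_Ind_W[OF W, where f = "\<lambda>v. v"]) (simp_all add: socle_module_def)
qed

text \<open>The socle is the least nonzero \<open>\<bb>\<close>-submodule, and an isomorphism preserves the ordering of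
  submodules.\<close>

lemma iso_socle:
  assumes W: "in_cat_O witt W" "simple_lie_module witt W" "\<not> trivial_lie_module witt W"
    and W': "in_cat_O witt W'" "simple_lie_module witt W'" "\<not> trivial_lie_module witt W'"
    and g: "g \<in> lie_mod_iso witt W W'"
  shows "g \<in> lie_mod_iso witt_b (socle_module witt_b W) (socle_module witt_b W')"
proof -
  let ?E = "lie_socle witt_b W" and ?E' = "lie_socle witt_b W'"
  obtain r where E: "lie_submodule witt_b ?E W" "?E \<noteq> {\<zero>\<^bsub>W\<^esub>}"
    and least: "\<forall>M. lie_submodule witt_b M W \<longrightarrow> M \<noteq> {\<zero>\<^bsub>W\<^esub>} \<longrightarrow> ?E \<subseteq> M"
    by (rule simple_structure[OF W])
  obtain r' where E': "lie_submodule witt_b ?E' W'" "?E' \<noteq> {\<zero>\<^bsub>W'\<^esub>}"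
    and least': "\<forall>M. lie_submodule witt_b M W' \<longrightarrow> M \<noteq> {\<zero>\<^bsub>W'\<^esub>} \<longrightarrow> ?E' \<subseteq> M"
    by (rule simple_structure[OF W'])
  have Wb: "lie_module witt_b W" "lie_module witt_b W'"
    using W(2) W'(2)
    by (auto intro!: lie_subalgebra.lie_module_restrict[OF lie_subalgebra_witt] simp: simple_lie_module_def)
  interpret b: lie_module witt_b W by (rule Wb(1))
  interpret b': lie_module witt_b W' by (rule Wb(2))
  have bij: "inj_on g (carrier W)" "g ` carrier W = carrier W'"
    using g by (auto simp: lie_mod_iso_def bij_betw_def)
  have hom: "v \<in> carrier W \<Longrightarrow> g v \<in> carrier W'"
    "v \<in> carrier W \<Longrightarrow> w \<in> carrier W \<Longrightarrow> g (v \<oplus>\<^bsub>W\<^esub> w) = g v \<oplus>\<^bsub>W'\<^esub> g w"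
    "v \<in> carrier W \<Longrightarrow> g (c \<odot>\<^bsub>W\<^esub> v) = c \<odot>\<^bsub>W'\<^esub> g v"
    "x \<in> carrier witt_b \<Longrightarrow> v \<in> carrier W \<Longrightarrow> g (x \<rhd>\<^bsub>W\<^esub> v) = x \<rhd>\<^bsub>W'\<^esub> g v" for v w c x
    using g witt_b_mem[of x] by (auto simp: lie_mod_iso_def bij_betw_def)
  have g0: "g \<zero>\<^bsub>W\<^esub> = \<zero>\<^bsub>W'\<^esub>" by (rule hom_zero[OF Wb hom(1,3)])
  have Ec: "v \<in> carrier W" if "v \<in> ?E" for v using b.lie_submoduleD(1)[OF E(1)] that by blast
  have "?E' \<subseteq> g ` ?E"
  proof -
    obtain v where v: "v \<in> ?E" "v \<noteq> \<zero>\<^bsub>W\<^esub>" by (rule nonzero_submoduleD[OF Wb(1) E])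
    have "g v \<noteq> \<zero>\<^bsub>W'\<^esub>" using inj_onD[OF bij(1), of v "\<zero>\<^bsub>W\<^esub>"] v Ec g0 by auto
    then have nz: "g ` ?E \<noteq> {\<zero>\<^bsub>W'\<^esub>}" using imageI[OF v(1), of g] by (metis singletonD)
    have "lie_submodule witt_b (g ` ?E) W'" by (rule image_lie_submodule[OF Wb hom E(1)])
    then show ?thesis using least' nz by simp
  qed
  moreover have "g ` ?E \<subseteq> ?E'"
  proof -
    let ?P = "{v \<in> carrier W. g v \<in> ?E'}"
    obtain y where y: "y \<in> ?E'" "y \<noteq> \<zero>\<^bsub>W'\<^esub>" by (rule nonzero_submoduleD[OF Wb(2) E'])
    have "y \<in> g ` carrier W" using b'.lie_submoduleD(1)[OF E'(1)] y(1) unfolding bij(2) by (rule subsetD)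
    then obtain v where v: "v \<in> carrier W" "y = g v" by (rule_tac imageE)
    have "v \<in> ?P" using v y(1) by simp
    moreover have "v \<noteq> \<zero>\<^bsub>W\<^esub>" using v(2) y(2) g0 by metis
    ultimately have "?P \<noteq> {\<zero>\<^bsub>W\<^esub>}" by (metis singletonD)
    moreover have "lie_submodule witt_b ?P W" by (rule vimage_lie_submodule[OF Wb hom E'(1)])
    ultimately have "?E \<subseteq> ?P" using least by simp
    then show ?thesis by auto
  qed
  ultimately have "g ` ?E = ?E'" by simp
  moreover have "inj_on g ?E" by (rule inj_on_subset[OF bij(1)]) (use Ec in blast)
  ultimately show ?thesis
    using hom Ec by (simp add: lie_mod_iso_def socle_module_def bij_betw_def)
qed

lemma lie_ideal_witt_V: "lie_ideal witt_b (witt_V n)"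
proof -
  interpret wb: lie_algebra witt_b by (rule lie_algebra_b)
  interpret w: lie_algebra witt by (rule lie_algebra_witt)
  note E = w.submoduleE[OF submodule_witt_V[of n]]
  note ops = lie_subalgebra.subalgebra_ops[OF lie_subalgebra_witt]
  have mem: "x \<in> carrier witt_b" if "x \<in> witt_V n" for x using that witt_V_b by blast
  have smult: "c \<odot>\<^bsub>witt_b\<^esub> x \<in> witt_V n" if "x \<in> witt_V n" for c x using E(4)[of c x] that by (simp add: ops)
  have "submodule (witt_V n) complex_ring witt_b"
  proof (rule wb.submoduleI)
    show "\<zero>\<^bsub>witt_b\<^esub> \<in> witt_V n"
      using submodule_witt_V[of n] by (simp add: ops submodule_def subgroup_def)
    show "\<ominus>\<^bsub>witt_b\<^esub> x \<in> witt_V n" if "x \<in> witt_V n" for x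
      using smult[OF that, of "-1"] wb.smult_minus_one[OF mem[OF that]] by simp
  qed (use mem smult E(5) in \<open>auto simp: ops\<close>)
  then show ?thesis
    by (intro lie_ideal.intro lie_ideal_axioms.intro lie_algebra_b witt_b_ideal)
qed

text \<open>The socle is annihilated by some \<open>\<VV>\<^sup>(\<^sup>r\<^sup>+\<^sup>1\<^sup>)\<close>, so it is a simple module over the quotient.\<close>

lemma simple_iso_Ind_inflate:
  fixes W :: "(poly_op, 'w) lie_mod"
  assumes W: "in_cat_O witt W" "simple_lie_module witt W" "\<not> trivial_lie_module witt W"
  shows "\<exists>r\<ge>1. \<exists>A :: (poly_op set, 'w) lie_mod.
        simple_lie_module (witt_a r) A \<and> lie_mod_isomorphic witt W (Ind_W (inflate r A))"
proof -
  let ?E = "lie_socle witt_b W" and ?S = "socle_module witt_b W"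
  obtain r where E: "lie_submodule witt_b ?E W" "?E \<noteq> {\<zero>\<^bsub>W\<^esub>}"
    and least: "\<forall>M. lie_submodule witt_b M W \<longrightarrow> M \<noteq> {\<zero>\<^bsub>W\<^esub>} \<longrightarrow> ?E \<subseteq> M"
    and kill: "\<forall>x\<in>witt_V (Suc r). \<forall>v\<in>?E. x \<rhd>\<^bsub>W\<^esub> v = \<zero>\<^bsub>W\<^esub>"
    by (rule simple_structure[OF W])
  have Wb: "lie_module witt_b W"
    using W(2) by (intro lie_subalgebra.lie_module_restrict[OF lie_subalgebra_witt]) (simp add: simple_lie_module_def)
  have S: "lie_module witt_b ?S" by (rule lie_module_socle[OF Wb E(1)])
  have S_simple: "simple_lie_module witt_b ?S"
    unfolding socle_module_def
    by (rule lie_module.socle_least_submodule(2)[OF Wb E]) (use least in simp)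
  \<comment> \<open>For \<open>r = 0\<close> the socle is inflated from \<open>\<aa>\<^sub>1\<close>, as only positive indices are wanted.\<close>
  define q where "q = max 1 r"
  have Sk: "x \<rhd>\<^bsub>?S\<^esub> v = \<zero>\<^bsub>?S\<^esub>" if "x \<in> witt_V (q + 1)" "v \<in> carrier ?S" for x v
  proof -
    have "x \<in> witt_V (Suc r)" using witt_V_antimono[of "Suc r" "q + 1"] that(1) by (auto simp: q_def)
    then show ?thesis using kill that(2) by (simp add: socle_module_def)
  qed
  interpret Q: lie_ideal witt_b "witt_V (q + 1)" by (rule lie_ideal_witt_V)
  let ?A = "Q.descend ?S"
  have A: "simple_lie_module (witt_a q) ?A"
    unfolding witt_a_def by (rule Q.simple_descend[OF S_simple Sk])
  have c: "carrier (inflate q ?A) = carrier ?S" "\<zero>\<^bsub>inflate q ?A\<^esub> = \<zero>\<^bsub>?S\<^esub>" "add (inflate q ?A) = add ?S"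
    "module.smult (inflate q ?A) = module.smult ?S"
    by (simp_all add: inflate_def pullback_lie_mod_def Q.descend_def)
  have act: "x \<rhd>\<^bsub>inflate q ?A\<^esub> v = x \<rhd>\<^bsub>?S\<^esub> v" if "x \<in> carrier witt_b" "v \<in> carrier ?S" for x v
    using Q.descend_act[OF S Sk that] by (simp add: inflate_def pullback_lie_mod_def)
  have M: "lie_module witt_b (inflate q ?A)" by (rule lie_module_cong[OF S c act])
  then have "lie_mod_isomorphic witt (Ind_W (inflate q ?A)) W"
    by (rule simple_iso_Ind_W[OF W, where f = "\<lambda>v. v"])
      (use act in \<open>simp_all add: c\<close>, simp_all add: socle_module_def)
  then have "lie_mod_isomorphic witt W (Ind_W (inflate q ?A))"
    by (rule lie_mod_isomorphic_sym[OF lie_module_Ind_W[OF M]])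
  moreover have "q \<ge> 1" by (simp add: q_def)
  ultimately show ?thesis using A by blast
qed

theorem lemma2:
  fixes B :: "(poly_op, 'b) lie_mod"
    and W :: "(poly_op, 'w) lie_mod"
    and W\<^sub>1 :: "(poly_op, 'x) lie_mod"
  assumes "in_cat_O witt_b B" and "simple_lie_module witt_b B" and "\<not> trivial_lie_module witt_b B"
    and "in_cat_O witt W" and "simple_lie_module witt W" and "\<not> trivial_lie_module witt W"
    and "in_cat_O witt W\<^sub>1" and "simple_lie_module witt W\<^sub>1" and "\<not> trivial_lie_module witt W\<^sub>1"
  shows
    "(simple_lie_module witt (Ind_W B) \<and> in_cat_O witt (Ind_W B)) \<and>
     (simple_lie_module witt_b (socle_module witt_b W) \<and>
      lie_socle witt_b W = \<Inter>{N. lie_submodule witt_b N W \<and> N \<noteq> {\<zero>\<^bsub>W\<^esub>}}) \<and>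
     (lie_mod_isomorphic witt W (Ind_W (socle_module witt_b W)) \<and>
      ind_unit witt_b witt B \<in> lie_mod_iso witt_b B (socle_module witt_b (Ind_W B))) \<and>
     (lie_mod_isomorphic witt W W\<^sub>1 \<longleftrightarrow>
      lie_mod_isomorphic witt_b (socle_module witt_b W) (socle_module witt_b W\<^sub>1)) \<and>
     (\<exists>r\<ge>1. \<exists>A :: (poly_op set, 'w) lie_mod.
        simple_lie_module (witt_a r) A \<and> lie_mod_isomorphic witt W (Ind_W (inflate r A)))"
proof (intro conjI)
  note W = assms(4-6) and W\<^sub>1 = assms(7-9)
  show "simple_lie_module witt (Ind_W B)" "in_cat_O witt (Ind_W B)"
    "ind_unit witt_b witt B \<in> lie_mod_iso witt_b B (socle_module witt_b (Ind_W B))"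
    by (rule induced_simple[OF assms(1-3)])+
  let ?E = "lie_socle witt_b W" and ?S = "socle_module witt_b W"
  obtain r where E: "lie_submodule witt_b ?E W" "?E \<noteq> {\<zero>\<^bsub>W\<^esub>}"
    and least: "\<forall>M. lie_submodule witt_b M W \<longrightarrow> M \<noteq> {\<zero>\<^bsub>W\<^esub>} \<longrightarrow> ?E \<subseteq> M"
    by (rule simple_structure[OF W])
  have Wm: "lie_module witt W" using W(2) by (simp add: simple_lie_module_def)
  have Wb: "lie_module witt_b W" by (rule lie_subalgebra.lie_module_restrict[OF lie_subalgebra_witt Wm])
  have S: "lie_module witt_b ?S" by (rule lie_module_socle[OF Wb E(1)])
  show "simple_lie_module witt_b ?S"
    unfolding socle_module_def by (rule lie_module.socle_least_submodule(2)[OF Wb E]) (use least in simp)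
  show "?E = \<Inter>{N. lie_submodule witt_b N W \<and> N \<noteq> {\<zero>\<^bsub>W\<^esub>}}"
    by (rule lie_module.socle_least_submodule(3)[OF Wb E, symmetric]) (use least in simp)
  show WI: "lie_mod_isomorphic witt W (Ind_W ?S)"
    by (rule lie_mod_isomorphic_sym[OF lie_module_Ind_W[OF S] simple_iso_Ind_socle[OF W]])
  show "lie_mod_isomorphic witt W W\<^sub>1 \<longleftrightarrow>
      lie_mod_isomorphic witt_b ?S (socle_module witt_b W\<^sub>1)"
  proof
    assume "lie_mod_isomorphic witt W W\<^sub>1"
    then show "lie_mod_isomorphic witt_b ?S (socle_module witt_b W\<^sub>1)"
      using iso_socle[OF W W\<^sub>1] unfolding lie_mod_isomorphic_def by blast
  next
    assume "lie_mod_isomorphic witt_b ?S (socle_module witt_b W\<^sub>1)"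
    then obtain f where f: "f \<in> lie_mod_iso witt_b ?S (socle_module witt_b W\<^sub>1)"
      unfolding lie_mod_isomorphic_def by blast
    have "lie_mod_isomorphic witt (Ind_W ?S) W\<^sub>1"
      by (rule simple_iso_Ind_W[OF W\<^sub>1 S, where f = f])
        (use f in \<open>simp_all add: lie_mod_iso_def bij_betw_def socle_module_def\<close>)
    with WI show "lie_mod_isomorphic witt W W\<^sub>1" by (rule lie_mod_isomorphic_trans)
  qed
  show "\<exists>r\<ge>1. \<exists>A :: (poly_op set, 'w) lie_mod.
        simple_lie_module (witt_a r) A \<and> lie_mod_isomorphic witt W (Ind_W (inflate r A))"
    by (rule simple_iso_Ind_inflate[OF W])
qed

end
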